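(* For every $\varepsilon>0$ there is an $(\alpha_{\mathsf{FL}}+\varepsilon)$-approximation algorithm for the Facility Location problem that runs in fixed-parameter time, i.e., in time $f(k,\varepsilon)\,n^{O(1)}$ for some function $f$, where $k$ is the number of facilities opened in an optimal solution and $\alpha_{\mathsf{FL}}=\max_{x\ge 0}\big(1+\frac{x}{1+x}\ln\frac{2}{x}\big)\approx 1.463$.
   Context: An instance of Facility Location consists of a finite metric space $(V,d)$ with $n=|V|$ points, a set of clients $C\subseteq V$, a set of facility locations $\mathbb{F}\subseteq V$, and opening costs $\mathrm{open}:\mathbb{F}\to\mathbb{R}^+$. The goal is to choose any $F\subseteq\mathbb{F}$ minimizing $\sum_{f\in F}\mathrm{open}(f)+\sum_{j\in C}d(j,F)$, where $d(j,F)=\min_{f\in F}d(j,f)$. *)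

theory Defs
  imports "HOL-Analysis.Analysis"
begin

record 'a fl_instance =
  points     :: "'a set"
  distance   :: "'a \<Rightarrow> 'a \<Rightarrow> real"
  clients    :: "'a set"
  facilities :: "'a set"
  open_cost  :: "'a \<Rightarrow> real"

definition fl_instance :: "'a fl_instance \<Rightarrow> bool" where
  "fl_instance I \<longleftrightarrow>
     finite (points I) \<and> points I \<noteq> {} \<and> Metric_space (points I) (distance I) \<and>
     clients I \<subseteq> points I \<and> facilities I \<subseteq> points I \<and>
     (\<forall>f\<in>facilities I. 0 \<le> open_cost I f)"

definition dist_to_set :: "'a fl_instance \<Rightarrow> 'a \<Rightarrow> 'a set \<Rightarrow> real" where
  "dist_to_set I j F = Min ((\<lambda>f. distance I j f) ` F)"

definition fl_cost :: "'a fl_instance \<Rightarrow> 'a set \<Rightarrow> real" where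
  "fl_cost I F = (\<Sum>f\<in>F. open_cost I f) + (\<Sum>j\<in>clients I. dist_to_set I j F)"

text \<open>The minimum over the empty set counts as infinite, so that \<open>F = {}\<close> is a solution only
  if there is no client to connect.\<close>

definition fl_solution :: "'a fl_instance \<Rightarrow> 'a set \<Rightarrow> bool" where
  "fl_solution I F \<longleftrightarrow> F \<subseteq> facilities I \<and> (F = {} \<longrightarrow> clients I = {})"

definition fl_optimal :: "'a fl_instance \<Rightarrow> 'a set \<Rightarrow> bool" where
  "fl_optimal I F \<longleftrightarrow>
     fl_solution I F \<and> (\<forall>F'. fl_solution I F' \<longrightarrow> fl_cost I F \<le> fl_cost I F')"

text \<open>At \<open>x = 0\<close> the term \<open>x / (1 + x) * ln (2 / x)\<close> evaluates to \<open>0\<close>, which is also its limit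
  for \<open>x\<close> tending to \<open>0\<close> from the right.\<close>

definition alpha_FL_fun :: "real \<Rightarrow> real" where
  "alpha_FL_fun x = 1 + x / (1 + x) * ln (2 / x)"

definition alpha_FL :: real where
  "alpha_FL = (SUP x\<in>{0..}. alpha_FL_fun x)"

text \<open>The supremum is a maximum; it is attained where \<open>ln (2 / x) = 1 + x\<close>, with value \<open>1 + x\<close>.\<close>

lemma alpha_FL_fun_le:
  assumes "0 < x0" "ln (2 / x0) = 1 + x0" "0 \<le> x"
  shows "alpha_FL_fun x \<le> 1 + x0"
proof (cases "x = 0")
  case True
  then show ?thesis using assms by (simp add: alpha_FL_fun_def)
next
  case False
  then have x: "0 < x" using assms by simp
  have "2 / x = (2 / x0) * (x0 / x)" using assms x by simp
  then have "ln (2 / x) = ln (2 / x0) + ln (x0 / x)"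
    using assms x by (metis divide_pos_pos ln_mult_pos zero_less_numeral)
  also have "ln (x0 / x) \<le> x0 / x - 1"
    using assms x by (intro ln_le_minus_one) simp
  finally have "ln (2 / x) \<le> x0 + x0 / x" using assms by simp
  then have "x / (1 + x) * ln (2 / x) \<le> x / (1 + x) * (x0 + x0 / x)"
    using x by (intro mult_left_mono) auto
  also have "\<dots> = x0"
  proof -
    have "x0 + x0 / x = x0 * (1 + x) / x" using x by (simp add: field_simps)
    then show ?thesis using x by simp
  qed
  finally show ?thesis by (simp add: alpha_FL_fun_def)
qed

lemma ln_160_37: "ln (160 / 37 :: real) \<ge> 1.4625"
  using ln_approx_bounds[of "160/37::real" 6] by (simp add: eval_nat_numeral)

lemma ln_4000_927: "ln (4000 / 927 :: real) \<le> 1.4635"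
  using ln_approx_bounds[of "4000/927::real" 6] by (simp add: eval_nat_numeral)

lemma alpha_FL_argmax: "\<exists>x\<in>{0.4625..0.4635}. ln (2 / x) = 1 + (x::real)"
proof -
  have "continuous_on {0.4625..0.4635} (\<lambda>x::real. 1 + x - ln (2 / x))"
    by (intro continuous_intros) auto
  moreover have "1 + 0.4625 - ln (2 / 0.4625) \<le> (0::real)"
    using ln_160_37 by simp
  moreover have "(0::real) \<le> 1 + 0.4635 - ln (2 / 0.4635)"
    using ln_4000_927 by simp
  ultimately obtain x :: real where "0.4625 \<le> x" "x \<le> 0.4635" "1 + x - ln (2 / x) = 0"
    using IVT'[of "\<lambda>x::real. 1 + x - ln (2 / x)" "0.4625" 0 "0.4635"] by auto
  then show ?thesis by (intro bexI[of _ x]) auto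
qed

lemma alpha_FL_max:
  "\<exists>x0\<in>{0..}. alpha_FL_fun x0 = alpha_FL \<and> (\<forall>x\<in>{0..}. alpha_FL_fun x \<le> alpha_FL)"
  and alpha_FL_approx: "alpha_FL \<in> {1.4625..1.4635}"
proof -
  obtain x0 :: real where x0: "0.4625 \<le> x0" "x0 \<le> 0.4635" "ln (2 / x0) = 1 + x0"
    using alpha_FL_argmax by auto
  have pos: "0 < x0" using x0 by simp
  have at: "alpha_FL_fun x0 = 1 + x0"
    using x0 pos by (simp add: alpha_FL_fun_def field_simps)
  have le: "alpha_FL_fun x \<le> 1 + x0" if "x \<in> {0..}" for x
    using alpha_FL_fun_le[OF pos x0(3)] that by simp
  have "alpha_FL = 1 + x0"
    unfolding alpha_FL_def using at le pos
    by (intro cSup_eq_maximum) (auto intro!: image_eqI[of _ _ x0])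
  with at le pos x0 show
    "\<exists>x0\<in>{0..}. alpha_FL_fun x0 = alpha_FL \<and> (\<forall>x\<in>{0..}. alpha_FL_fun x \<le> alpha_FL)"
    "alpha_FL \<in> {1.4625..1.4635}"
    by (auto intro!: bexI[of _ x0])
qed

text \<open>
  The machine model is the real RAM, presented as a structured language: registers and
  arrays over the natural numbers (for control and indexing) and over the reals, with
  unit cost for every operation and every test.  Names of registers and arrays are numbers
  occurring literally in the program.  To rule out the known abuses of unit cost,
  natural numbers can only be added and subtracted (truncated), there is no conversion (such as
  rounding) from reals to natural numbers other than by comparing reals, and the only constants
  are rational.
\<close>

datatype com =
    Skip
  | NConst nat nat            \<comment> \<open>\<open>NConst x a\<close>: \<open>x := a\<close>\<close>
  | NAdd nat nat nat          \<comment> \<open>\<open>NAdd x y z\<close>: \<open>x := y + z\<close>\<close>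
  | NSub nat nat nat
  | NLoad nat nat nat         \<comment> \<open>\<open>NLoad x A y\<close>: \<open>x := A[y]\<close>\<close>
  | NStore nat nat nat        \<comment> \<open>\<open>NStore A x y\<close>: \<open>A[x] := y\<close>\<close>
  | RConst nat rat
  | RAdd nat nat nat
  | RSub nat nat nat
  | RMul nat nat nat
  | RDiv nat nat nat
  | RLoad nat nat nat         \<comment> \<open>real register, real array, index in a natural register\<close>
  | RStore nat nat nat        \<comment> \<open>real array, index in a natural register, real register\<close>
  | Seq com com
  | IfNLe nat nat com com     \<comment> \<open>\<open>IfNLe x y c d\<close>: if \<open>x \<le> y\<close> then \<open>c\<close> else \<open>d\<close>\<close>
  | IfRLe nat nat com com
  | WhileNLess nat nat com    \<comment> \<open>\<open>WhileNLess x y c\<close>: while \<open>x < y\<close> do \<open>c\<close>\<close>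

record store =
  nreg :: "nat \<Rightarrow> nat"
  rreg :: "nat \<Rightarrow> real"
  narr :: "nat \<Rightarrow> nat \<Rightarrow> nat"
  rarr :: "nat \<Rightarrow> nat \<Rightarrow> real"

definition set_nreg :: "nat \<Rightarrow> nat \<Rightarrow> store \<Rightarrow> store" where
  "set_nreg x a s = s\<lparr>nreg := (nreg s)(x := a)\<rparr>"

definition set_rreg :: "nat \<Rightarrow> real \<Rightarrow> store \<Rightarrow> store" where
  "set_rreg x a s = s\<lparr>rreg := (rreg s)(x := a)\<rparr>"

definition set_narr :: "nat \<Rightarrow> nat \<Rightarrow> nat \<Rightarrow> store \<Rightarrow> store" where
  "set_narr A i a s = s\<lparr>narr := (narr s)(A := (narr s A)(i := a))\<rparr>"

definition set_rarr :: "nat \<Rightarrow> nat \<Rightarrow> real \<Rightarrow> store \<Rightarrow> store" where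
  "set_rarr A i a s = s\<lparr>rarr := (rarr s)(A := (rarr s A)(i := a))\<rparr>"

text \<open>\<open>exec c s t s'\<close>: started in \<open>s\<close>, program \<open>c\<close> halts in \<open>s'\<close> after exactly \<open>t\<close> steps.\<close>

inductive exec :: "com \<Rightarrow> store \<Rightarrow> nat \<Rightarrow> store \<Rightarrow> bool" where
  Skip: "exec Skip s 1 s"
| NConst: "exec (NConst x a) s 1 (set_nreg x a s)"
| NAdd: "exec (NAdd x y z) s 1 (set_nreg x (nreg s y + nreg s z) s)"
| NSub: "exec (NSub x y z) s 1 (set_nreg x (nreg s y - nreg s z) s)"
| NLoad: "exec (NLoad x A y) s 1 (set_nreg x (narr s A (nreg s y)) s)"
| NStore: "exec (NStore A x y) s 1 (set_narr A (nreg s x) (nreg s y) s)"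
| RConst: "exec (RConst x q) s 1 (set_rreg x (real_of_rat q) s)"
| RAdd: "exec (RAdd x y z) s 1 (set_rreg x (rreg s y + rreg s z) s)"
| RSub: "exec (RSub x y z) s 1 (set_rreg x (rreg s y - rreg s z) s)"
| RMul: "exec (RMul x y z) s 1 (set_rreg x (rreg s y * rreg s z) s)"
| RDiv: "exec (RDiv x y z) s 1 (set_rreg x (rreg s y / rreg s z) s)"
| RLoad: "exec (RLoad x A y) s 1 (set_rreg x (rarr s A (nreg s y)) s)"
| RStore: "exec (RStore A x y) s 1 (set_rarr A (nreg s x) (rreg s y) s)"
| Seq: "exec c s t s' \<Longrightarrow> exec d s' u s'' \<Longrightarrow> exec (Seq c d) s (t + u) s''"
| IfNLe_True: "nreg s x \<le> nreg s y \<Longrightarrow> exec c s t s' \<Longrightarrow> exec (IfNLe x y c d) s (1 + t) s'"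
| IfNLe_False: "\<not> nreg s x \<le> nreg s y \<Longrightarrow> exec d s t s' \<Longrightarrow> exec (IfNLe x y c d) s (1 + t) s'"
| IfRLe_True: "rreg s x \<le> rreg s y \<Longrightarrow> exec c s t s' \<Longrightarrow> exec (IfRLe x y c d) s (1 + t) s'"
| IfRLe_False: "\<not> rreg s x \<le> rreg s y \<Longrightarrow> exec d s t s' \<Longrightarrow> exec (IfRLe x y c d) s (1 + t) s'"
| While_False: "\<not> nreg s x < nreg s y \<Longrightarrow> exec (WhileNLess x y c) s 1 s"
| While_True: "nreg s x < nreg s y \<Longrightarrow> exec c s t s' \<Longrightarrow> exec (WhileNLess x y c) s' u s'' \<Longrightarrow>
    exec (WhileNLess x y c) s (1 + t + u) s''"

text \<open>Programs are deterministic: result and running time are functions of the initial store.\<close>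

lemma exec_deterministic:
  "exec c s t s' \<Longrightarrow> exec c s u s'' \<Longrightarrow> t = u \<and> s' = s''"
proof (induction arbitrary: u s'' rule: exec.induct)
  case (Seq c s t s' d u' s1)
  from Seq.prems show ?case by cases (use Seq.IH in blast)
next
  case (While_True s x y c t s' u' s1)
  from While_True.prems show ?case
    by cases (use While_True.IH While_True.hyps in blast)+
next
  case (IfNLe_True s x y c t s' d)
  from IfNLe_True.prems show ?case
    by cases (use IfNLe_True.IH IfNLe_True.hyps in blast)+
next
  case (IfNLe_False s x y d t s' c)
  from IfNLe_False.prems show ?case
    by cases (use IfNLe_False.IH IfNLe_False.hyps in blast)+
next
  case (IfRLe_True s x y c t s' d)
  from IfRLe_True.prems show ?case
    by cases (use IfRLe_True.IH IfRLe_True.hyps in blast)+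
next
  case (IfRLe_False s x y d t s' c)
  from IfRLe_False.prems show ?case
    by cases (use IfRLe_False.IH IfRLe_False.hyps in blast)+
next
  case (While_False s x y c)
  from While_False.prems show ?case by cases (use While_False.hyps in auto)
qed (auto elim: exec.cases)

text \<open>
  An instance on the points \<open>{..<n}\<close>, together with the parameter \<open>k\<close>, is presented to a program
  as follows.  Registers \<open>0\<close> and \<open>1\<close> hold \<open>n\<close> and \<open>k\<close>; the arrays \<open>0\<close> and \<open>1\<close> over the
  natural numbers hold the characteristic functions of clients and facilities; the real
  arrays \<open>0\<close> and \<open>1\<close> hold the distance matrix in row-major order and the opening costs.
  Everything else is zero.
\<close>

definition encode :: "nat fl_instance \<Rightarrow> nat \<Rightarrow> store" where
  "encode I k = (let n = card (points I) in
     \<lparr> nreg = (\<lambda>_. 0)(0 := n, 1 := k),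
       rreg = (\<lambda>_. 0),
       narr = (\<lambda>_ _. 0)(0 := (\<lambda>v. if v \<in> clients I then 1 else 0),
                        1 := (\<lambda>v. if v \<in> facilities I then 1 else 0)),
       rarr = (\<lambda>_ _. 0)(0 := (\<lambda>i. if i < n * n then distance I (i div n) (i mod n) else 0),
                        1 := (\<lambda>v. if v \<in> facilities I then open_cost I v else 0)) \<rparr>)"

text \<open>The set of facilities to open is returned in array \<open>2\<close> over the natural numbers.\<close>

definition decode :: "nat \<Rightarrow> store \<Rightarrow> nat set" where
  "decode n s = {v. v < n \<and> narr s 2 v \<noteq> 0}"

text \<open>
  The parameter \<open>k\<close> is part of the input, as usual for parameterized problems.  Running time
  and approximation guarantee are required whenever \<open>k\<close> is the number of facilities opened in
  some optimal solution.
\<close>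

definition fl_approx_algorithm :: "real \<Rightarrow> (nat \<Rightarrow> nat \<Rightarrow> nat) \<Rightarrow> com \<Rightarrow> bool" where
  "fl_approx_algorithm \<rho> T P \<longleftrightarrow>
     (\<forall>n I k Opt. fl_instance I \<and> points I = {..<n} \<and> fl_optimal I Opt \<and> card Opt = k \<longrightarrow>
        (\<exists>t s. exec P (encode I k) t s \<and> t \<le> T k n \<and>
               fl_solution I (decode n s) \<and> fl_cost I (decode n s) \<le> \<rho> * fl_cost I Opt))"

end

theory Submission
  imports Defs
begin

text \<open>
  Let \<open>e = p = 1 / N\<close>, and let a solution have \<open>k'\<close> facilities \<open>f\<close> with nonempty clusters, opening costs
  \<open>O\<close> and connection costs \<open>R\<close>.  Every \<open>f\<close> gets an anchor, a client whose distance to \<open>f\<close> is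
  not much larger than the average in the cluster of \<open>f\<close>.  Anchors are found one by one: if some
  cluster has no anchor yet, then, for the worst such cluster, the clients near \<open>f\<close> account for at
  least the fraction \<open>\<delta> = e\<^sup>3 / (48 k)\<close> of the total distance of the clients to the present anchors.
  Such a ball around a facility is called heavy.  Taking repeatedly the client that lies in the
  most heavy balls not hit so far decreases their number by the factor \<open>1 - \<delta>\<close>, so that all are
  hit after \<open>O(log n / \<delta>)\<close> steps, and the index of the step that hits the ball of \<open>f\<close> can be
  guessed.

  Guess also for every \<open>f\<close> its anchor and, up to the factor \<open>1 + e\<close>, the distance to it.  This
  determines a class of facilities among which \<open>f\<close> lies, and any choice of one facility from each
  class serves the clients at cost at most about \<open>3 R\<close>.  A greedy algorithm adds facilities in
  fractions \<open>1 / N\<close>, one of every class per round, weighting connection costs by a factor that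
  grows with the rounds.  After \<open>M\<close> rounds the expected total cost is about
  \<open>M / N * O + (1 + 2 exp (- M / N)) * R\<close>, and for the best \<open>M \<ge> N\<close> this is at most
  \<open>\<alpha> * (O + R)\<close>; the maximum over \<open>x = O / R\<close> defines \<open>\<alpha>\<close>.  The first \<open>N\<close> rounds have total
  fraction \<open>1\<close> in every class.  Making them mutually exclusive does not increase the expectation and
  ensures that every class is served.

  All guesses, including the outcome of the rounding, form a string of \<open>L\<close> digits below \<open>B\<close>, where
  \<open>L\<close> depends only on \<open>k\<close> and \<open>N\<close>, and \<open>B\<close> is \<open>O(log n / \<delta>)\<close>.  Since \<open>(log n)\<^sup>L\<close> is at most \<open>n\<close>
  times a function of \<open>L\<close>, trying them all is possible in fixed-parameter time.
\<close>

section \<open>A loop language and its compilation\<close>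

text \<open>A digit may take only O(log n) values times a function of \<open>k\<close> and
  \<open>N\<close>, while a client or a radius has about n candidates. So anchors are named by steps
  of a deterministic process, and radii by exponents relative to one distance \<open>d v v'\<close>,
  the largest one from a facility to its anchor; trying all pairs of points costs a polynomial
  factor only. The 3 in 3 R is R for the clients' way to their facilities plus twice R for the way
  to the anchor and on to the substitute, so the greedy algorithm starts with an excess of about 2 R
  over R. In each round the gains of the facilities \<open>fs i\<close> are compared at the end of
  the round, where diminishing returns make them smallest; therefore the excess is divided by 1 + p
  per round, whence 2 exp (- M / N). Fractions are used because the expected minimum can be computed
  exactly and its change is linear in p. Independent choices alone could leave a class without a
  facility, and then only the fictitious service cost \<open>D j\<close> would remain; this is why M
  is at least N and the first N rounds are made exclusive.\<close>

datatype nexp = NC nat | NV nat | NA nat nexp | NPl nexp nexp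

datatype aop = OAdd | OSub | OMul | ODiv

datatype rexp =
    RC rat
  | RA nat nexp
  | ROp aop rexp rexp
  | RIfN nexp nexp rexp rexp
  | RIfR rexp rexp rexp rexp
  | RSum nat nat rexp

datatype stm =
    SSkip
  | NSt nat nexp nexp
  | RSt nat nexp rexp
  | SSeq stm stm  (infixr ";;" 60)
  | SIfN nexp nexp stm stm
  | SIfR rexp rexp stm stm
  | SFor nat nat stm

abbreviation "RPl \<equiv> ROp OAdd"
abbreviation "RMi \<equiv> ROp OSub"
abbreviation "RMu \<equiv> ROp OMul"
abbreviation "RDi \<equiv> ROp ODiv"

primrec ev_op :: "aop \<Rightarrow> real \<Rightarrow> real \<Rightarrow> real" where
  "ev_op OAdd a b = a + b"
| "ev_op OSub a b = a - b"
| "ev_op OMul a b = a * b"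
| "ev_op ODiv a b = a / b"

primrec com_op :: "aop \<Rightarrow> nat \<Rightarrow> nat \<Rightarrow> nat \<Rightarrow> com" where
  "com_op OAdd = RAdd"
| "com_op OSub = RSub"
| "com_op OMul = RMul"
| "com_op ODiv = RDiv"

lemma exec_com_op: "exec (com_op f x y z) s 1 (set_rreg x (ev_op f (rreg s y) (rreg s z)) s)"
  by (cases f) (auto simp del: One_nat_def intro: exec.intros)

type_synonym mem = "(nat \<Rightarrow> nat \<Rightarrow> nat) \<times> (nat \<Rightarrow> nat \<Rightarrow> real)"

primrec evN :: "nexp \<Rightarrow> (nat \<Rightarrow> nat) \<Rightarrow> mem \<Rightarrow> nat" where
  "evN (NC a) \<rho> \<sigma> = a"
| "evN (NV x) \<rho> \<sigma> = \<rho> x"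
| "evN (NA A e) \<rho> \<sigma> = fst \<sigma> A (evN e \<rho> \<sigma>)"
| "evN (NPl a b) \<rho> \<sigma> = evN a \<rho> \<sigma> + evN b \<rho> \<sigma>"

primrec evR :: "rexp \<Rightarrow> (nat \<Rightarrow> nat) \<Rightarrow> mem \<Rightarrow> real" where
  "evR (RC q) \<rho> \<sigma> = real_of_rat q"
| "evR (RA A e) \<rho> \<sigma> = snd \<sigma> A (evN e \<rho> \<sigma>)"
| "evR (ROp f a b) \<rho> \<sigma> = ev_op f (evR a \<rho> \<sigma>) (evR b \<rho> \<sigma>)"
| "evR (RIfN a b c d) \<rho> \<sigma> = (if evN a \<rho> \<sigma> \<le> evN b \<rho> \<sigma> then evR c \<rho> \<sigma> else evR d \<rho> \<sigma>)"
| "evR (RIfR a b c d) \<rho> \<sigma> = (if evR a \<rho> \<sigma> \<le> evR b \<rho> \<sigma> then evR c \<rho> \<sigma> else evR d \<rho> \<sigma>)"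
| "evR (RSum x y e) \<rho> \<sigma> = (\<Sum>i<\<rho> y. evR e (\<rho>(x := i)) \<sigma>)"

primrec sem :: "stm \<Rightarrow> (nat \<Rightarrow> nat) \<Rightarrow> mem \<Rightarrow> mem" where
  "sem SSkip \<rho> \<sigma> = \<sigma>"
| "sem (NSt A i e) \<rho> \<sigma> = ((fst \<sigma>)(A := (fst \<sigma> A)(evN i \<rho> \<sigma> := evN e \<rho> \<sigma>)), snd \<sigma>)"
| "sem (RSt A i e) \<rho> \<sigma> = (fst \<sigma>, (snd \<sigma>)(A := (snd \<sigma> A)(evN i \<rho> \<sigma> := evR e \<rho> \<sigma>)))"
| "sem (c ;; d) \<rho> \<sigma> = sem d \<rho> (sem c \<rho> \<sigma>)"
| "sem (SIfN a b c d) \<rho> \<sigma> = (if evN a \<rho> \<sigma> \<le> evN b \<rho> \<sigma> then sem c \<rho> \<sigma> else sem d \<rho> \<sigma>)"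
| "sem (SIfR a b c d) \<rho> \<sigma> = (if evR a \<rho> \<sigma> \<le> evR b \<rho> \<sigma> then sem c \<rho> \<sigma> else sem d \<rho> \<sigma>)"
| "sem (SFor x y c) \<rho> \<sigma> = fold (\<lambda>i. sem c (\<rho>(x := i))) [0..<\<rho> y] \<sigma>"

text \<open>Registers below \<open>10\<close> hold loop bounds and are never assigned, registers \<open>10..<100\<close> are
  loop variables, and the compiler uses all others as a stack.\<close>

primrec wfN :: "nat set \<Rightarrow> nexp \<Rightarrow> bool" where
  "wfN X (NC a) = True"
| "wfN X (NV x) = (x \<in> X)"
| "wfN X (NA A e) = wfN X e"
| "wfN X (NPl a b) = (wfN X a \<and> wfN X b)"

text \<open>The condition \<open>x \<notin> X\<close> rules out reusing a live loop variable:
  \<open>evR\<close> restores it after the sum, whereas the compiled loop leaves the final count in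
  its register.\<close>

primrec wfR :: "nat set \<Rightarrow> rexp \<Rightarrow> bool" where
  "wfR X (RC q) = True"
| "wfR X (RA A e) = wfN X e"
| "wfR X (ROp f a b) = (wfR X a \<and> wfR X b)"
| "wfR X (RIfN a b c d) = (wfN X a \<and> wfN X b \<and> wfR X c \<and> wfR X d)"
| "wfR X (RIfR a b c d) = (wfR X a \<and> wfR X b \<and> wfR X c \<and> wfR X d)"
| "wfR X (RSum x y e) = (x \<notin> X \<and> 10 \<le> x \<and> x < 100 \<and> y \<in> X \<and> y < 10 \<and> wfR (insert x X) e)"

primrec wfS :: "nat set \<Rightarrow> stm \<Rightarrow> bool" where
  "wfS X SSkip = True"
| "wfS X (NSt A i e) = (wfN X i \<and> wfN X e)"
| "wfS X (RSt A i e) = (wfN X i \<and> wfR X e)"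
| "wfS X (c ;; d) = (wfS X c \<and> wfS X d)"
| "wfS X (SIfN a b c d) = (wfN X a \<and> wfN X b \<and> wfS X c \<and> wfS X d)"
| "wfS X (SIfR a b c d) = (wfR X a \<and> wfR X b \<and> wfS X c \<and> wfS X d)"
| "wfS X (SFor x y c) = (x \<notin> X \<and> 10 \<le> x \<and> x < 100 \<and> y \<in> X \<and> y < 10 \<and> wfS (insert x X) c)"

text \<open>The value ends up in register \<open>m\<close> and registers below \<open>m\<close>
  survive, so \<open>m\<close> is a stack pointer known at compile time. There is no move
  instruction; a register is copied by adding 0.\<close>

primrec cN :: "nexp \<Rightarrow> nat \<Rightarrow> com" where
  "cN (NC a) m = NConst m a"
| "cN (NV x) m = Seq (NConst (Suc m) 0) (NAdd m x (Suc m))"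
| "cN (NA A e) m = Seq (cN e m) (NLoad m A m)"
| "cN (NPl a b) m = Seq (cN a m) (Seq (cN b (Suc m)) (NAdd m m (Suc m)))"

text \<open>In a sum, the accumulator is the real register \<open>m\<close>; the natural register
  \<open>m\<close> is a different cell and holds the constant 1 for the increment.\<close>

primrec cR :: "rexp \<Rightarrow> nat \<Rightarrow> com" where
  "cR (RC q) m = RConst m q"
| "cR (RA A e) m = Seq (cN e m) (RLoad m A m)"
| "cR (ROp f a b) m = Seq (cR a m) (Seq (cR b (Suc m)) (com_op f m m (Suc m)))"
| "cR (RIfN a b c d) m = Seq (cN a m) (Seq (cN b (Suc m)) (IfNLe m (Suc m) (cR c m) (cR d m)))"
| "cR (RIfR a b c d) m = Seq (cR a m) (Seq (cR b (Suc m)) (IfRLe m (Suc m) (cR c m) (cR d m)))"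
| "cR (RSum x y e) m = Seq (RConst m 0) (Seq (NConst x 0) (WhileNLess x y
     (Seq (cR e (Suc m)) (Seq (RAdd m m (Suc m)) (Seq (NConst m 1) (NAdd x x m))))))"

primrec cS :: "stm \<Rightarrow> com" where
  "cS SSkip = Skip"
| "cS (NSt A i e) = Seq (cN i 100) (Seq (cN e 101) (NStore A 100 101))"
| "cS (RSt A i e) = Seq (cN i 100) (Seq (cR e 101) (RStore A 100 101))"
| "cS (c ;; d) = Seq (cS c) (cS d)"
| "cS (SIfN a b c d) = Seq (cN a 100) (Seq (cN b 101) (IfNLe 100 101 (cS c) (cS d)))"
| "cS (SIfR a b c d) = Seq (cR a 100) (Seq (cR b 101) (IfRLe 100 101 (cS c) (cS d)))"
| "cS (SFor x y c) = Seq (NConst x 0) (WhileNLess x y (Seq (cS c) (Seq (NConst 100 1) (NAdd x x 100))))"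

text \<open>Running times, where \<open>m\<close> bounds the number of iterations of every loop.\<close>

primrec tN :: "nexp \<Rightarrow> nat" where
  "tN (NC a) = 1"
| "tN (NV x) = 2"
| "tN (NA A e) = tN e + 1"
| "tN (NPl a b) = tN a + tN b + 1"

primrec tR :: "nat \<Rightarrow> rexp \<Rightarrow> nat" where
  "tR m (RC q) = 1"
| "tR m (RA A e) = tN e + 1"
| "tR m (ROp f a b) = tR m a + tR m b + 1"
| "tR m (RIfN a b c d) = tN a + tN b + tR m c + tR m d + 1"
| "tR m (RIfR a b c d) = tR m a + tR m b + tR m c + tR m d + 1"
| "tR m (RSum x y e) = m * (tR m e + 4) + 3"

primrec tS :: "nat \<Rightarrow> stm \<Rightarrow> nat" where
  "tS m SSkip = 1"
| "tS m (NSt A i e) = tN i + tN e + 1"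
| "tS m (RSt A i e) = tN i + tR m e + 1"
| "tS m (c ;; d) = tS m c + tS m d"
| "tS m (SIfN a b c d) = tN a + tN b + tS m c + tS m d + 1"
| "tS m (SIfR a b c d) = tR m a + tR m b + tS m c + tS m d + 1"
| "tS m (SFor x y c) = m * (tS m c + 3) + 2"

lemma cN_correct:
  assumes "wfN X e" "X \<subseteq> {..<100}" "100 \<le> m" "\<forall>x\<in>X. nreg s x = \<rho> x"
  shows "\<exists>s' t. exec (cN e m) s t s' \<and> t \<le> tN e \<and> nreg s' m = evN e \<rho> (narr s, rarr s) \<and>
    (\<forall>x<m. nreg s' x = nreg s x) \<and> rreg s' = rreg s \<and> narr s' = narr s \<and> rarr s' = rarr s"
  using assms
proof (induction e arbitrary: m s)
  case (NC a)
  then show ?case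
    by (intro exI[of _ "set_nreg m a s"] exI[of _ 1]) (auto simp: set_nreg_def exec.NConst[unfolded One_nat_def set_nreg_def])
next
  case (NV x)
  have "exec (cN (NV x) m) s (1 + 1) (set_nreg m (nreg (set_nreg (Suc m) 0 s) x +
      nreg (set_nreg (Suc m) 0 s) (Suc m)) (set_nreg (Suc m) 0 s))"
    unfolding cN.simps by (rule exec.Seq[OF exec.NConst exec.NAdd])
  then show ?case using NV
    by - (intro exI conjI, assumption, auto simp: set_nreg_def)
next
  case (NA A e)
  obtain s1 t1 where 1: "exec (cN e m) s t1 s1" "t1 \<le> tN e"
    "nreg s1 m = evN e \<rho> (narr s, rarr s)" "\<forall>x<m. nreg s1 x = nreg s x" "rreg s1 = rreg s"
    "narr s1 = narr s" "rarr s1 = rarr s" using NA.IH[of m s] NA.prems by auto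
  have "exec (cN (NA A e) m) s (t1 + 1) (set_nreg m (narr s1 A (nreg s1 m)) s1)"
    unfolding cN.simps by (intro exec.Seq[OF 1(1)] exec.NLoad)
  then show ?case using 1
    by - (intro exI conjI, assumption, auto simp: set_nreg_def)
next
  case (NPl a b)
  obtain s1 t1 where 1: "exec (cN a m) s t1 s1" "t1 \<le> tN a"
    "nreg s1 m = evN a \<rho> (narr s, rarr s)" "\<forall>x<m. nreg s1 x = nreg s x" "rreg s1 = rreg s"
    "narr s1 = narr s" "rarr s1 = rarr s" using NPl.IH(1)[of m s] NPl.prems by auto
  have "\<forall>x\<in>X. nreg s1 x = \<rho> x" using NPl.prems 1 by force
  then obtain s2 t2 where 2: "exec (cN b (Suc m)) s1 t2 s2" "t2 \<le> tN b"
    "nreg s2 (Suc m) = evN b \<rho> (narr s, rarr s)" "\<forall>x<Suc m. nreg s2 x = nreg s1 x" "rreg s2 = rreg s"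
    "narr s2 = narr s" "rarr s2 = rarr s" using NPl.IH(2)[of "Suc m" s1] NPl.prems(1-3) 1(5-7) by auto
  have "exec (cN (NPl a b) m) s (t1 + (t2 + 1)) (set_nreg m (nreg s2 m + nreg s2 (Suc m)) s2)"
    unfolding cN.simps by (intro exec.Seq[OF 1(1)] exec.Seq[OF 2(1)] exec.NAdd)
  moreover have "nreg s2 m = evN a \<rho> (narr s, rarr s)" "\<forall>x<m. nreg s2 x = nreg s x"
    using 1(3,4) 2(4) by simp_all
  ultimately show ?case using 1(2) 2(2,3,5-7)
    by - (intro exI conjI, assumption, auto simp: set_nreg_def)
qed

text \<open>What the evaluation of a real expression at stack level \<open>m\<close> leaves unchanged.\<close>

definition keeps :: "nat set \<Rightarrow> nat \<Rightarrow> store \<Rightarrow> store \<Rightarrow> bool" where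
  "keeps X m s s' \<longleftrightarrow> (\<forall>x. x \<in> X \<or> 100 \<le> x \<and> x < m \<longrightarrow> nreg s' x = nreg s x) \<and>
     (\<forall>x<m. rreg s' x = rreg s x) \<and> narr s' = narr s \<and> rarr s' = rarr s"

lemma keeps_trans: "keeps X m s s' \<Longrightarrow> keeps X m s' s'' \<Longrightarrow> keeps X m s s''"
  by (auto simp: keeps_def)

lemma keeps_mono: "keeps X' m' s s' \<Longrightarrow> X \<subseteq> X' \<Longrightarrow> m \<le> m' \<Longrightarrow> keeps X m s s'"
  by (auto simp: keeps_def)

lemma keeps_set_rreg [simp]: "m \<le> x \<Longrightarrow> keeps X m s (set_rreg x a s') = keeps X m s s'"
  by (auto simp: keeps_def set_rreg_def)

lemma keeps_set_nreg [simp]: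
  "x \<notin> X \<Longrightarrow> \<not> (100 \<le> x \<and> x < m) \<Longrightarrow> keeps X m s (set_nreg x a s') = keeps X m s s'"
  by (auto simp: keeps_def set_nreg_def)

lemma cN_keeps:
  assumes "wfN X e" "X \<subseteq> {..<100}" "100 \<le> m" "\<forall>x\<in>X. nreg s x = \<rho> x"
  obtains s' t where "exec (cN e m) s t s'" "t \<le> tN e" "nreg s' m = evN e \<rho> (narr s, rarr s)"
    "keeps X m s s'" "\<forall>x<m. nreg s' x = nreg s x" "rreg s' = rreg s"
    "\<forall>x\<in>X. nreg s' x = \<rho> x" "narr s' = narr s" "rarr s' = rarr s"
proof -
  obtain s' t where "exec (cN e m) s t s'" "t \<le> tN e" "nreg s' m = evN e \<rho> (narr s, rarr s)"
    "\<forall>x<m. nreg s' x = nreg s x" "rreg s' = rreg s" "narr s' = narr s" "rarr s' = rarr s"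
    using cN_correct[OF assms] by blast
  moreover from this assms have "keeps X m s s'" "\<forall>x\<in>X. nreg s' x = \<rho> x"
    by (force simp: keeps_def)+
  ultimately show ?thesis using that by blast
qed

lemma cR_correct:
  assumes "wfR X e" "X \<subseteq> {..<100}" "100 \<le> m" "\<forall>x\<in>X. nreg s x = \<rho> x" "\<forall>y<10. \<rho> y \<le> M"
  shows "\<exists>s' t. exec (cR e m) s t s' \<and> t \<le> tR M e \<and> rreg s' m = evR e \<rho> (narr s, rarr s) \<and>
    keeps X m s s'"
  using assms
proof (induction e arbitrary: m s X \<rho>)
  case (RC q)
  then show ?case
    by (intro exI[of _ "set_rreg m (real_of_rat q) s"] exI[of _ 1])
       (auto simp: set_rreg_def keeps_def exec.RConst[unfolded One_nat_def set_rreg_def])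
next
  case (RA A e)
  obtain s1 t1 where 1: "exec (cN e m) s t1 s1" "t1 \<le> tN e"
    "nreg s1 m = evN e \<rho> (narr s, rarr s)" "keeps X m s s1" "narr s1 = narr s" "rarr s1 = rarr s"
    by (rule cN_keeps[of X e m s \<rho>]) (use RA.prems in auto)
  have "exec (cR (RA A e) m) s (t1 + 1) (set_rreg m (rarr s1 A (nreg s1 m)) s1)"
    unfolding cR.simps by (intro exec.Seq[OF 1(1)] exec.RLoad)
  then show ?case using 1
    by - (intro exI conjI, assumption, auto simp: set_rreg_def keeps_def)
next
  case (RIfN a b c d)
  obtain s1 t1 where 1: "exec (cN a m) s t1 s1" "t1 \<le> tN a"
    "nreg s1 m = evN a \<rho> (narr s, rarr s)" "keeps X m s s1" "\<forall>x\<in>X. nreg s1 x = \<rho> x"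
    "narr s1 = narr s" "rarr s1 = rarr s"
    by (rule cN_keeps[of X a m s \<rho>]) (use RIfN.prems in auto)
  obtain s2 t2 where 2: "exec (cN b (Suc m)) s1 t2 s2" "t2 \<le> tN b"
    "nreg s2 (Suc m) = evN b \<rho> (narr s, rarr s)" "keeps X (Suc m) s1 s2" "\<forall>x\<in>X. nreg s2 x = \<rho> x"
    "narr s2 = narr s" "rarr s2 = rarr s"
    by (rule cN_keeps[of X b "Suc m" s1 \<rho>]) (use RIfN.prems 1 in auto)
  have cm: "nreg s2 m = evN a \<rho> (narr s, rarr s)"
    using 1(3) 2(4) RIfN.prems by (auto simp: keeps_def)
  have k2: "keeps X m s s2" using keeps_trans[OF 1(4) keeps_mono[OF 2(4)]] by auto
  show ?case
  proof (cases "nreg s2 m \<le> nreg s2 (Suc m)")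
    case True
    obtain s3 t3 where 3: "exec (cR c m) s2 t3 s3" "t3 \<le> tR M c" "rreg s3 m = evR c \<rho> (narr s, rarr s)"
      "keeps X m s2 s3" using RIfN.IH(1)[of X m s2 \<rho>] RIfN.prems 2 by auto
    have "exec (cR (RIfN a b c d) m) s (t1 + (t2 + (1 + t3))) s3"
      unfolding cR.simps by (intro exec.Seq[OF 1(1)] exec.Seq[OF 2(1)] exec.IfNLe_True True 3)
    then show ?thesis using True cm 1 2 3 keeps_trans[OF k2 3(4)]
      by - (intro exI conjI, assumption, auto)
  next
    case False
    obtain s3 t3 where 3: "exec (cR d m) s2 t3 s3" "t3 \<le> tR M d" "rreg s3 m = evR d \<rho> (narr s, rarr s)"
      "keeps X m s2 s3" using RIfN.IH(2)[of X m s2 \<rho>] RIfN.prems 2 by auto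
    have "exec (cR (RIfN a b c d) m) s (t1 + (t2 + (1 + t3))) s3"
      unfolding cR.simps by (intro exec.Seq[OF 1(1)] exec.Seq[OF 2(1)] exec.IfNLe_False False 3)
    then show ?thesis using False cm 1 2 3 keeps_trans[OF k2 3(4)]
      by - (intro exI conjI, assumption, auto)
  qed
next
  case (RSum x y e)
  define W where "W = WhileNLess x y
     (Seq (cR e (Suc m)) (Seq (RAdd m m (Suc m)) (Seq (NConst m 1) (NAdd x x m))))"
  note prems = RSum.prems
  have wf: "x \<notin> X" "10 \<le> x" "x < 100" "y \<in> X" "y < 10" "wfR (insert x X) e" using prems by auto
  define F where "F i = evR e (\<rho>(x := i)) (narr s, rarr s)" for i
  \<comment> \<open>A while loop unfolds at its first iteration, so the claim concerns the
    iterations from \<open>i\<close> on, with an arbitrary value in the accumulator, and is proved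
    by induction downwards from the bound.\<close>
  have loop: "\<exists>s' t. exec W s0 t s' \<and> t \<le> (\<rho> y - i) * (tR M e + 4) + 1 \<and>
      rreg s' m = rreg s0 m + (\<Sum>l=i..<\<rho> y. F l) \<and> keeps X m s0 s'"
    if "i \<le> \<rho> y" "nreg s0 x = i" "\<forall>z\<in>X. nreg s0 z = \<rho> z" "narr s0 = narr s" "rarr s0 = rarr s" for i s0
    using that
  proof (induction i arbitrary: s0 rule: inc_induct)
    case base
    have "exec W s0 1 s0" unfolding W_def using base wf by (intro exec.While_False) auto
    then show ?case using base by - (intro exI conjI, assumption, auto simp: keeps_def)
  next
    case (step i)
    have b: "\<forall>ya<10. (\<rho>(x := i)) ya \<le> M" using prems wf by auto
    have ag: "\<forall>z\<in>insert x X. nreg s0 z = (\<rho>(x := i)) z" using step.prems wf by auto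
    have "\<exists>s' t. exec (cR e (Suc m)) s0 t s' \<and> t \<le> tR M e \<and>
        rreg s' (Suc m) = evR e (\<rho>(x := i)) (narr s0, rarr s0) \<and> keeps (insert x X) (Suc m) s0 s'"
      using prems by (intro RSum.IH[OF wf(6) _ _ ag b]) auto
    then obtain s1 t1 where 1: "exec (cR e (Suc m)) s0 t1 s1" "t1 \<le> tR M e"
      "rreg s1 (Suc m) = F i" "keeps (insert x X) (Suc m) s0 s1"
      unfolding step.prems F_def by blast
    define s2 where "s2 = set_rreg m (rreg s1 m + rreg s1 (Suc m)) s1"
    define s3 where "s3 = set_nreg m 1 s2"
    define s4 where "s4 = set_nreg x (nreg s3 x + nreg s3 m) s3"
    have ex: "exec (Seq (cR e (Suc m)) (Seq (RAdd m m (Suc m)) (Seq (NConst m 1) (NAdd x x m))))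
        s0 (t1 + (1 + (1 + 1))) s4"
      unfolding s2_def s3_def s4_def by (rule exec.Seq[OF 1(1) exec.Seq[OF exec.RAdd exec.Seq[OF exec.NConst exec.NAdd]]])
    have k1: "keeps X m s0 s1" by (rule keeps_mono[OF 1(4)]) auto
    have mX: "m \<notin> X" using prems by auto
    have k4: "keeps X m s0 s4" unfolding s4_def s3_def s2_def using k1 wf prems mX
      by simp
    have r4: "rreg s4 m = rreg s0 m + F i"
      using 1(3,4) by (auto simp: s4_def s3_def s2_def set_nreg_def set_rreg_def keeps_def)
    have n4: "nreg s4 x = Suc i" using 1(4) step.prems wf prems
      by (auto simp: s4_def s3_def s2_def set_nreg_def set_rreg_def keeps_def)
    have "\<forall>z\<in>X. nreg s4 z = \<rho> z" "narr s4 = narr s" "rarr s4 = rarr s"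
      using k4 step.prems by (auto simp: keeps_def)
    from step.IH[OF n4 this] obtain s5 t5 where 5: "exec W s4 t5 s5"
      "t5 \<le> (\<rho> y - Suc i) * (tR M e + 4) + 1"
      "rreg s5 m = rreg s4 m + (\<Sum>l=Suc i..<\<rho> y. F l)" "keeps X m s4 s5"
      by blast
    have lt: "nreg s0 x < nreg s0 y" using step wf by auto
    have "exec W s0 (1 + (t1 + (1 + (1 + 1))) + t5) s5"
      unfolding W_def by (rule exec.While_True[OF lt ex 5(1)[unfolded W_def]])
    moreover have "\<rho> y - i = Suc (\<rho> y - Suc i)" using step.hyps by simp
    ultimately show ?case using 5 1 r4 keeps_trans[OF k4 5(4)] step.hyps
      by - (intro exI conjI, assumption, auto simp: sum.atLeast_Suc_lessThan algebra_simps)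
  qed
  define s1 where "s1 = set_nreg x 0 (set_rreg m (real_of_rat 0) s)"
  have k1: "keeps X m s s1" unfolding s1_def using wf by (simp add: keeps_def[of _ _ s s])
  have "\<forall>z\<in>X. nreg s1 z = \<rho> z" using k1 prems by (auto simp: keeps_def)
  moreover have "nreg s1 x = 0" "narr s1 = narr s" "rarr s1 = rarr s" "rreg s1 m = 0"
    by (auto simp: s1_def set_nreg_def set_rreg_def)
  ultimately obtain s2 t2 where 2: "exec W s1 t2 s2" "t2 \<le> \<rho> y * (tR M e + 4) + 1"
     "rreg s2 m = (\<Sum>l=0..<\<rho> y. F l)" "keeps X m s1 s2"
    using loop[of 0 s1] by auto
  have "exec (cR (RSum x y e) m) s (1 + (1 + t2)) s2"
    unfolding cR.simps W_def[symmetric]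
    by (intro exec.Seq[OF exec.RConst] exec.Seq[OF exec.NConst] 2(1)[unfolded s1_def])
  moreover have "\<rho> y * (tR M e + 4) \<le> M * (tR M e + 4)" using wf prems by (intro mult_right_mono) auto
  then have "t2 \<le> M * (tR M e + 4) + 1" using 2(2) by linarith
  ultimately show ?case using 2 keeps_trans[OF k1 2(4)]
    by - (intro exI conjI, assumption, auto simp: lessThan_atLeast0 F_def)
next
  case (RIfR a b c d)
  obtain s1 t1 where 1: "exec (cR a m) s t1 s1" "t1 \<le> tR M a"
    "rreg s1 m = evR a \<rho> (narr s, rarr s)" "keeps X m s s1"
    using RIfR.IH(1)[of X m s \<rho>] RIfR.prems by auto
  have e1: "\<forall>x\<in>X. nreg s1 x = \<rho> x" "narr s1 = narr s" "rarr s1 = rarr s"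
    using 1(4) RIfR.prems by (auto simp: keeps_def)
  obtain s2 t2 where 2: "exec (cR b (Suc m)) s1 t2 s2" "t2 \<le> tR M b"
    "rreg s2 (Suc m) = evR b \<rho> (narr s, rarr s)" "keeps X (Suc m) s1 s2"
    using RIfR.IH(2)[of X "Suc m" s1 \<rho>] RIfR.prems e1 by auto
  have e2: "\<forall>x\<in>X. nreg s2 x = \<rho> x" "narr s2 = narr s" "rarr s2 = rarr s"
    using 2(4) e1 by (auto simp: keeps_def)
  have cm: "rreg s2 m = evR a \<rho> (narr s, rarr s)"
    using 1(3) 2(4) RIfR.prems by (auto simp: keeps_def)
  have k2: "keeps X m s s2" using keeps_trans[OF 1(4) keeps_mono[OF 2(4)]] by auto
  show ?case
  proof (cases "rreg s2 m \<le> rreg s2 (Suc m)")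
    case True
    obtain s3 t3 where 3: "exec (cR c m) s2 t3 s3" "t3 \<le> tR M c" "rreg s3 m = evR c \<rho> (narr s, rarr s)"
      "keeps X m s2 s3" using RIfR.IH(3)[of X m s2 \<rho>] RIfR.prems e2 by auto
    have "exec (cR (RIfR a b c d) m) s (t1 + (t2 + (1 + t3))) s3"
      unfolding cR.simps by (intro exec.Seq[OF 1(1)] exec.Seq[OF 2(1)] exec.IfRLe_True True 3)
    then show ?thesis using True cm 1 2 3 keeps_trans[OF k2 3(4)]
      by - (intro exI conjI, assumption, auto)
  next
    case False
    obtain s3 t3 where 3: "exec (cR d m) s2 t3 s3" "t3 \<le> tR M d" "rreg s3 m = evR d \<rho> (narr s, rarr s)"
      "keeps X m s2 s3" using RIfR.IH(4)[of X m s2 \<rho>] RIfR.prems e2 by auto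
    have "exec (cR (RIfR a b c d) m) s (t1 + (t2 + (1 + t3))) s3"
      unfolding cR.simps by (intro exec.Seq[OF 1(1)] exec.Seq[OF 2(1)] exec.IfRLe_False False 3)
    then show ?thesis using False cm 1 2 3 keeps_trans[OF k2 3(4)]
      by - (intro exI conjI, assumption, auto)
  qed
next
  case (ROp f a b)
  obtain s1 t1 where 1: "exec (cR a m) s t1 s1" "t1 \<le> tR M a"
    "rreg s1 m = evR a \<rho> (narr s, rarr s)" "keeps X m s s1"
    using ROp.IH(1)[of X m s \<rho>] ROp.prems by auto
  have e1: "\<forall>x\<in>X. nreg s1 x = \<rho> x" "narr s1 = narr s" "rarr s1 = rarr s"
    using 1(4) ROp.prems by (auto simp: keeps_def)
  obtain s2 t2 where 2: "exec (cR b (Suc m)) s1 t2 s2" "t2 \<le> tR M b"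
    "rreg s2 (Suc m) = evR b \<rho> (narr s, rarr s)" "keeps X (Suc m) s1 s2"
    using ROp.IH(2)[of X "Suc m" s1 \<rho>] ROp.prems e1 by auto
  have cm: "rreg s2 m = evR a \<rho> (narr s, rarr s)" using 1(3) 2(4) by (auto simp: keeps_def)
  have k2: "keeps X m s s2" using keeps_trans[OF 1(4) keeps_mono[OF 2(4)]] by auto
  have "exec (cR (ROp f a b) m) s (t1 + (t2 + 1)) (set_rreg m (ev_op f (rreg s2 m) (rreg s2 (Suc m))) s2)"
    unfolding cR.simps by (intro exec.Seq[OF 1(1)] exec.Seq[OF 2(1)] exec_com_op)
  then show ?case using 1 2 cm k2
    by - (intro exI conjI, assumption, auto simp: set_rreg_def keeps_def)
qed

definition corresponds :: "nat set \<Rightarrow> (nat \<Rightarrow> nat) \<Rightarrow> mem \<Rightarrow> store \<Rightarrow> bool" where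
  "corresponds X \<rho> \<sigma> s \<longleftrightarrow> (\<forall>x\<in>X. nreg s x = \<rho> x) \<and> narr s = fst \<sigma> \<and> rarr s = snd \<sigma>"

lemma corresponds_keeps: "corresponds X \<rho> \<sigma> s \<Longrightarrow> keeps X m s s' \<Longrightarrow> corresponds X \<rho> \<sigma> s'"
  by (auto simp: corresponds_def keeps_def)

lemma cN_corresponds:
  assumes "wfN X e" "X \<subseteq> {..<100}" "100 \<le> m" "corresponds X \<rho> \<sigma> s"
  obtains s' t where "exec (cN e m) s t s'" "t \<le> tN e" "nreg s' m = evN e \<rho> \<sigma>"
    "keeps X m s s'" "corresponds X \<rho> \<sigma> s'"
proof -
  have a: "\<forall>x\<in>X. nreg s x = \<rho> x" "(narr s, rarr s) = \<sigma>"
    using assms(4) by (auto simp: corresponds_def)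
  show ?thesis
    by (rule cN_keeps[OF assms(1-3) a(1)])
       (rule that, use a(2) corresponds_keeps[OF assms(4)] in auto)
qed

lemma cR_corresponds:
  assumes "wfR X e" "X \<subseteq> {..<100}" "100 \<le> m" "corresponds X \<rho> \<sigma> s" "\<forall>y<10. \<rho> y \<le> M"
  obtains s' t where "exec (cR e m) s t s'" "t \<le> tR M e" "rreg s' m = evR e \<rho> \<sigma>"
    "keeps X m s s'" "corresponds X \<rho> \<sigma> s'"
proof -
  have a: "\<forall>x\<in>X. nreg s x = \<rho> x" "(narr s, rarr s) = \<sigma>"
    using assms(4) by (auto simp: corresponds_def)
  show ?thesis
    using cR_correct[OF assms(1-3) a(1) assms(5)] corresponds_keeps[OF assms(4)] that
    unfolding a(2) by blast
qed

lemma cS_correct: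
  assumes "wfS X c" "X \<subseteq> {..<100}" "corresponds X \<rho> \<sigma> s" "\<forall>y<10. \<rho> y \<le> M"
  shows "\<exists>s' t. exec (cS c) s t s' \<and> t \<le> tS M c \<and> corresponds X \<rho> (sem c \<rho> \<sigma>) s'"
  using assms
proof (induction c arbitrary: s \<sigma> X \<rho>)
  case SSkip
  then show ?case by (auto intro!: exI exec.Skip)
next
  case (NSt A i e)
  obtain s1 t1 where 1: "exec (cN i 100) s t1 s1" "t1 \<le> tN i" "nreg s1 100 = evN i \<rho> \<sigma>"
    "corresponds X \<rho> \<sigma> s1" by (rule cN_corresponds[of X i 100 \<rho> \<sigma> s]) (use NSt.prems in auto)
  obtain s2 t2 where 2: "exec (cN e 101) s1 t2 s2" "t2 \<le> tN e" "nreg s2 101 = evN e \<rho> \<sigma>"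
    "keeps X 101 s1 s2" "corresponds X \<rho> \<sigma> s2"
    by (rule cN_corresponds[of X e 101 \<rho> \<sigma> s1]) (use NSt.prems 1 in auto)
  have n: "nreg s2 100 = evN i \<rho> \<sigma>" using 2(4) 1(3) by (auto simp: keeps_def)
  have "exec (cS (NSt A i e)) s (t1 + (t2 + 1)) (set_narr A (nreg s2 100) (nreg s2 101) s2)"
    unfolding cS.simps by (intro exec.Seq[OF 1(1)] exec.Seq[OF 2(1)] exec.NStore)
  then show ?case using 1 2 n
    by - (intro exI conjI, assumption, auto simp: set_narr_def corresponds_def)
next
  case (RSt A i e)
  obtain s1 t1 where 1: "exec (cN i 100) s t1 s1" "t1 \<le> tN i" "nreg s1 100 = evN i \<rho> \<sigma>"
    "corresponds X \<rho> \<sigma> s1" by (rule cN_corresponds[of X i 100 \<rho> \<sigma> s]) (use RSt.prems in auto)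
  obtain s2 t2 where 2: "exec (cR e 101) s1 t2 s2" "t2 \<le> tR M e" "rreg s2 101 = evR e \<rho> \<sigma>"
    "keeps X 101 s1 s2" "corresponds X \<rho> \<sigma> s2"
    by (rule cR_corresponds[of X e 101 \<rho> \<sigma> s1 M]) (use RSt.prems 1 in auto)
  have n: "nreg s2 100 = evN i \<rho> \<sigma>" using 2(4) 1(3) by (auto simp: keeps_def)
  have "exec (cS (RSt A i e)) s (t1 + (t2 + 1)) (set_rarr A (nreg s2 100) (rreg s2 101) s2)"
    unfolding cS.simps by (intro exec.Seq[OF 1(1)] exec.Seq[OF 2(1)] exec.RStore)
  then show ?case using 1 2 n
    by - (intro exI conjI, assumption, auto simp: set_rarr_def corresponds_def)
next
  case (SSeq c d)
  obtain s1 t1 where 1: "exec (cS c) s t1 s1" "t1 \<le> tS M c" "corresponds X \<rho> (sem c \<rho> \<sigma>) s1"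
    using SSeq.IH(1)[of X \<rho> \<sigma> s] SSeq.prems by auto
  obtain s2 t2 where 2: "exec (cS d) s1 t2 s2" "t2 \<le> tS M d"
    "corresponds X \<rho> (sem d \<rho> (sem c \<rho> \<sigma>)) s2"
    using SSeq.IH(2)[of X \<rho> "sem c \<rho> \<sigma>" s1] SSeq.prems 1 by auto
  have "exec (cS (c ;; d)) s (t1 + t2) s2" unfolding cS.simps by (intro exec.Seq[OF 1(1) 2(1)])
  then show ?case using 1 2 by - (intro exI conjI, assumption, auto)
next
  case (SIfN a b c d)
  obtain s1 t1 where 1: "exec (cN a 100) s t1 s1" "t1 \<le> tN a" "nreg s1 100 = evN a \<rho> \<sigma>"
    "corresponds X \<rho> \<sigma> s1" by (rule cN_corresponds[of X a 100 \<rho> \<sigma> s]) (use SIfN.prems in auto)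
  obtain s2 t2 where 2: "exec (cN b 101) s1 t2 s2" "t2 \<le> tN b" "nreg s2 101 = evN b \<rho> \<sigma>"
    "keeps X 101 s1 s2" "corresponds X \<rho> \<sigma> s2"
    by (rule cN_corresponds[of X b 101 \<rho> \<sigma> s1]) (use SIfN.prems 1 in auto)
  have n: "nreg s2 100 = evN a \<rho> \<sigma>" using 2(4) 1(3) by (auto simp: keeps_def)
  show ?case
  proof (cases "nreg s2 100 \<le> nreg s2 101")
    case True
    obtain s3 t3 where 3: "exec (cS c) s2 t3 s3" "t3 \<le> tS M c" "corresponds X \<rho> (sem c \<rho> \<sigma>) s3"
      using SIfN.IH(1)[of X \<rho> \<sigma> s2] SIfN.prems 2 by auto
    have "exec (cS (SIfN a b c d)) s (t1 + (t2 + (1 + t3))) s3"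
      unfolding cS.simps by (intro exec.Seq[OF 1(1)] exec.Seq[OF 2(1)] exec.IfNLe_True True 3)
    then show ?thesis using True n 1 2 3 by - (intro exI conjI, assumption, auto)
  next
    case False
    obtain s3 t3 where 3: "exec (cS d) s2 t3 s3" "t3 \<le> tS M d" "corresponds X \<rho> (sem d \<rho> \<sigma>) s3"
      using SIfN.IH(2)[of X \<rho> \<sigma> s2] SIfN.prems 2 by auto
    have "exec (cS (SIfN a b c d)) s (t1 + (t2 + (1 + t3))) s3"
      unfolding cS.simps by (intro exec.Seq[OF 1(1)] exec.Seq[OF 2(1)] exec.IfNLe_False False 3)
    then show ?thesis using False n 1 2 3 by - (intro exI conjI, assumption, auto)
  qed
next
  case (SIfR a b c d)
  obtain s1 t1 where 1: "exec (cR a 100) s t1 s1" "t1 \<le> tR M a" "rreg s1 100 = evR a \<rho> \<sigma>"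
    "corresponds X \<rho> \<sigma> s1" by (rule cR_corresponds[of X a 100 \<rho> \<sigma> s M]) (use SIfR.prems in auto)
  obtain s2 t2 where 2: "exec (cR b 101) s1 t2 s2" "t2 \<le> tR M b" "rreg s2 101 = evR b \<rho> \<sigma>"
    "keeps X 101 s1 s2" "corresponds X \<rho> \<sigma> s2"
    by (rule cR_corresponds[of X b 101 \<rho> \<sigma> s1 M]) (use SIfR.prems 1 in auto)
  have n: "rreg s2 100 = evR a \<rho> \<sigma>" using 2(4) 1(3) by (auto simp: keeps_def)
  show ?case
  proof (cases "rreg s2 100 \<le> rreg s2 101")
    case True
    obtain s3 t3 where 3: "exec (cS c) s2 t3 s3" "t3 \<le> tS M c" "corresponds X \<rho> (sem c \<rho> \<sigma>) s3"
      using SIfR.IH(1)[of X \<rho> \<sigma> s2] SIfR.prems 2 by auto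
    have "exec (cS (SIfR a b c d)) s (t1 + (t2 + (1 + t3))) s3"
      unfolding cS.simps by (intro exec.Seq[OF 1(1)] exec.Seq[OF 2(1)] exec.IfRLe_True True 3)
    then show ?thesis using True n 1 2 3 by - (intro exI conjI, assumption, auto)
  next
    case False
    obtain s3 t3 where 3: "exec (cS d) s2 t3 s3" "t3 \<le> tS M d" "corresponds X \<rho> (sem d \<rho> \<sigma>) s3"
      using SIfR.IH(2)[of X \<rho> \<sigma> s2] SIfR.prems 2 by auto
    have "exec (cS (SIfR a b c d)) s (t1 + (t2 + (1 + t3))) s3"
      unfolding cS.simps by (intro exec.Seq[OF 1(1)] exec.Seq[OF 2(1)] exec.IfRLe_False False 3)
    then show ?thesis using False n 1 2 3 by - (intro exI conjI, assumption, auto)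
  qed
next
  case (SFor x y c)
  define W where "W = WhileNLess x y (Seq (cS c) (Seq (NConst 100 1) (NAdd x x 100)))"
  define G where "G = (\<lambda>i. sem c (\<rho>(x := i)))"
  note prems = SFor.prems
  have wf: "x \<notin> X" "10 \<le> x" "x < 100" "y \<in> X" "y < 10" "wfS (insert x X) c" using prems by auto
  have loop: "\<exists>s' t. exec W s0 t s' \<and> t \<le> (\<rho> y - i) * (tS M c + 3) + 1 \<and>
      corresponds X \<rho> (fold G [i..<\<rho> y] \<tau>) s'"
    if "i \<le> \<rho> y" "nreg s0 x = i" "corresponds X \<rho> \<tau> s0" for i s0 \<tau>
    using that
  proof (induction i arbitrary: s0 \<tau> rule: inc_induct)
    case base
    have "exec W s0 1 s0" unfolding W_def using base wf
      by (intro exec.While_False) (auto simp: corresponds_def)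
    then show ?case using base by - (intro exI conjI, assumption, auto simp: G_def)
  next
    case (step i)
    have b: "\<forall>ya<10. (\<rho>(x := i)) ya \<le> M" using prems wf by auto
    have "corresponds (insert x X) (\<rho>(x := i)) \<tau> s0" using step.prems wf by (auto simp: corresponds_def)
    note ag = this
    have "\<exists>s' t. exec (cS c) s0 t s' \<and> t \<le> tS M c \<and>
        corresponds (insert x X) (\<rho>(x := i)) (G i \<tau>) s'"
      unfolding G_def using wf prems by (intro SFor.IH[OF wf(6) _ ag b]) auto
    then obtain s1 t1 where 1: "exec (cS c) s0 t1 s1" "t1 \<le> tS M c"
      "corresponds (insert x X) (\<rho>(x := i)) (G i \<tau>) s1" by blast
    define s2 where "s2 = set_nreg 100 1 s1"
    define s3 where "s3 = set_nreg x (nreg s2 x + nreg s2 100) s2"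
    have ex: "exec (Seq (cS c) (Seq (NConst 100 1) (NAdd x x 100))) s0 (t1 + (1 + 1)) s3"
      unfolding s2_def s3_def by (rule exec.Seq[OF 1(1) exec.Seq[OF exec.NConst exec.NAdd]])
    have mX: "100 \<notin> X" using prems by auto
    have k3: "corresponds X \<rho> (G i \<tau>) s3" using 1(3) wf mX
      by (auto simp: s3_def s2_def corresponds_def set_nreg_def)
    have n3: "nreg s3 x = Suc i" using 1(3) wf
      by (auto simp: s3_def s2_def set_nreg_def corresponds_def)
    from step.IH[OF n3 k3] obtain s5 t5 where 5: "exec W s3 t5 s5"
      "t5 \<le> (\<rho> y - Suc i) * (tS M c + 3) + 1"
      "corresponds X \<rho> (fold G [Suc i..<\<rho> y] (G i \<tau>)) s5"
      by blast
    have lt: "nreg s0 x < nreg s0 y" using step wf by (auto simp: corresponds_def)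
    have "exec W s0 (1 + (t1 + (1 + 1)) + t5) s5"
      unfolding W_def by (rule exec.While_True[OF lt ex 5(1)[unfolded W_def]])
    moreover have "\<rho> y - i = Suc (\<rho> y - Suc i)" using step.hyps by simp
    ultimately show ?case using 5 1 step.hyps
      by - (intro exI conjI, assumption, auto simp: upt_conv_Cons)
  qed
  define s1 where "s1 = set_nreg x 0 s"
  have "corresponds X \<rho> \<sigma> s1" "nreg s1 x = 0"
    using prems wf by (auto simp: s1_def corresponds_def set_nreg_def)
  then obtain s2 t2 where 2: "exec W s1 t2 s2" "t2 \<le> \<rho> y * (tS M c + 3) + 1"
     "corresponds X \<rho> (fold G [0..<\<rho> y] \<sigma>) s2"
    using loop[of 0 s1 \<sigma>] by auto
  have "exec (cS (SFor x y c)) s (1 + t2) s2"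
    unfolding cS.simps W_def[symmetric]
    by (intro exec.Seq[OF exec.NConst] 2(1)[unfolded s1_def])
  moreover have "\<rho> y * (tS M c + 3) \<le> M * (tS M c + 3)" using wf prems by (intro mult_right_mono) auto
  then have "t2 \<le> M * (tS M c + 3) + 1" using 2(2) by linarith
  moreover have "sem (SFor x y c) \<rho> \<sigma> = fold G [0..<\<rho> y] \<sigma>" unfolding G_def sem.simps ..
  ultimately show ?case using 2 by - (intro exI conjI, assumption, simp_all del: sem.simps)
qed

section \<open>Running times as polynomials in the common bound on the loop lengths\<close>

primrec depthR :: "rexp \<Rightarrow> nat" where
  "depthR (RC q) = 0"
| "depthR (RA A e) = 0"
| "depthR (ROp f a b) = max (depthR a) (depthR b)"
| "depthR (RIfN a b c d) = max (depthR c) (depthR d)"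
| "depthR (RIfR a b c d) = max (max (depthR a) (depthR b)) (max (depthR c) (depthR d))"
| "depthR (RSum x y e) = Suc (depthR e)"

primrec depthS :: "stm \<Rightarrow> nat" where
  "depthS SSkip = 0"
| "depthS (NSt A i e) = 0"
| "depthS (RSt A i e) = depthR e"
| "depthS (c ;; d) = max (depthS c) (depthS d)"
| "depthS (SIfN a b c d) = max (depthS c) (depthS d)"
| "depthS (SIfR a b c d) = max (max (depthR a) (depthR b)) (max (depthS c) (depthS d))"
| "depthS (SFor x y c) = Suc (depthS c)"

text \<open>For \<open>m \<ge> 1\<close> the powers of \<open>m\<close> increase with the exponent,
  so that constants and lower degrees are absorbed.\<close>

definition poly_bounded :: "nat \<Rightarrow> (nat \<Rightarrow> nat) \<Rightarrow> bool" where
  "poly_bounded d t \<longleftrightarrow> (\<exists>a. \<forall>m\<ge>1. t m \<le> a * m ^ d)"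

lemma poly_bounded_const: "poly_bounded d (\<lambda>_. a)"
  unfolding poly_bounded_def by (intro exI[of _ a]) auto

lemma poly_bounded_mono:
  assumes "poly_bounded d t" "d \<le> d'" shows "poly_bounded d' t"
proof -
  from assms obtain a where a: "\<And>m. 1 \<le> m \<Longrightarrow> t m \<le> a * m ^ d"
    unfolding poly_bounded_def by blast
  have "t m \<le> a * m ^ d'" if "1 \<le> m" for m
    using a[OF that] power_increasing[OF assms(2) that] by (meson le_trans mult_le_mono2)
  then show ?thesis unfolding poly_bounded_def by blast
qed

lemma poly_bounded_add:
  assumes "poly_bounded d t" "poly_bounded d u" shows "poly_bounded d (\<lambda>m. t m + u m)"
proof -
  from assms obtain a b where "\<forall>m\<ge>1. t m \<le> a * m ^ d" "\<forall>m\<ge>1. u m \<le> b * m ^ d"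
    unfolding poly_bounded_def by blast
  then show ?thesis unfolding poly_bounded_def
    by (intro exI[of _ "a + b"]) (auto simp: add_mult_distrib intro: add_mono)
qed

lemma poly_bounded_Suc: "poly_bounded d t \<Longrightarrow> poly_bounded d (\<lambda>m. Suc (t m))"
  using poly_bounded_add[of d t "\<lambda>_. 1"] poly_bounded_const[of d 1] by simp

lemma poly_bounded_times:
  assumes "poly_bounded d t" shows "poly_bounded (Suc d) (\<lambda>m. m * t m)"
proof -
  from assms obtain a where "\<forall>m\<ge>1. t m \<le> a * m ^ d"
    unfolding poly_bounded_def by blast
  then show ?thesis unfolding poly_bounded_def
    by (intro exI[of _ a]) (auto simp: mult.left_commute)
qed

text \<open>Only loops raise the degree, and expressions over the natural numbers contain
  none.\<close>

lemma tR_poly_bounded: "poly_bounded (depthR e) (\<lambda>m. tR m e)"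
  by (induction e)
     (auto intro!: poly_bounded_Suc poly_bounded_add poly_bounded_times poly_bounded_const intro: poly_bounded_mono)

lemma tS_poly_bounded: "poly_bounded (depthS c) (\<lambda>m. tS m c)"
  by (induction c)
     (auto intro!: poly_bounded_Suc poly_bounded_add poly_bounded_times poly_bounded_const
           intro: poly_bounded_mono poly_bounded_mono[OF tR_poly_bounded])

text \<open>A syntactic superset of the arrays that are changed; it reduces all frame conditions for
  the large programs below to membership in explicit finite sets.\<close>

primrec wrN :: "stm \<Rightarrow> nat set" where
  "wrN SSkip = {}"
| "wrN (NSt A i e) = {A}"
| "wrN (RSt A i e) = {}"
| "wrN (c ;; d) = wrN c \<union> wrN d"
| "wrN (SIfN a b c d) = wrN c \<union> wrN d"
| "wrN (SIfR a b c d) = wrN c \<union> wrN d"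
| "wrN (SFor x y c) = wrN c"

primrec wrR :: "stm \<Rightarrow> nat set" where
  "wrR SSkip = {}"
| "wrR (NSt A i e) = {}"
| "wrR (RSt A i e) = {A}"
| "wrR (c ;; d) = wrR c \<union> wrR d"
| "wrR (SIfN a b c d) = wrR c \<union> wrR d"
| "wrR (SIfR a b c d) = wrR c \<union> wrR d"
| "wrR (SFor x y c) = wrR c"

lemma sem_For_inv:
  assumes "I 0 \<sigma>" "\<And>i \<tau>. i < \<rho> y \<Longrightarrow> I i \<tau> \<Longrightarrow> I (Suc i) (sem c (\<rho>(x := i)) \<tau>)"
  shows "I (\<rho> y) (sem (SFor x y c) \<rho> \<sigma>)"
proof -
  have "I l (fold (\<lambda>i. sem c (\<rho>(x := i))) [0..<l] \<sigma>)" if "l \<le> \<rho> y" for l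
    using that by (induction l) (use assms in auto)
  then show ?thesis by simp
qed

lemma sem_frameN: "A \<notin> wrN c \<Longrightarrow> fst (sem c \<rho> \<sigma>) A = fst \<sigma> A"
proof (induction c arbitrary: \<rho> \<sigma>)
  case (SFor x y c)
  then show ?case by (intro sem_For_inv[where I = "\<lambda>_ \<tau>. fst \<tau> A = fst \<sigma> A"]) auto
qed auto

lemma sem_frameR: "A \<notin> wrR c \<Longrightarrow> snd (sem c \<rho> \<sigma>) A = snd \<sigma> A"
proof (induction c arbitrary: \<rho> \<sigma>)
  case (SFor x y c)
  then show ?case by (intro sem_For_inv[where I = "\<lambda>_ \<tau>. snd \<tau> A = snd \<sigma> A"]) auto
qed auto

section \<open>Choosing the number of rounds\<close>

text \<open>With \<open>x = Oc / C\<close>, the left side is minimal at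
  \<open>\<gamma> = ln (2 / x)\<close>, where \<open>2 * exp (-\<gamma>) = x\<close> and its value
  is \<open>(1 + x) * alpha_FL_fun x\<close>. Clamping to \<open>{1..4}\<close> guarantees enough
  rounds to serve every class and bounds their number; outside that range the value 1.4625 leaves
  enough room at the end points.\<close>

lemma tradeoff_exists:
  fixes Oc C :: real
  assumes "0 \<le> Oc" "0 < C"
  shows "\<exists>\<gamma>\<in>{1..4}. \<gamma> * Oc + C + 2 * C * exp (-\<gamma>) \<le> alpha_FL * (Oc + C)"
proof -
  have al: "1.4625 \<le> alpha_FL" using alpha_FL_approx by simp
  have e1: "2.5 \<le> exp (1::real)" using exp_lower_Taylor_quadratic[of 1] by simp
  have e4: "39 \<le> exp (4::real)"
  proof -
    have "(2.5::real) ^ 4 \<le> exp 1 ^ 4" using e1 by (intro power_mono) auto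
    also have "exp 1 ^ 4 = exp (4::real)" by (simp flip: exp_of_nat_mult)
    finally show ?thesis by (simp add: eval_nat_numeral)
  qed
  define x where "x = Oc / C"
  have x: "Oc = x * C" "0 \<le> x" using assms by (auto simp: x_def)
  have "\<exists>\<gamma>\<in>{1..4}. \<gamma> * x + 1 + 2 * exp (-\<gamma>) \<le> alpha_FL * (x + 1)"
  proof -
    consider "2 * exp (-1) \<le> x" | "x \<le> 2 * exp (-4)" | "2 * exp (-4) < x" "x < 2 * exp (-1)"
      by linarith
    then show ?thesis
    proof cases
      case 1
      have "exp (-1::real) \<le> 1 / 2.5" using e1 by (simp add: exp_minus field_simps)
      then have "x + 1 + 2 * exp (-1) \<le> 1.4625 * (x + 1)" using 1 by simp
      also have "\<dots> \<le> alpha_FL * (x + 1)" using al x by (intro mult_right_mono) auto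
      finally show ?thesis by (intro bexI[of _ 1]) auto
    next
      case 2
      have "exp (-4::real) \<le> 1 / 39" using e4 by (simp add: exp_minus field_simps)
      then have "4 * x + 1 + 2 * exp (-4) \<le> 1.4625 * (x + 1)" using 2 x by simp
      also have "\<dots> \<le> alpha_FL * (x + 1)" using al x by (intro mult_right_mono) auto
      finally show ?thesis by (intro bexI[of _ 4]) auto
    next
      case 3
      have x0: "0 < x" using 3 by (smt (verit) exp_gt_zero)
      define \<gamma> where "\<gamma> = ln (2 / x)"
      have ex: "exp (-\<gamma>) = x / 2" using x0 by (simp add: \<gamma>_def exp_minus)
      have "exp (-4) < exp (-\<gamma>)" "exp (-\<gamma>) < exp (-1)" using 3 ex by auto
      then have g: "\<gamma> \<in> {1..4}" by (simp del: ex)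
      obtain "alpha_FL_fun x \<le> alpha_FL" using alpha_FL_max(1) x(2) by auto
      then have "(1 + x / (1 + x) * \<gamma>) * (1 + x) \<le> alpha_FL * (1 + x)"
        using x0 by (intro mult_right_mono) (auto simp: alpha_FL_fun_def \<gamma>_def)
      moreover have "(1 + x / (1 + x) * \<gamma>) * (1 + x) = \<gamma> * x + 1 + 2 * exp (-\<gamma>)"
        using x0 ex by (simp add: field_simps)
      ultimately show ?thesis using g by (intro bexI[of _ \<gamma>]) (auto simp: add.commute)
    qed
  qed
  then obtain \<gamma> where "\<gamma> \<in> {1..4}" "\<gamma> * x + 1 + 2 * exp (-\<gamma>) \<le> alpha_FL * (x + 1)" by blast
  then have "\<gamma> \<in> {1..4}" "(\<gamma> * x + 1 + 2 * exp (-\<gamma>)) * C \<le> alpha_FL * (x + 1) * C"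
    using assms by auto
  then show ?thesis unfolding x(1) by (intro bexI[of _ \<gamma>]) (auto simp: algebra_simps)
qed

lemma rounds_exist:
  fixes Oc C :: real and N :: nat
  assumes "0 \<le> Oc" "0 \<le> C" "1 \<le> N"
  shows "\<exists>M\<in>{N..4 * N + 5}. real M / N * Oc + C + 2 * C * (N / (N + 1)) ^ M \<le> (alpha_FL + 5 / N) * (Oc + C)"
proof (cases "C = 0")
  case True
  have "1 \<le> alpha_FL + 5 / N"
    using alpha_FL_approx by (intro add_increasing2) auto
  then have "Oc \<le> (alpha_FL + 5 / N) * Oc"
    using mult_right_mono[of 1 "alpha_FL + 5 / N" Oc] assms by simp
  then show ?thesis using True assms by (intro bexI[of _ N]) auto
next
  case False
  then obtain \<gamma> where g: "1 \<le> \<gamma>" "\<gamma> \<le> 4" "\<gamma> * Oc + C + 2 * C * exp (-\<gamma>) \<le> alpha_FL * (Oc + C)"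
    using tradeoff_exists[of Oc C] assms by auto
  define u where "u = ln (1 + 1 / real N)"
  have u: "u \<le> 1 / N" using assms ln_add_one_self_le_self[of "1 / real N"] by (simp add: u_def)
  have pos: "0 < 1 + 1 / real N" by (intro add_pos_nonneg) auto
  have inv: "N / (N + 1) = inverse (1 + 1 / real N)" using assms by (simp add: field_simps)
  have u': "1 / (N + 1) \<le> u"
  proof -
    have "ln (N / (N + 1)) \<le> real N / (N + 1) - 1" using assms by (intro ln_le_minus_one) auto
    moreover have "ln (N / (N + 1)) = - u" unfolding inv u_def using pos by (simp add: ln_inverse)
    moreover have "real N / (N + 1) - 1 = - (1 / (N + 1))" by (simp add: field_simps)
    ultimately show ?thesis by linarith
  qed
  have "0 < 1 / real (N + 1)" by simp
  then have u0: "0 < u" using u' by linarith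
  \<comment> \<open>A round contracts by \<open>N / (N + 1) = exp (- u)\<close> with
    \<open>u\<close> slightly below \<open>1 / N\<close>, and \<open>M\<close> is the least number
    of rounds contracting by \<open>exp (-\<gamma>)\<close>. As \<open>1 / u \<le> N + 1\<close> and
    \<open>\<gamma> \<le> 4\<close>, rounding up stays within
    \<open>4 * (N + 1) + 1 = 4 * N + 5\<close>.\<close>
  define M where "M = nat \<lceil>\<gamma> / u\<rceil>"
  have M: "\<gamma> / u \<le> M" "M \<le> \<gamma> / u + 1"
  proof -
    have "0 \<le> \<gamma> / u" using g u0 by simp
    then have "real M = of_int \<lceil>\<gamma> / u\<rceil>" unfolding M_def by (simp add: of_nat_nat)
    then show "\<gamma> / u \<le> M" "M \<le> \<gamma> / u + 1" by linarith+
  qed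
  have "\<gamma> / u \<le> \<gamma> * (N + 1)"
  proof -
    have "\<gamma> / u \<le> \<gamma> / (1 / (N + 1))" using u' g u0 by (intro divide_left_mono) auto
    then show ?thesis by simp
  qed
  then have Mle: "M \<le> \<gamma> * (N + 1) + 1" using M by linarith
  have "N \<le> 1 / u" using u u0 assms by (simp add: field_simps)
  also have "\<dots> \<le> \<gamma> / u" using g u0 by (intro divide_right_mono) auto
  finally have NM: "N \<le> M" using M by linarith
  have "\<gamma> * real (N + 1) \<le> 4 * real (N + 1)" using g by (intro mult_right_mono) auto
  then have "real M \<le> real (4 * N + 5)" using Mle by simp
  then have M4: "M \<le> 4 * N + 5" by (simp only: of_nat_le_iff)
  have r: "real M / N \<le> \<gamma> + 5 / N"
  proof -
    have "real M / N \<le> (\<gamma> * (N + 1) + 1) / N" using Mle by (intro divide_right_mono) auto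
    also have "\<dots> = \<gamma> + (\<gamma> + 1) / N" using assms by (simp add: field_simps)
    also have "\<dots> \<le> \<gamma> + 5 / N" using g by (intro add_left_mono divide_right_mono) auto
    finally show ?thesis .
  qed
  have "(N / (N + 1)) ^ M = exp (- u * M)"
  proof -
    have "exp (- u) = N / (N + 1)" unfolding inv u_def exp_minus using pos by simp
    then have "(N / (N + 1)) ^ M = exp (- u) ^ M" by simp
    also have "\<dots> = exp (- u * M)" by (simp add: exp_of_nat_mult[symmetric] mult.commute)
    finally show ?thesis .
  qed
  also have "\<dots> \<le> exp (- \<gamma>)" using M(1) u0 by (simp add: field_simps)
  finally have "2 * C * (N / (N + 1)) ^ M \<le> 2 * C * exp (-\<gamma>)" using assms by (intro mult_left_mono) auto
  moreover have "real M / N * Oc \<le> (\<gamma> + 5 / N) * Oc" using r assms by (intro mult_right_mono) auto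
  moreover have "0 \<le> 5 / N * C" using assms by simp
  ultimately have "real M / N * Oc + C + 2 * C * (N / (N + 1)) ^ M
      \<le> (\<gamma> * Oc + C + 2 * C * exp (-\<gamma>)) + 5 / N * (Oc + C)"
    by (simp add: distrib_left distrib_right)
  also have "\<dots> \<le> alpha_FL * (Oc + C) + 5 / N * (Oc + C)" using g(3) by simp
  finally have "real M / N * Oc + C + 2 * C * (N / (N + 1)) ^ M \<le> (alpha_FL + 5 / N) * (Oc + C)"
    by (simp add: distrib_right)
  then show ?thesis using NM M4 by (intro bexI[of _ M]) auto
qed

section \<open>Minima over random subsets\<close>

text \<open>The expectation of \<open>\<phi>\<close> at the minimum of \<open>x\<close> and the values \<open>d r\<close> over a random subset
  of \<open>R\<close> that contains each element independently with probability \<open>p\<close>.\<close>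

definition exp_min :: "real \<Rightarrow> (real \<Rightarrow> real) \<Rightarrow> real \<Rightarrow> (nat \<Rightarrow> real) \<Rightarrow> nat set \<Rightarrow> real" where
  "exp_min p \<phi> x d R = (\<Sum>J\<in>Pow R. p ^ card J * (1 - p) ^ card (R - J) * \<phi> (Min (insert x (d ` J))))"

lemma exp_min_empty [simp]: "exp_min p \<phi> x d {} = \<phi> x"
  by (simp add: exp_min_def)

lemma Min_insert_min:
  fixes x :: real
  assumes "finite J" shows "Min (insert x (d ` insert r J)) = Min (insert (min x (d r)) (d ` J))"
  using assms by (cases "J = {}") (auto simp: min.assoc)

lemma exp_min_insert:
  assumes "finite R" "r \<notin> R"
  shows "exp_min p \<phi> x d (insert r R) = p * exp_min p \<phi> (min x (d r)) d R + (1 - p) * exp_min p \<phi> x d R"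
proof -
  let ?f = "\<lambda>J. p ^ card J * (1 - p) ^ card (insert r R - J) * \<phi> (Min (insert x (d ` J)))"
  have inj: "inj_on (insert r) (Pow R)" using assms by (auto simp: inj_on_def)
  have disj: "Pow R \<inter> insert r ` Pow R = {}" using assms by auto
  have "exp_min p \<phi> x d (insert r R) = sum ?f (Pow R) + sum ?f (insert r ` Pow R)"
    unfolding exp_min_def Pow_insert using assms disj by (intro sum.union_disjoint) auto
  also have "sum ?f (insert r ` Pow R) = (\<Sum>J\<in>Pow R. ?f (insert r J))"
    using inj by (simp add: sum.reindex)
  also have "\<dots> = (\<Sum>J\<in>Pow R. p * (p ^ card J * (1 - p) ^ card (R - J) * \<phi> (Min (insert (min x (d r)) (d ` J)))))"
  proof (intro sum.cong refl)
    fix J assume J: "J \<in> Pow R"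
    have f: "finite J" "r \<notin> J" using J assms finite_subset by auto
    have "insert r R - insert r J = R - J" using assms J by auto
    then show "?f (insert r J) = p * (p ^ card J * (1 - p) ^ card (R - J) * \<phi> (Min (insert (min x (d r)) (d ` J))))"
      using f Min_insert_min[OF f(1), of x d r] by simp
  qed
  also have "sum ?f (Pow R) = (\<Sum>J\<in>Pow R. (1 - p) * (p ^ card J * (1 - p) ^ card (R - J) * \<phi> (Min (insert x (d ` J)))))"
  proof (intro sum.cong refl)
    fix J assume J: "J \<in> Pow R"
    have "insert r R - J = insert r (R - J)" using assms J by auto
    then show "?f J = (1 - p) * (p ^ card J * (1 - p) ^ card (R - J) * \<phi> (Min (insert x (d ` J))))"
      using assms by simp
  qed
  finally show ?thesis by (simp add: exp_min_def sum_distrib_left)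
qed

text \<open>Moves a change of the initial value into the integrand, so that inequalities between
  such expectations follow pointwise from \<open>exp_min_mono\<close>.\<close>

lemma exp_min_shift:
  "finite R \<Longrightarrow> exp_min p \<phi> (min x c) d R = exp_min p (\<lambda>y. \<phi> (min y c)) x d R"
proof (induction R arbitrary: x rule: finite_induct)
  case (insert r R)
  have "min (min x c) (d r) = min (min x (d r)) c" by (simp add: min.assoc min.commute min.left_commute)
  then show ?case using insert by (simp add: exp_min_insert)
qed simp

lemma exp_min_cong:
  "(\<And>r. r \<in> R \<Longrightarrow> d r = d' r) \<Longrightarrow> exp_min p \<phi> x d R = exp_min p \<phi> x d' R"
  unfolding exp_min_def by (intro sum.cong refl) (simp cong: image_cong add: subset_iff)

lemma exp_min_mono:
  assumes "finite R" "0 \<le> p" "p \<le> 1" "\<And>y. \<phi> y \<le> \<psi> y"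
  shows "exp_min p \<phi> x d R \<le> exp_min p \<psi> x d R"
  unfolding exp_min_def using assms by (intro sum_mono mult_left_mono) auto

lemma exp_min_diff:
  "exp_min p (\<lambda>y. \<phi> y - \<psi> y) x d R = exp_min p \<phi> x d R - exp_min p \<psi> x d R"
  by (simp add: exp_min_def sum_subtractf algebra_simps)

lemma exp_min_add:
  "exp_min p (\<lambda>y. \<phi> y + \<psi> y) x d R = exp_min p \<phi> x d R + exp_min p \<psi> x d R"
  by (simp add: exp_min_def sum.distrib algebra_simps)

lemma exp_min_sum:
  "exp_min p (\<lambda>y. \<Sum>i\<in>A. \<phi> i y) x d R = (\<Sum>i\<in>A. exp_min p (\<phi> i) x d R)"
  unfolding exp_min_def by (subst sum.swap) (simp add: sum_distrib_left)

lemma exp_min_const: "finite R \<Longrightarrow> exp_min p (\<lambda>_. c) x d R = c"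
  by (induction R arbitrary: x rule: finite_induct) (auto simp: exp_min_insert algebra_simps)

text \<open>Replacing the independent choices in a block of at most \<open>1 / p\<close> indices by the choice of
  at most one of them decreases the expected minimum.\<close>

lemma exp_min_block:
  assumes "finite B" "finite R" "B \<inter> R = {}" "0 \<le> p" "p \<le> 1"
  shows "p * (\<Sum>u\<in>B. exp_min p (\<lambda>y. y) (min x (d u)) d R) + (1 - p * card B) * exp_min p (\<lambda>y. y) x d R
    \<le> exp_min p (\<lambda>y. y) x d (B \<union> R)"
  using assms(1,3)
proof (induction B arbitrary: x rule: finite_induct)
  case (insert b B)
  define A where "A y = exp_min p (\<lambda>y. y) y d R" for y
  have IH: "p * (\<Sum>u\<in>B. A (min y (d u))) + (1 - p * card B) * A y \<le> exp_min p (\<lambda>y. y) y d (B \<union> R)" for y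
    using insert.prems unfolding A_def by (intro insert.IH) auto
  \<comment> \<open>Diminishing returns, pointwise: of the two caps \<open>d b\<close> and
    \<open>d u\<close>, the larger one lowers a minimum less if the smaller one has been applied
    before.\<close>
  have sup: "A (min x (d b)) + A (min x (d u)) \<le> A (min (min x (d b)) (d u)) + A x" for u
  proof -
    have sh: "A (min x c) = exp_min p (\<lambda>y. min y c) x d R" for x c
      unfolding A_def using exp_min_shift[OF assms(2), of p "\<lambda>y. y" x c d] by simp
    have 1: "A (min x (d b)) + A (min x (d u)) = exp_min p (\<lambda>y. min y (d b) + min y (d u)) x d R"
      unfolding sh exp_min_add by (rule refl)
    have 2: "A (min (min x (d b)) (d u)) + A x = exp_min p (\<lambda>y. min (min y (d b)) (d u) + y) x d R"
      unfolding sh exp_min_add exp_min_shift[OF assms(2)] A_def by (rule refl)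
    show ?thesis unfolding 1 2 using assms by (intro exp_min_mono) auto
  qed
  have e: "exp_min p (\<lambda>y. y) x d (insert b B \<union> R) =
      p * exp_min p (\<lambda>y. y) (min x (d b)) d (B \<union> R) + (1 - p) * exp_min p (\<lambda>y. y) x d (B \<union> R)"
    using insert assms by (simp add: exp_min_insert)
  let ?X = "\<Sum>u\<in>B. A (min (min x (d b)) (d u))" let ?Y = "\<Sum>u\<in>B. A (min x (d u))"
  have "(\<Sum>u\<in>B. A (min x (d b)) + A (min x (d u))) \<le> (\<Sum>u\<in>B. A (min (min x (d b)) (d u)) + A x)"
    by (intro sum_mono sup)
  then have s: "card B * A (min x (d b)) + ?Y \<le> ?X + card B * A x" by (simp add: sum.distrib)
  \<comment> \<open>Opening both \<open>b\<close> and another element of the block has probability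
    of order \<open>p * p\<close>; the difference of the two sides is exactly \<open>p * p\<close>
    times the slack in \<open>s\<close>.\<close>
  have "p * (A (min x (d b)) + ?Y) + (1 - p * (1 + card B)) * A x
      \<le> p * (p * ?X + (1 - p * card B) * A (min x (d b))) + (1 - p) * (p * ?Y + (1 - p * card B) * A x)"
  proof -
    have "p * (p * ?X + (1 - p * card B) * A (min x (d b))) + (1 - p) * (p * ?Y + (1 - p * card B) * A x)
      - (p * (A (min x (d b)) + ?Y) + (1 - p * (1 + card B)) * A x)
      = p * p * (?X + card B * A x - (card B * A (min x (d b)) + ?Y))" by (simp add: algebra_simps)
    moreover have "0 \<le> p * p * (?X + card B * A x - (card B * A (min x (d b)) + ?Y))"
      using s assms by (intro mult_nonneg_nonneg) auto
    ultimately show ?thesis by linarith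
  qed
  also have "\<dots> \<le> exp_min p (\<lambda>y. y) x d (insert b B \<union> R)"
    unfolding e using assms IH by (intro add_mono mult_left_mono) auto
  finally show ?case using insert by (simp add: A_def)
qed simp

text \<open>Method of conditional expectations: \<open>c1\<close> and \<open>c2\<close> are the
  expected totals given that \<open>r\<close> is taken or left out, and one of them is at most their
  average. The distance to a chosen \<open>r\<close> is folded into the initial value
  \<open>x\<close>.\<close>

lemma round_singles:
  fixes cost :: "nat \<Rightarrow> real"
  assumes "finite R" "0 \<le> p" "p \<le> 1"
  shows "\<exists>J\<subseteq>R. (\<Sum>l\<in>J. cost l) + (\<Sum>j\<in>C. Min (insert (x j) (d j ` J)))
    \<le> p * (\<Sum>l\<in>R. cost l) + (\<Sum>j\<in>C. exp_min p (\<lambda>y. y) (x j) (d j) R)"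
  using assms(1)
proof (induction R arbitrary: x rule: finite_induct)
  case (insert r R)
  let ?E = "\<lambda>x. (\<Sum>j\<in>C. exp_min p (\<lambda>y. y) (x j) (d j) R)"
  let ?x = "\<lambda>j. min (x j) (d j r)"
  define c1 c2 where "c1 = cost r + p * (\<Sum>l\<in>R. cost l) + ?E ?x" and "c2 = p * (\<Sum>l\<in>R. cost l) + ?E x"
  have tot: "p * (\<Sum>l\<in>insert r R. cost l) + (\<Sum>j\<in>C. exp_min p (\<lambda>y. y) (x j) (d j) (insert r R)) = p * c1 + (1 - p) * c2"
  proof -
    have "(\<Sum>j\<in>C. exp_min p (\<lambda>y. y) (x j) (d j) (insert r R)) = p * ?E ?x + (1 - p) * ?E x"
      using insert by (simp add: exp_min_insert sum.distrib sum_distrib_left)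
    then show ?thesis using insert by (simp add: c1_def c2_def algebra_simps)
  qed
  have "p * min c1 c2 + (1 - p) * min c1 c2 \<le> p * c1 + (1 - p) * c2"
    using assms by (intro add_mono mult_left_mono) auto
  then have "min c1 c2 \<le> p * c1 + (1 - p) * c2" by (simp add: algebra_simps)
  then consider "c1 \<le> p * c1 + (1 - p) * c2" | "c2 \<le> p * c1 + (1 - p) * c2" by linarith
  then show ?case
  proof cases
    case 1
    obtain J where J: "J \<subseteq> R" "(\<Sum>l\<in>J. cost l) + (\<Sum>j\<in>C. Min (insert (?x j) (d j ` J)))
      \<le> p * (\<Sum>l\<in>R. cost l) + ?E ?x" using insert.IH[of ?x] by blast
    have f: "finite J" "r \<notin> J" using J insert finite_subset by auto
    have "(\<Sum>l\<in>insert r J. cost l) + (\<Sum>j\<in>C. Min (insert (x j) (d j ` insert r J))) \<le> c1"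
      unfolding Min_insert_min[OF f(1)] using J f by (simp add: c1_def)
    then show ?thesis using 1 J tot by (intro exI[of _ "insert r J"]) auto
  next
    case 2
    obtain J where J: "J \<subseteq> R" "(\<Sum>l\<in>J. cost l) + (\<Sum>j\<in>C. Min (insert (x j) (d j ` J)))
      \<le> c2" using insert.IH[of x] c2_def by blast
    then show ?thesis using 2 tot by (intro exI[of _ J]) auto
  qed
qed auto

text \<open>Conditional expectations again, one block at a time. By \<open>exp_min_block\<close> at
  most one index per block may be drawn, each with probability \<open>p\<close>; since
  \<open>p * N = 1\<close>, drawing none has probability 0, so every block is hit. The indices
  outside the blocks are left to \<open>round_singles\<close>.\<close>

lemma round_blocks:
  fixes cost :: "nat \<Rightarrow> real" and Bl :: "nat \<Rightarrow> nat set"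
  assumes "finite R" "1 \<le> N" "p = 1 / real N"
    and "\<And>i. i < k \<Longrightarrow> Bl i \<subseteq> R" "\<And>i. i < k \<Longrightarrow> card (Bl i) = N"
    and "\<And>i i'. i < i' \<Longrightarrow> i' < k \<Longrightarrow> Bl i \<inter> Bl i' = {}"
  shows "\<exists>J\<subseteq>R. (\<forall>i<k. J \<inter> Bl i \<noteq> {}) \<and> (\<Sum>l\<in>J. cost l) + (\<Sum>j\<in>C. Min (insert (x j) (d j ` J)))
    \<le> p * (\<Sum>l\<in>R. cost l) + (\<Sum>j\<in>C. exp_min p (\<lambda>y. y) (x j) (d j) R)"
  using assms(1,4-6)
proof (induction k arbitrary: R x)
  case 0
  obtain J where J: "J \<subseteq> R" "(\<Sum>l\<in>J. cost l) + (\<Sum>j\<in>C. Min (insert (x j) (d j ` J)))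
    \<le> p * (\<Sum>l\<in>R. cost l) + (\<Sum>j\<in>C. exp_min p (\<lambda>y. y) (x j) (d j) R)"
    using round_singles[where R = R and p = p and cost = cost and C = C and x = x and d = d] 0 assms(2,3)
    by force
  show ?case by (intro exI[of _ J] conjI allI impI J) simp
next
  case (Suc k)
  let ?B = "Bl k" let ?R = "R - Bl k"
  have p: "0 < p" "p \<le> 1" "p * N = 1" using assms by auto
  have B: "?B \<subseteq> R" "card ?B = N" using Suc.prems(2)[of k] Suc.prems(3)[of k] by auto
  have "?B \<noteq> {}" using Suc.prems(3)[of k] assms(2) by (metis card.empty lessI not_one_le_zero)
  moreover have "finite ?B" using Suc.prems(1) B finite_subset by blast
  ultimately have B': "finite ?B" "?B \<noteq> {}" by auto
  note B = B B'
  define c where "c u = cost u + p * (\<Sum>l\<in>?R. cost l) + (\<Sum>j\<in>C. exp_min p (\<lambda>y. y) (min (x j) (d j u)) (d j) ?R)" for u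
  have R: "?B \<union> ?R = R" using B by auto
  define K E where "K = p * (\<Sum>l\<in>?R. cost l)"
    and "E j u = exp_min p (\<lambda>y. y) (min (x j) (d j u)) (d j) ?R" for j u
  have "(\<Sum>u\<in>?B. c u) = (\<Sum>u\<in>?B. cost u) + N * K + (\<Sum>u\<in>?B. \<Sum>j\<in>C. E j u)"
    unfolding c_def K_def[symmetric] E_def[symmetric] using B by (simp add: sum.distrib)
  also have "(\<Sum>u\<in>?B. \<Sum>j\<in>C. E j u) = (\<Sum>j\<in>C. \<Sum>u\<in>?B. E j u)" by (rule sum.swap)
  finally have "p * (\<Sum>u\<in>?B. c u) = p * (\<Sum>u\<in>?B. cost u) + p * N * K + p * (\<Sum>j\<in>C. \<Sum>u\<in>?B. E j u)"
    by (simp add: distrib_left)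
  then have "p * (\<Sum>u\<in>?B. c u) = p * (\<Sum>u\<in>?B. cost u) + K + (\<Sum>j\<in>C. p * (\<Sum>u\<in>?B. E j u))"
    using p by (simp add: sum_distrib_left)
  also have "\<dots> \<le> p * (\<Sum>u\<in>?B. cost u) + K + (\<Sum>j\<in>C. exp_min p (\<lambda>y. y) (x j) (d j) R)"
  proof -
    have "p * (\<Sum>u\<in>?B. exp_min p (\<lambda>y. y) (min (x j) (d j u)) (d j) ?R) \<le> exp_min p (\<lambda>y. y) (x j) (d j) R" for j
    proof -
      have "p * (\<Sum>u\<in>?B. exp_min p (\<lambda>y. y) (min (x j) (d j u)) (d j) ?R) + (1 - p * card ?B) * exp_min p (\<lambda>y. y) (x j) (d j) ?R
        \<le> exp_min p (\<lambda>y. y) (x j) (d j) (?B \<union> ?R)"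
        using B p Suc.prems by (intro exp_min_block) auto
      then show ?thesis using p B unfolding R by simp
    qed
    then show ?thesis unfolding E_def by (intro add_mono sum_mono) auto
  qed
  also have "\<dots> = p * (\<Sum>l\<in>R. cost l) + (\<Sum>j\<in>C. exp_min p (\<lambda>y. y) (x j) (d j) R)"
    using sum.subset_diff[OF B(1) Suc.prems(1), of cost] by (simp add: K_def algebra_simps)
  finally have avg: "p * (\<Sum>u\<in>?B. c u) \<le> p * (\<Sum>l\<in>R. cost l) + (\<Sum>j\<in>C. exp_min p (\<lambda>y. y) (x j) (d j) R)"
    (is "_ \<le> ?T") .
  have "\<exists>u\<in>?B. c u \<le> ?T"
  proof (rule ccontr)
    assume "\<not> ?thesis"
    then have "(\<Sum>u\<in>?B. ?T) < (\<Sum>u\<in>?B. c u)" using B by (intro sum_strict_mono) auto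
    then have "p * (\<Sum>u\<in>?B. ?T) < p * (\<Sum>u\<in>?B. c u)" using p by simp
    then have "p * N * ?T < p * (\<Sum>u\<in>?B. c u)" using B by (simp add: mult.assoc)
    then show False using avg p by simp
  qed
  then obtain u where u: "u \<in> ?B" "c u \<le> ?T" by blast
  let ?x = "\<lambda>j. min (x j) (d j u)"
  have "Bl i \<subseteq> ?R" if "i < k" for i
    using Suc.prems(2)[of i] Suc.prems(4)[of i k] that by (simp add: disjoint_iff) blast
  then have "\<exists>J\<subseteq>?R. (\<forall>i<k. J \<inter> Bl i \<noteq> {}) \<and>
    (\<Sum>l\<in>J. cost l) + (\<Sum>j\<in>C. Min (insert (?x j) (d j ` J)))
      \<le> p * (\<Sum>l\<in>?R. cost l) + (\<Sum>j\<in>C. exp_min p (\<lambda>y. y) (?x j) (d j) ?R)"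
    using Suc.prems by (intro Suc.IH) auto
  then obtain J where J: "J \<subseteq> ?R" "\<forall>i<k. J \<inter> Bl i \<noteq> {}"
    "(\<Sum>l\<in>J. cost l) + (\<Sum>j\<in>C. Min (insert (?x j) (d j ` J)))
      \<le> p * (\<Sum>l\<in>?R. cost l) + (\<Sum>j\<in>C. exp_min p (\<lambda>y. y) (?x j) (d j) ?R)" by blast
  have f: "finite J" "u \<notin> J" using J(1) u Suc.prems(1) finite_subset[of J ?R] by auto
  have "(\<Sum>l\<in>insert u J. cost l) + (\<Sum>j\<in>C. Min (insert (x j) (d j ` insert u J))) \<le> c u"
    unfolding Min_insert_min[OF f(1)] using J(3) f by (simp add: c_def)
  moreover have "\<forall>i<Suc k. insert u J \<inter> Bl i \<noteq> {}" using J u by (auto simp: less_Suc_eq)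
  moreover have "insert u J \<subseteq> R" using J u B by auto
  ultimately show ?case using u(2) by (intro exI[of _ "insert u J"]) auto
qed

section \<open>The greedy algorithm\<close>

text \<open>A list \<open>S\<close> of facilities stands for the random set containing each entry independently with
  probability \<open>p\<close>; a client \<open>j\<close> can always be served at cost \<open>D j\<close>.\<close>

locale fractional_greedy =
  fixes C :: "nat set" and d :: "nat \<Rightarrow> nat \<Rightarrow> real" and p :: real and D :: "nat \<Rightarrow> real"
  assumes finite_C: "finite C" and p: "0 < p" "p \<le> 1"
begin

definition conn :: "nat list \<Rightarrow> real" where
  "conn S = (\<Sum>j\<in>C. exp_min p (\<lambda>y. y) (D j) (\<lambda>l. d j (S ! l)) {..<length S})"

definition gain :: "nat list \<Rightarrow> nat \<Rightarrow> real" where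
  "gain S f = (\<Sum>j\<in>C. exp_min p (\<lambda>y. max 0 (y - d j f)) (D j) (\<lambda>l. d j (S ! l)) {..<length S})"

lemma exp_min_snoc:
  "exp_min p \<phi> x (\<lambda>l. e ((S @ [s]) ! l)) {..<length (S @ [s])} =
     p * exp_min p (\<lambda>y. \<phi> (min y (e s))) x (\<lambda>l. e (S ! l)) {..<length S} +
     (1 - p) * exp_min p \<phi> x (\<lambda>l. e (S ! l)) {..<length S}"
proof -
  have c: "exp_min p \<psi> y (\<lambda>l. e ((S @ [s]) ! l)) {..<length S} = exp_min p \<psi> y (\<lambda>l. e (S ! l)) {..<length S}"
    for \<psi> y by (intro exp_min_cong) (auto simp: nth_append)
  have e: "{..<length (S @ [s])} = insert (length S) {..<length S}" by auto
  have n: "length S \<notin> {..<length S}" by simp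
  show ?thesis
    unfolding e exp_min_insert[OF finite_lessThan n] c nth_append_length
      exp_min_shift[OF finite_lessThan] by (rule refl)
qed

lemma conn_snoc: "conn (S @ [f]) = conn S - p * gain S f"
proof -
  have m: "min y c = y - max 0 (y - c)" for y c :: real by auto
  show ?thesis unfolding conn_def gain_def exp_min_snoc m exp_min_diff
    by (simp add: sum_subtractf sum_distrib_left algebra_simps sum.distrib)
qed

text \<open>Submodularity: capping the current cost by \<open>d j s\<close> can only lessen what
  \<open>f\<close> still saves.\<close>

lemma gain_snoc: "gain (S @ [s]) f \<le> gain S f"
  unfolding gain_def
proof (intro sum_mono)
  fix j
  let ?E = "\<lambda>\<phi>. exp_min p \<phi> (D j) (\<lambda>l. d j (S ! l)) {..<length S}"
  have "?E (\<lambda>y. max 0 (min y (d j s) - d j f)) \<le> ?E (\<lambda>y. max 0 (y - d j f))"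
    using p by (intro exp_min_mono) auto
  then have "p * ?E (\<lambda>y. max 0 (min y (d j s) - d j f)) + (1 - p) * ?E (\<lambda>y. max 0 (y - d j f))
    \<le> p * ?E (\<lambda>y. max 0 (y - d j f)) + (1 - p) * ?E (\<lambda>y. max 0 (y - d j f))"
    using p by (intro add_right_mono mult_left_mono) auto
  then show "exp_min p (\<lambda>y. max 0 (y - d j f)) (D j) (\<lambda>l. d j ((S @ [s]) ! l)) {..<length (S @ [s])}
    \<le> ?E (\<lambda>y. max 0 (y - d j f))"
    unfolding exp_min_snoc by (simp add: algebra_simps)
qed

lemma gain_append: "gain (S @ T) f \<le> gain S f"
proof (induction T rule: rev_induct)
  case (snoc t T)
  then show ?case using gain_snoc[of "S @ T" t f] by simp
qed simp

text \<open>For each client the single term of its own facility already accounts for the excess, and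
  the other terms are nonnegative.\<close>

lemma gain_sum:
  fixes k :: nat
  assumes "\<And>j. j \<in> C \<Longrightarrow> \<phi> j < k"
  shows "conn S - (\<Sum>j\<in>C. d j (fs (\<phi> j))) \<le> (\<Sum>i<k. gain S (fs i))"
proof -
  have "conn S - (\<Sum>j\<in>C. d j (fs (\<phi> j)))
    = (\<Sum>j\<in>C. exp_min p (\<lambda>y. y - d j (fs (\<phi> j))) (D j) (\<lambda>l. d j (S ! l)) {..<length S})"
    by (simp add: conn_def exp_min_diff exp_min_const sum_subtractf)
  also have "\<dots> \<le> (\<Sum>j\<in>C. exp_min p (\<lambda>y. \<Sum>i<k. max 0 (y - d j (fs i))) (D j) (\<lambda>l. d j (S ! l)) {..<length S})"
  proof (intro sum_mono exp_min_mono)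
    fix j y assume j: "j \<in> C"
    have "y - d j (fs (\<phi> j)) \<le> max 0 (y - d j (fs (\<phi> j)))" by simp
    also have "\<dots> \<le> (\<Sum>i<k. max 0 (y - d j (fs i)))"
      using assms[OF j] by (intro member_le_sum) auto
    finally show "y - d j (fs (\<phi> j)) \<le> (\<Sum>i<k. max 0 (y - d j (fs i)))" .
  qed (use p in auto)
  also have "\<dots> = (\<Sum>i<k. gain S (fs i))"
    unfolding exp_min_sum gain_def by (rule sum.swap)
  finally show ?thesis .
qed

end

text \<open>\<open>sel i c S\<close> is the facility that the algorithm adds to \<open>S\<close> for class \<open>i\<close> when connection
  costs are weighted with \<open>c\<close>; the weight grows by the factor \<open>1 + p\<close> with every round.\<close>

primrec greedy_round :: "(nat \<Rightarrow> real \<Rightarrow> nat list \<Rightarrow> nat) \<Rightarrow> real \<Rightarrow> nat list \<Rightarrow> nat \<Rightarrow> nat list" where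
  "greedy_round sel c S 0 = S"
| "greedy_round sel c S (Suc i) = greedy_round sel c S i @ [sel i c (greedy_round sel c S i)]"

primrec greedy :: "(nat \<Rightarrow> real \<Rightarrow> nat list \<Rightarrow> nat) \<Rightarrow> nat \<Rightarrow> (nat \<Rightarrow> real) \<Rightarrow> nat \<Rightarrow> nat list" where
  "greedy sel k c 0 = []"
| "greedy sel k c (Suc t) = greedy_round sel (c t) (greedy sel k c t) k"

lemma greedy_round_append: "\<exists>T. greedy_round sel c S i = S @ T \<and> length T = i"
  by (induction i) auto

lemma length_greedy_round [simp]: "length (greedy_round sel c S i) = length S + i"
  by (induction i) auto

lemma length_greedy [simp]: "length (greedy sel k c t) = t * k"
  by (induction t) auto

lemma greedy_round_nth_old: "l < length S \<Longrightarrow> greedy_round sel c S i ! l = S ! l"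
  using greedy_round_append[of sel c S i] by (auto simp: nth_append)

lemma greedy_round_nth_new:
  "i < k \<Longrightarrow> \<exists>S'. greedy_round sel c S k ! (length S + i) = sel i c S'"
  by (induction k) (auto simp: nth_append less_Suc_eq)

lemma greedy_nth:
  "t < M \<Longrightarrow> i < k \<Longrightarrow> \<exists>c' S'. greedy sel k c M ! (t * k + i) = sel i c' S'"
proof (induction M)
  case (Suc M)
  show ?case
  proof (cases "t = M")
    case True
    then show ?thesis using greedy_round_nth_new[of i k sel "c M" "greedy sel k c M"] Suc by auto
  next
    case False
    then have "t < M" using Suc by simp
    then have "t * k + i < Suc t * k" "Suc t * k \<le> M * k"
      using Suc.prems \<open>t < M\<close> by (simp, intro mult_right_mono) auto
    then show ?thesis using Suc \<open>t < M\<close> greedy_round_nth_old[of "t * k + i" "greedy sel k c M"] by auto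
  qed
qed simp

context fractional_greedy
begin

text \<open>Each selection is compared with \<open>fs i\<close>, whose gain is then lowered to the
  one at the final list \<open>S'\<close>. There \<open>gain_sum\<close> bounds the sum of gains
  from below by the excess after the round, not before it; moving this term to the left yields the
  factor \<open>1 + p\<close>.\<close>

lemma greedy_round_bound:
  fixes cost :: "nat \<Rightarrow> real"
  assumes sel: "\<And>i S. i < k \<Longrightarrow> cost (sel i c S) - c * gain S (sel i c S) \<le> cost (fs i) - c * gain S (fs i)"
    and \<phi>: "\<And>j. j \<in> C \<Longrightarrow> \<phi> j < k" and c: "0 \<le> c"
    and S': "S' = greedy_round sel c S k"
    and Oc: "Oc = (\<Sum>i<k. cost (fs i))" and Cc: "Cc = (\<Sum>j\<in>C. d j (fs (\<phi> j)))"
  shows "p * sum_list (map cost S') + c * (1 + p) * (conn S' - Cc)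
    \<le> p * sum_list (map cost S) + p * Oc + c * (conn S - Cc)"
proof -
  let ?T = "greedy_round sel c S"
  have step: "p * sum_list (map cost (?T i)) + c * conn (?T i)
    \<le> p * sum_list (map cost S) + c * conn S + p * (\<Sum>l<i. cost (fs l) - c * gain S' (fs l))"
    if "i \<le> k" for i using that
  proof (induction i)
    case (Suc i)
    obtain U where U: "greedy_round sel c (?T i) 0 @ U = S'"
    proof -
      have "\<exists>U. ?T k = ?T i @ U" using Suc.prems
      proof (induction k)
        case (Suc k) then show ?case by (cases "i = Suc k") (auto simp: le_Suc_eq)
      qed auto
      then show ?thesis using that S' by auto
    qed
    let ?s = "sel i c (?T i)"
    have "cost ?s - c * gain (?T i) ?s \<le> cost (fs i) - c * gain (?T i) (fs i)" using sel Suc by auto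
    also have "\<dots> \<le> cost (fs i) - c * gain S' (fs i)"
      using gain_append[of "?T i" U "fs i"] U c by (auto intro: mult_left_mono)
    finally have "p * (cost ?s - c * gain (?T i) ?s) \<le> p * (cost (fs i) - c * gain S' (fs i))"
      using p by (intro mult_left_mono) auto
    then show ?case using Suc by (simp add: conn_snoc algebra_simps)
  qed simp
  have "c * (conn S' - Cc) \<le> c * (\<Sum>i<k. gain S' (fs i))"
    unfolding Cc using gain_sum[OF \<phi>] c by (intro mult_left_mono) auto
  then have "p * (\<Sum>l<k. cost (fs l) - c * gain S' (fs l)) \<le> p * (Oc - c * (conn S' - Cc))"
    using p Oc by (intro mult_left_mono) (auto simp: sum_subtractf sum_distrib_left)
  with step[of k] S' show ?thesis by (simp add: algebra_simps)
qed

text \<open>The weights are chosen so that the factor \<open>1 + p\<close> of each round turns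
  \<open>c t\<close> into \<open>c (Suc t)\<close> and the round bounds telescope.\<close>

lemma greedy_bound:
  fixes cost :: "nat \<Rightarrow> real"
  assumes sel: "\<And>i c S. i < k \<Longrightarrow> cost (sel i c S) - c * gain S (sel i c S) \<le> cost (fs i) - c * gain S (fs i)"
    and \<phi>: "\<And>j. j \<in> C \<Longrightarrow> \<phi> j < k"
    and c: "\<And>t. 0 \<le> c t" "\<And>t. t < M \<Longrightarrow> c (Suc t) = c t * (1 + p)"
    and Oc: "Oc = (\<Sum>i<k. cost (fs i))" and Cc: "Cc = (\<Sum>j\<in>C. d j (fs (\<phi> j)))"
  shows "p * sum_list (map cost (greedy sel k c M)) + c M * (conn (greedy sel k c M) - Cc)
    \<le> M * p * Oc + c 0 * (conn [] - Cc)"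
  using c(2)
proof (induction M)
  case (Suc M)
  have "p * sum_list (map cost (greedy sel k c (Suc M))) + c M * (1 + p) * (conn (greedy sel k c (Suc M)) - Cc)
    \<le> p * sum_list (map cost (greedy sel k c M)) + p * Oc + c M * (conn (greedy sel k c M) - Cc)"
    by (rule greedy_round_bound[where sel = sel and fs = fs and k = k]) (use sel \<phi> c Oc Cc in auto)
  then show ?case using Suc by (simp add: algebra_simps)
qed simp

end

section \<open>Hitting heavy balls\<close>

text \<open>Ties go to the smallest index, as in a scan that replaces its candidate only by a
  strictly better one; so the model and the program agree exactly. The default 0 occurs for
  meaningless guesses.\<close>

definition amin :: "(nat \<Rightarrow> bool) \<Rightarrow> (nat \<Rightarrow> real) \<Rightarrow> nat \<Rightarrow> nat" where
  "amin P e n = (if \<exists>i<n. P i then LEAST i. i < n \<and> P i \<and> (\<forall>j<n. P j \<longrightarrow> e i \<le> e j) else 0)"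

definition minval :: "(nat \<Rightarrow> bool) \<Rightarrow> (nat \<Rightarrow> real) \<Rightarrow> nat \<Rightarrow> real" where
  "minval P e n = (if \<exists>i<n. P i then e (amin P e n) else 0)"

lemma amin_ex:
  fixes e :: "nat \<Rightarrow> real"
  assumes "\<exists>i<n. P i" shows "\<exists>i. i < n \<and> P i \<and> (\<forall>j<n. P j \<longrightarrow> e i \<le> e j)"
proof -
  have "finite (e ` {i. i < n \<and> P i})" "e ` {i. i < n \<and> P i} \<noteq> {}" using assms by auto
  from Min_in[OF this] Min_le[OF this(1)] show ?thesis by fastforce
qed

lemma amin_props:
  assumes "\<exists>i<n. P i"
  shows "amin P e n < n" "P (amin P e n)" "\<And>j. j < n \<Longrightarrow> P j \<Longrightarrow> e (amin P e n) \<le> e j"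
  using LeastI_ex[OF amin_ex[OF assms, where e = e]] assms by (auto simp: amin_def)

lemma minval_eq_Min:
  assumes "\<exists>i<n. P i"
  shows "minval P e n = Min (e ` {i. i < n \<and> P i})"
proof -
  note a = amin_props[OF assms, where e = e]
  have "Min (e ` {i. i < n \<and> P i}) = e (amin P e n)"
    by (rule Min_eqI) (use a in auto)
  then show ?thesis using assms by (simp add: minval_def)
qed

locale fl_points =
  fixes n :: nat and d :: "nat \<Rightarrow> nat \<Rightarrow> real" and C Fc :: "nat set" and cost :: "nat \<Rightarrow> real"
  assumes metric: "Metric_space {..<n} d"
    and C_sub: "C \<subseteq> {..<n}" and Fc_sub: "Fc \<subseteq> {..<n}" and cost_nonneg: "\<And>f. f \<in> Fc \<Longrightarrow> 0 \<le> cost f"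
begin

lemma d_sym: "d x y = d y x" and d_nonneg: "0 \<le> d x y"
  and d_tri: "x < n \<Longrightarrow> y < n \<Longrightarrow> z < n \<Longrightarrow> d x z \<le> d x y + d y z"
  using Metric_space.commute[OF metric] Metric_space.nonneg[OF metric]
    Metric_space.triangle[OF metric] by (blast, blast, simp)

lemma finite_CF: "finite C" "finite Fc"
  using C_sub Fc_sub finite_subset by blast+

definition wt :: "nat list \<Rightarrow> nat \<Rightarrow> real" where
  "wt as j = Min ((\<lambda>a. d j a) ` set as)"

text \<open>For positive total weight and \<delta> in (0, 1], the clients of the smallest closed
  ball around \<open>f\<close> that has at least the fraction \<delta> of the weight. Testing the
  clients strictly nearer than \<open>x\<close> avoids computing the radius.\<close>

definition inball :: "real \<Rightarrow> nat list \<Rightarrow> nat \<Rightarrow> nat \<Rightarrow> bool" where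
  "inball \<delta> as f x \<longleftrightarrow> x \<in> C \<and>
     (\<Sum>y\<in>C. if d f x \<le> d f y then 0 else wt as y) < \<delta> * (\<Sum>y\<in>C. wt as y)"

definition hitpt :: "real \<Rightarrow> nat list \<Rightarrow> nat set \<Rightarrow> nat" where
  "hitpt \<delta> as X = amin (\<lambda>x. x \<in> C) (\<lambda>x. - real (card {f \<in> X. inball \<delta> as f x})) n"

primrec alive :: "real \<Rightarrow> nat list \<Rightarrow> nat \<Rightarrow> nat set" where
  "alive \<delta> as 0 = Fc"
| "alive \<delta> as (Suc m) = {f \<in> alive \<delta> as m. \<not> inball \<delta> as f (hitpt \<delta> as (alive \<delta> as m))}"

definition pick :: "real \<Rightarrow> nat list \<Rightarrow> nat \<Rightarrow> nat" where
  "pick \<delta> as g = hitpt \<delta> as (alive \<delta> as g)"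

text \<open>The arbitrary first entry 0 makes \<open>wt\<close> a minimum over a nonempty set. Stage
  \<open>i\<close> recomputes the balls for the anchors so far and takes the point of step
  \<open>G i\<close>.\<close>

primrec ancs :: "real \<Rightarrow> (nat \<Rightarrow> nat) \<Rightarrow> nat \<Rightarrow> nat list" where
  "ancs \<delta> G 0 = [0]"
| "ancs \<delta> G (Suc i) = ancs \<delta> G i @ [pick \<delta> (ancs \<delta> G i) (G i)]"

lemma length_ancs [simp]: "length (ancs \<delta> G i) = Suc i"
  by (induction i) auto

lemma ancs_cong: "(\<And>l. l < i \<Longrightarrow> G l = G' l) \<Longrightarrow> ancs \<delta> G i = ancs \<delta> G' i"
  by (induction i) auto

lemma wt_nonneg: "as \<noteq> [] \<Longrightarrow> 0 \<le> wt as j"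
  by (simp add: wt_def d_nonneg)

lemma wt_le: "a \<in> set as \<Longrightarrow> wt as j \<le> d j a"
  by (simp add: wt_def)

lemma wt_attained: "as \<noteq> [] \<Longrightarrow> \<exists>a\<in>set as. wt as j = d j a"
proof -
  assume "as \<noteq> []"
  then have "wt as j \<in> (\<lambda>a. d j a) ` set as" unfolding wt_def by (intro Min_in) auto
  then show ?thesis by blast
qed

lemma wt_tri:
  assumes "as \<noteq> []" "set as \<subseteq> {..<n}" "x < n" "y < n"
  shows "wt as x \<le> d x y + wt as y"
proof -
  obtain a where a: "a \<in> set as" "wt as y = d y a" using wt_attained[OF assms(1)] by blast
  then show ?thesis using wt_le[OF a(1), of x] d_tri[of x y a] assms by auto
qed

text \<open>If some client is outside the ball, let \<open>x\<close> be a nearest one: all clients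
  strictly nearer are inside, and as \<open>x\<close> is outside they have the required
  weight.\<close>

lemma ball_heavy:
  fixes \<delta> :: real
  assumes "as \<noteq> []" "\<delta> \<le> 1"
  shows "\<delta> * (\<Sum>y\<in>C. wt as y) \<le> (\<Sum>x\<in>{x\<in>C. inball \<delta> as f x}. wt as x)"
proof (cases "\<forall>x\<in>C. inball \<delta> as f x")
  case True
  then have "{x\<in>C. inball \<delta> as f x} = C" by auto
  then show ?thesis using mult_right_mono[OF assms(2), of "\<Sum>y\<in>C. wt as y"] assms
    by (simp add: sum_nonneg wt_nonneg)
next
  case False
  define X where "X = {x\<in>C. \<not> inball \<delta> as f x}"
  have "finite (d f ` X)" "d f ` X \<noteq> {}" using False finite_CF by (auto simp: X_def)
  from Min_in[OF this] Min_le[OF this(1)] obtain x where x: "x \<in> X" "\<And>y. y \<in> X \<Longrightarrow> d f x \<le> d f y"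
    by fastforce
  have "\<delta> * (\<Sum>y\<in>C. wt as y) \<le> (\<Sum>y\<in>C. if d f x \<le> d f y then 0 else wt as y)"
    using x(1) by (auto simp: X_def inball_def)
  also have "\<dots> \<le> (\<Sum>y\<in>C. if inball \<delta> as f y then wt as y else 0)"
  proof (intro sum_mono)
    fix y assume "y \<in> C"
    then show "(if d f x \<le> d f y then 0 else wt as y) \<le> (if inball \<delta> as f y then wt as y else 0)"
      using x(2)[of y] wt_nonneg[OF assms(1), of y] by (auto simp: X_def)
  qed
  also have "\<dots> = (\<Sum>x\<in>{x\<in>C. inball \<delta> as f x}. wt as x)"
    using finite_CF by (simp add: sum.inter_filter)
  finally show ?thesis .
qed

text \<open>Double counting of pairs of a ball and a client in it, with clients weighted by
  \<open>wt\<close>: the weighted average client lies in at least the fraction \<delta> of the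
  balls, so the best one does too.\<close>

lemma hitpt_count:
  fixes \<delta> :: real
  assumes "as \<noteq> []" "\<delta> \<le> 1" "X \<subseteq> Fc" "0 < (\<Sum>y\<in>C. wt as y)"
  shows "\<delta> * card X \<le> card {f \<in> X. inball \<delta> as f (hitpt \<delta> as X)}"
proof -
  let ?W = "\<Sum>y\<in>C. wt as y" let ?c = "\<lambda>x. card {f \<in> X. inball \<delta> as f x}"
  have fX: "finite X" using assms finite_CF finite_subset by blast
  have "C \<noteq> {}" using assms(4) by auto
  then have ex: "\<exists>x<n. x \<in> C" using C_sub by auto
  have le: "?c x \<le> ?c (hitpt \<delta> as X)" if "x \<in> C" for x
    using amin_props(3)[OF ex, where j = x and e = "\<lambda>x. - real (?c x)"] that C_sub by (auto simp: hitpt_def)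
  have "card X * (\<delta> * ?W) = (\<Sum>f\<in>X. \<delta> * ?W)" by simp
  also have "\<dots> \<le> (\<Sum>f\<in>X. \<Sum>x\<in>{x\<in>C. inball \<delta> as f x}. wt as x)"
    by (intro sum_mono ball_heavy assms)
  also have "\<dots> = (\<Sum>f\<in>X. \<Sum>x\<in>C. if inball \<delta> as f x then wt as x else 0)"
    using finite_CF by (simp add: sum.inter_filter)
  also have "\<dots> = (\<Sum>x\<in>C. \<Sum>f\<in>X. if inball \<delta> as f x then wt as x else 0)" by (rule sum.swap)
  also have "\<dots> = (\<Sum>x\<in>C. ?c x * wt as x)"
    unfolding sum.inter_filter[OF fX, symmetric] by simp
  also have "\<dots> \<le> (\<Sum>x\<in>C. ?c (hitpt \<delta> as X) * wt as x)"
    using le wt_nonneg[OF assms(1)] by (intro sum_mono mult_right_mono) auto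
  also have "\<dots> = ?c (hitpt \<delta> as X) * ?W" by (simp add: sum_distrib_left)
  finally have "(\<delta> * card X) * ?W \<le> ?c (hitpt \<delta> as X) * ?W" by (simp add: mult.commute mult.left_commute)
  then show ?thesis using assms(4) by (simp only: mult_le_cancel_right_pos)
qed

lemma alive_sub: "alive \<delta> as m \<subseteq> Fc"
  by (induction m) auto

lemma card_alive:
  fixes \<delta> :: real
  assumes "as \<noteq> []" "0 \<le> \<delta>" "\<delta> \<le> 1" "0 < (\<Sum>y\<in>C. wt as y)"
  shows "card (alive \<delta> as m) \<le> (1 - \<delta>) ^ m * n"
proof (induction m)
  case 0
  then show ?case using card_mono[OF _ Fc_sub] by simp
next
  case (Suc m)
  let ?X = "alive \<delta> as m" let ?H = "{f \<in> ?X. inball \<delta> as f (hitpt \<delta> as ?X)}"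
  have fX: "finite ?X" by (rule finite_subset[OF alive_sub finite_CF(2)])
  have sub: "?H \<subseteq> ?X" by blast
  have "alive \<delta> as (Suc m) = ?X - ?H" by auto
  then have "card (alive \<delta> as (Suc m)) = card ?X - card ?H"
    by (metis (no_types, lifting) card_Diff_subset finite_subset fX sub)
  moreover have "card ?H \<le> card ?X" using fX sub by (rule card_mono)
  ultimately have "real (card (alive \<delta> as (Suc m))) = real (card ?X) - real (card ?H)"
    by (simp only: of_nat_diff)
  also have "\<dots> \<le> (1 - \<delta>) * card ?X"
    using hitpt_count[OF assms(1,3) alive_sub[of \<delta> as m] assms(4)] by (simp add: algebra_simps)
  also have "\<dots> \<le> (1 - \<delta>) * ((1 - \<delta>) ^ m * n)" using Suc assms by (intro mult_left_mono) auto
  finally show ?case by (simp add: mult.assoc)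
qed

text \<open>After \<open>B\<close> steps fewer than one ball would be left.\<close>

lemma pick_hits:
  fixes \<delta> :: real
  assumes "as \<noteq> []" "0 \<le> \<delta>" "\<delta> \<le> 1" "0 < (\<Sum>y\<in>C. wt as y)" "(1 - \<delta>) ^ B * n < 1" "f \<in> Fc"
  shows "\<exists>g<B. inball \<delta> as f (pick \<delta> as g)"
proof (rule ccontr)
  assume not: "\<not> ?thesis"
  have "f \<in> alive \<delta> as m" if "m \<le> B" for m
    using that
  proof (induction m)
    case (Suc m)
    then have "\<not> inball \<delta> as f (pick \<delta> as m)" using not by auto
    then show ?case using Suc by (simp add: pick_def)
  qed (use assms(6) in simp)
  then have "f \<in> alive \<delta> as B" by simp
  moreover have "finite (alive \<delta> as B)" by (rule finite_subset[OF alive_sub finite_CF(2)])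
  ultimately have "0 < card (alive \<delta> as B)" by (auto simp: card_gt_0_iff)
  then have "1 \<le> real (card (alive \<delta> as B))" by simp
  then show False using card_alive[OF assms(1-4), of B] assms(5) by linarith
qed

end

section \<open>The algorithm as a function of its guesses\<close>

text \<open>The guesses are the digits \<open>G l\<close>: those below \<open>k\<close> select the anchors, the next \<open>2 * k\<close> assign to
  each of the \<open>G (3 * k)\<close> clusters an anchor and the exponent of its radius, relative to the distance
  of \<open>v\<close> and \<open>v'\<close>; \<open>G (3 * k + 1)\<close> is the number of rounds, and the remaining digits select
  a subset of the list produced by the greedy algorithm.\<close>

locale fl_model = fl_points +
  fixes k :: nat and \<delta> \<eta> p :: real and M0 :: nat
begin

definition anch :: "(nat \<Rightarrow> nat) \<Rightarrow> nat \<Rightarrow> nat" where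
  "anch G i = (if i < k then ancs \<delta> G k ! G (k + i) else 0)"

definition rad :: "(nat \<Rightarrow> nat) \<Rightarrow> nat \<Rightarrow> nat \<Rightarrow> nat \<Rightarrow> real" where
  "rad G v v' i = (if i < k then d v v' * \<eta> ^ G (2 * k + i) else 0)"

definition classes :: "(nat \<Rightarrow> nat) \<Rightarrow> nat" where
  "classes G = min k (G (3 * k))"

definition rounds :: "(nat \<Rightarrow> nat) \<Rightarrow> nat" where
  "rounds G = min M0 (G (3 * k + 1))"

text \<open>By the triangle inequality through the anchor, the client can be served at this cost
  whichever facility is opened in the best class.\<close>

definition dummy :: "(nat \<Rightarrow> nat) \<Rightarrow> nat \<Rightarrow> nat \<Rightarrow> nat \<Rightarrow> real" where
  "dummy G v v' j = minval (\<lambda>i. i < classes G) (\<lambda>i. d j (anch G i) + rad G v v' i) k"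

definition sel :: "(nat \<Rightarrow> nat) \<Rightarrow> nat \<Rightarrow> nat \<Rightarrow> nat \<Rightarrow> real \<Rightarrow> nat list \<Rightarrow> nat" where
  "sel G v v' i c S = amin (\<lambda>f. f \<in> Fc \<and> d f (anch G i) \<le> rad G v v' i)
     (\<lambda>f. cost f - c * fractional_greedy.gain C d p (dummy G v v') S f) n"

text \<open>The weight starts small and reaches 1 after the last round, so that opening and
  connection costs count equally in the result while the initial excess is multiplied by the small
  initial weight.\<close>

definition glist :: "(nat \<Rightarrow> nat) \<Rightarrow> nat \<Rightarrow> nat \<Rightarrow> nat list" where
  "glist G v v' = greedy (sel G v v') (classes G) (\<lambda>t. (1 / (1 + p)) ^ (rounds G - t)) (rounds G)"

text \<open>The test \<open>s \<in> Fc\<close> concerns wrong guesses: an empty class makes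
  \<open>sel\<close> return 0, which may not be a facility.\<close>

definition solset :: "(nat \<Rightarrow> nat) \<Rightarrow> nat \<Rightarrow> nat \<Rightarrow> nat set" where
  "solset G v v' = {s. \<exists>l<length (glist G v v'). s = glist G v v' ! l \<and> 1 \<le> G (3 * k + 2 + l) \<and> s \<in> Fc}"

definition val :: "nat set \<Rightarrow> real" where
  "val T = (\<Sum>f\<in>T. cost f) + (\<Sum>j\<in>C. Min ((\<lambda>f. d j f) ` T))"

text \<open>Thus the digits from \<open>3 * k + 2\<close> on can still be chosen once the list is
  known.\<close>

lemma glist_cong:
  assumes "\<And>l. l < 3 * k + 2 \<Longrightarrow> G l = G' l"
  shows "glist G v v' = glist G' v v'"
proof -
  have "ancs \<delta> G k = ancs \<delta> G' k" using assms by (intro ancs_cong) auto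
  then have "anch G = anch G'" using assms by (auto simp: anch_def)
  moreover have "rad G v v' = rad G' v v'" using assms by (auto simp: rad_def)
  moreover have "classes G = classes G'" "rounds G = rounds G'" using assms by (auto simp: classes_def rounds_def)
  moreover from calculation have "dummy G v v' = dummy G' v v'"
    by (intro ext) (simp add: dummy_def)
  moreover from calculation have "sel G v v' = sel G' v v'" by (intro ext) (simp add: sel_def)
  ultimately show ?thesis by (simp add: glist_def)
qed

end

section \<open>Existence of good guesses for a given solution\<close>

text \<open>The facilities \<open>fs i\<close> with the clusters given by \<open>\<phi>\<close> are those of a solution to compare with.\<close>

locale fl_clusters = fl_model +
  fixes k' :: nat and fs \<phi> :: "nat \<Rightarrow> nat" and e :: real and B N :: nat
  assumes fs: "\<And>i. i < k' \<Longrightarrow> fs i \<in> Fc" and \<phi>: "\<And>j. j \<in> C \<Longrightarrow> \<phi> j < k'"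
    and nonempty: "\<And>i. i < k' \<Longrightarrow> \<exists>j\<in>C. \<phi> j = i" and k': "1 \<le> k'" "k' \<le> k"
    and e: "0 < e" "e \<le> 1" and N: "1 \<le> N" and p_def: "p = 1 / real N"
    and \<delta>_def: "\<delta> = e ^ 3 / (48 * real k)" and \<eta>_def: "\<eta> = 1 / (1 + e)"
    and M0_def: "M0 = 4 * N + 5"
    and B: "(1 - \<delta>) ^ B * n < 1" "n \<le> e * (1 + e) ^ (B - 1)" "k < B" "M0 < B"
begin

definition cl :: "nat \<Rightarrow> nat set" where "cl i = {j \<in> C. \<phi> j = i}"
definition cc :: "nat \<Rightarrow> real" where "cc i = (\<Sum>j\<in>cl i. d j (fs i))"
definition Cst :: real where "Cst = (\<Sum>j\<in>C. d j (fs (\<phi> j)))"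
definition Oc :: real where "Oc = (\<Sum>i<k'. cost (fs i))"

text \<open>The additive term sums to at most \<open>e * Cst\<close> over all clusters. It ensures
  that a cluster violating the inequality carries a fraction of the total weight bounded below in
  terms of \<open>e\<close> and \<open>k\<close>.\<close>

definition good :: "nat list \<Rightarrow> nat \<Rightarrow> bool" where
  "good as i \<longleftrightarrow> card (cl i) * wt as (fs i) \<le> (1 + e) * cc i + e / k * Cst"

lemma finite_cl [simp]: "finite (cl i)"
  using finite_CF by (simp add: cl_def)

lemma cl_sub: "cl i \<subseteq> C" by (auto simp: cl_def)

lemma card_cl: "i < k' \<Longrightarrow> 1 \<le> card (cl i)"
  using nonempty[of i] by (auto simp: cl_def card_gt_0_iff finite_CF Suc_le_eq)

lemma sum_cl: "(\<Sum>j\<in>C. g j) = (\<Sum>i<k'. \<Sum>j\<in>cl i. g j)" for g :: "nat \<Rightarrow> real"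
proof -
  have "(\<Sum>i<k'. \<Sum>j\<in>cl i. g j) = (\<Sum>i\<in>{..<k'}. \<Sum>j\<in>{j \<in> C. \<phi> j = i}. g j)" by (simp add: cl_def)
  also have "\<dots> = (\<Sum>j\<in>C. g j)" using finite_CF \<phi> by (intro sum.group) auto
  finally show ?thesis by simp
qed

lemma Cst_eq: "Cst = (\<Sum>i<k'. cc i)"
  unfolding Cst_def sum_cl cc_def by (intro sum.cong refl) (auto simp: cl_def)

lemma cc_nonneg: "0 \<le> cc i" by (simp add: cc_def sum_nonneg d_nonneg)
lemma Cst_nonneg: "0 \<le> Cst" by (simp add: Cst_def sum_nonneg d_nonneg)
lemma Oc_nonneg: "0 \<le> Oc" unfolding Oc_def using fs cost_nonneg by (intro sum_nonneg) auto

lemma in_points: "j \<in> C \<Longrightarrow> j < n" "i < k' \<Longrightarrow> fs i < n"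
  using C_sub Fc_sub fs by auto

lemma n_pos: "0 < n" using in_points(2)[of 0] k' by auto

lemma k_pos: "1 \<le> real k" "real k' \<le> real k" using k' by auto

lemma \<delta>: "0 \<le> \<delta>" "\<delta> \<le> 1"
proof -
  show "0 \<le> \<delta>" using e by (simp add: \<delta>_def)
  have "e ^ 3 \<le> 1" using e by (simp add: power_le_one)
  then show "\<delta> \<le> 1" using k_pos(1) unfolding \<delta>_def by (simp add: divide_le_eq)
qed

lemma wt_cl:
  assumes "as \<noteq> []" "set as \<subseteq> {..<n}" "i < k'" "j \<in> cl i"
  shows "wt as j \<le> d j (fs i) + wt as (fs i)" "wt as (fs i) \<le> d j (fs i) + wt as j"
  using wt_tri[OF assms(1,2), of j "fs i"] wt_tri[OF assms(1,2), of "fs i" j] in_points assms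
  by (auto simp: cl_def d_sym)

text \<open>By Markov's inequality.\<close>

lemma close_clients:
  assumes "i < k'"
  shows "card (cl i) * (e / 3) \<le> card {j \<in> cl i. card (cl i) * d j (fs i) \<le> (1 + e / 2) * cc i}"
proof -
  let ?m = "real (card (cl i))"
  let ?X = "{j \<in> cl i. ?m * d j (fs i) \<le> (1 + e / 2) * cc i}"
  define Z where "Z = cl i - ?X"
  have m: "1 \<le> ?m" using card_cl[OF assms] by simp
  have cZ: "?m = card ?X + real (card Z)"
  proof -
    have "card ?X \<le> card (cl i)" by (intro card_mono) auto
    moreover have "card Z = card (cl i) - card ?X" unfolding Z_def by (intro card_Diff_subset) auto
    ultimately show ?thesis by simp
  qed
  have fZ: "finite Z" by (simp add: Z_def)
  have sZ: "(\<Sum>j\<in>Z. d j (fs i)) \<le> cc i"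
    unfolding cc_def Z_def by (intro sum_mono2) (auto simp: d_nonneg)
  have zle: "real (card Z) * (1 + e / 2) \<le> ?m"
  proof (cases "Z = {}")
    case False
    have "(\<Sum>j\<in>Z. (1 + e / 2) * cc i) < (\<Sum>j\<in>Z. ?m * d j (fs i))"
      using False fZ by (intro sum_strict_mono) (auto simp: Z_def)
    also have "\<dots> \<le> ?m * cc i" using sZ by (simp add: sum_distrib_left[symmetric] mult_left_mono)
    finally have lt: "(real (card Z) * (1 + e / 2)) * cc i < ?m * cc i" by simp
    then show ?thesis using cc_nonneg[of i] by (metis less_eq_real_def mult_less_cancel_right_disj not_less)
  qed simp
  \<comment> \<open>For \<open>e \<le> 1\<close>, \<open>(1 - e / 3) * (1 + e / 2) \<ge> 1\<close>;
    this is why the fraction \<open>e / 3\<close> of close clients can be claimed.\<close>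
  have "?m * (1 - e / 3) * (1 + e / 2) = ?m + ?m * (e / 6 - e\<^sup>2 / 6)"
    by (simp add: field_simps power2_eq_square)
  moreover have "0 \<le> ?m * (e / 6 - e\<^sup>2 / 6)"
    using m e by (intro mult_nonneg_nonneg) (auto simp: power2_eq_square mult_left_le)
  ultimately have "real (card Z) * (1 + e / 2) \<le> (?m * (1 - e / 3)) * (1 + e / 2)" using zle by linarith
  then have "real (card Z) \<le> ?m * (1 - e / 3)" using e by simp
  then show ?thesis using cZ by (simp add: algebra_simps)
qed

text \<open>The cluster \<open>i\<close> with the largest deficit \<open>a i\<close> is treated. Its
  deficit controls those of all others and hence the total weight. The close clients of the cluster
  therefore outweigh \<delta> times the total, so the heavy ball of \<open>fs i\<close> reaches no
  farther than they do, and any point hitting it is a good anchor.\<close>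

lemma anchor_step:
  assumes as: "as \<noteq> []" "set as \<subseteq> {..<n}" and bad: "\<exists>i<k'. \<not> good as i"
  shows "\<exists>i<k'. \<not> good as i \<and> (\<exists>g<B. good (as @ [pick \<delta> as g]) i)"
proof -
  define D m where "D i = wt as (fs i)" and "m i = real (card (cl i))" for i
  define a where "a i = m i * D i - (1 + e) * cc i" for i
  have bad_iff: "\<not> good as i \<longleftrightarrow> e / k * Cst < a i" for i by (auto simp: good_def a_def D_def m_def)
  have "0 \<in> {..<k'}" using k' by simp
  then have fin: "finite (a ` {..<k'})" "a ` {..<k'} \<noteq> {}" by blast+
  obtain i where i: "i < k'" "\<And>l. l < k' \<Longrightarrow> a l \<le> a i"
    using Min_in Max_in[OF fin] Max_ge[OF fin(1)] by fastforce
  have bi: "e / k * Cst < a i" using bad bad_iff i(2) by (meson less_le_trans)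
  have D0: "0 \<le> D i" using wt_nonneg[OF as(1)] by (simp add: D_def)
  have m1: "1 \<le> m i" using card_cl[OF i(1)] by (simp add: m_def)
  have "0 \<le> e / k * Cst" using e Cst_nonneg by simp
  then have a0: "0 < a i" using bi by linarith
  let ?W = "\<Sum>y\<in>C. wt as y"
  have "?W = (\<Sum>l<k'. \<Sum>j\<in>cl l. wt as j)" by (rule sum_cl)
  also have "\<dots> \<le> (\<Sum>l<k'. \<Sum>j\<in>cl l. d j (fs l) + D l)"
    using wt_cl(1)[OF as] by (intro sum_mono) (auto simp: D_def)
  also have "\<dots> = (\<Sum>l<k'. cc l + m l * D l)"
    by (simp add: sum.distrib cc_def m_def)
  also have "\<dots> = (\<Sum>l<k'. (2 + e) * cc l + a l)" by (simp add: a_def algebra_simps)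
  also have "\<dots> \<le> (\<Sum>l<k'. (2 + e) * cc l + a i)" using i(2) by (intro sum_mono add_left_mono) auto
  also have "\<dots> = (2 + e) * Cst + k' * a i" by (simp add: sum.distrib Cst_eq sum_distrib_left)
  also have "\<dots> \<le> 3 * Cst + k * a i"
    using e Cst_nonneg a0 k_pos by (intro add_mono mult_right_mono) auto
  also have "\<dots> \<le> 3 * (k / e * a i) + k / e * a i"
  proof -
    have "Cst \<le> k / e * a i" using bi e k_pos by (simp add: field_simps)
    moreover have "k * a i * 1 \<le> k * a i * (1 / e)" using e a0 by (intro mult_left_mono) auto
    moreover have "k * a i * (1 / e) = k / e * a i" by simp
    ultimately show ?thesis by linarith
  qed
  also have "\<dots> = 4 * k / e * a i" by simp
  also have "\<dots> \<le> 4 * k / e * (m i * D i)"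
    using e cc_nonneg[of i] by (intro mult_left_mono) (auto simp: a_def)
  finally have W: "?W \<le> 4 * k / e * (m i * D i)" .
  \<comment> \<open>Here the constant 48 arises as 4 times 12: 4 from the bound \<open>W\<close>,
    and 12 from the fraction \<open>e / 3\<close> of the cluster times the weight
    \<open>e / 4\<close> of each of its clients, in units of \<open>D i\<close>.\<close>
  have dW: "\<delta> * ?W \<le> e\<^sup>2 / 12 * (m i * D i)"
  proof -
    have "\<delta> * ?W \<le> \<delta> * (4 * k / e * (m i * D i))" using W \<delta> by (intro mult_left_mono) auto
    also have "\<dots> = e\<^sup>2 / 12 * (m i * D i)"
      using e k_pos by (simp add: \<delta>_def field_simps power2_eq_square power3_eq_cube)
    finally show ?thesis .
  qed
  define X where "X = {j \<in> cl i. m i * d j (fs i) \<le> (1 + e / 2) * cc i}"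
  have cX: "m i * (e / 3) \<le> card X" using close_clients[OF i(1)] by (simp add: X_def m_def)
  \<comment> \<open>Since the cluster is bad and
    \<open>(1 - e / 4) * (1 + e) \<ge> 1 + e / 2\<close>, a client of \<open>X\<close> is within
    \<open>(1 - e / 4) * D i\<close> of \<open>fs i\<close>, so its own distance to the anchors is
    at least the remaining \<open>e / 4 * D i\<close>.\<close>
  have far: "D i * (e / 4) \<le> wt as j" if "j \<in> X" for j
  proof -
    have "(1 + e) * cc i \<le> m i * D i" using a0 by (simp add: a_def)
    then have "(1 - e / 4) * ((1 + e) * cc i) \<le> (1 - e / 4) * (m i * D i)"
      using e by (intro mult_left_mono) auto
    moreover have "(1 - e / 4) * ((1 + e) * cc i) = (1 + e / 2) * cc i + (e / 4 - e\<^sup>2 / 4) * cc i"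
      by (simp add: algebra_simps power2_eq_square)
    moreover have "0 \<le> (e / 4 - e\<^sup>2 / 4) * cc i"
      using e cc_nonneg by (intro mult_nonneg_nonneg) (auto simp: power2_eq_square mult_left_le)
    ultimately have "m i * d j (fs i) \<le> (1 - e / 4) * (m i * D i)" using that by (simp add: X_def)
    then have "m i * d j (fs i) \<le> m i * ((1 - e / 4) * D i)" by (simp add: algebra_simps)
    then have "d j (fs i) \<le> (1 - e / 4) * D i" using m1 by (simp add: mult_le_cancel_left_pos)
    then show ?thesis using wt_cl(2)[OF as i(1), of j] that by (simp add: X_def D_def algebra_simps)
  qed
  have XC: "X \<subseteq> C" using cl_sub by (auto simp: X_def)
  have fX: "finite X" by (simp add: X_def)
  have wX: "e\<^sup>2 / 12 * (m i * D i) \<le> (\<Sum>j\<in>X. wt as j)"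
  proof -
    have "e\<^sup>2 / 12 * (m i * D i) = (m i * (e / 3)) * (D i * (e / 4))" by (simp add: power2_eq_square)
    also have "\<dots> \<le> card X * (D i * (e / 4))" using cX D0 e by (intro mult_right_mono) auto
    also have "\<dots> \<le> (\<Sum>j\<in>X. wt as j)" using far by (intro sum_bounded_below)
    finally show ?thesis .
  qed
  have "0 < m i * D i" using a0 e cc_nonneg[of i] by (simp add: a_def) (smt (verit) mult_nonneg_nonneg)
  then have "0 < e\<^sup>2 / 12 * (m i * D i)" using e by simp
  also have "\<dots> \<le> (\<Sum>j\<in>X. wt as j)" by (rule wX)
  also have "\<dots> \<le> ?W" using XC finite_CF wt_nonneg[OF as(1)] by (intro sum_mono2) auto
  finally have W0: "0 < ?W" .
  obtain g where g: "g < B" "inball \<delta> as (fs i) (pick \<delta> as g)"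
    using pick_hits[OF as(1) \<delta> W0 B(1) fs[OF i(1)]] by blast
  define x where "x = pick \<delta> as g"
  \<comment> \<open>Otherwise all of \<open>X\<close> is strictly nearer to \<open>fs i\<close> than
    \<open>x\<close>. But those clients weigh less than \<delta> times the total, whereas
    \<open>X\<close> weighs at least that much.\<close>
  have "m i * d (fs i) x \<le> (1 + e / 2) * cc i"
  proof (rule ccontr)
    assume far': "\<not> ?thesis"
    have "d (fs i) y < d (fs i) x" if "y \<in> X" for y
    proof -
      have "m i * d (fs i) y < m i * d (fs i) x" using that far' by (auto simp: X_def d_sym)
      then show ?thesis using m1 by simp
    qed
    then have "(\<Sum>j\<in>X. wt as j) = (\<Sum>y\<in>X. if d (fs i) x \<le> d (fs i) y then 0 else wt as y)"
      by (intro sum.cong) (auto simp: not_le[symmetric])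
    also have "\<dots> \<le> (\<Sum>y\<in>C. if d (fs i) x \<le> d (fs i) y then 0 else wt as y)"
      using XC finite_CF wt_nonneg[OF as(1)] by (intro sum_mono2) auto
    also have "\<dots> < \<delta> * ?W" using g(2) by (simp add: inball_def x_def)
    finally show False using dW wX by linarith
  qed
  moreover have "wt (as @ [x]) (fs i) \<le> d (fs i) x" by (intro wt_le) simp
  then have "m i * wt (as @ [x]) (fs i) \<le> m i * d (fs i) x" using m1 by (intro mult_left_mono) auto
  moreover have "(1 + e / 2) * cc i \<le> (1 + e) * cc i" using e cc_nonneg by (intro mult_right_mono) auto
  moreover have "0 \<le> e / k * Cst" by fact
  ultimately have "good (as @ [x]) i" unfolding good_def m_def by linarith
  then show ?thesis using i(1) bi bad_iff g(1) unfolding x_def by blast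
qed

lemma good_mono: "as \<noteq> [] \<Longrightarrow> good as i \<Longrightarrow> good (as @ bs) i"
proof -
  assume a: "as \<noteq> []" "good as i"
  have "wt (as @ bs) (fs i) \<le> wt as (fs i)"
    unfolding wt_def using a by (intro Min_antimono) auto
  then have "card (cl i) * wt (as @ bs) (fs i) \<le> card (cl i) * wt as (fs i)" by (intro mult_left_mono) auto
  then show ?thesis using a by (simp add: good_def)
qed

lemma ancs_points: "set (ancs \<delta> G i) \<subseteq> {..<n}"
proof (induction i)
  case (Suc i)
  have "\<exists>x<n. x \<in> C" using nonempty[of 0] k' in_points by auto
  then have "pick \<delta> as g < n" for as g unfolding pick_def hitpt_def by (rule amin_props)
  then show ?case using Suc by auto
qed (use n_pos in auto)

lemma ancs_nonempty: "ancs \<delta> G i \<noteq> []"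
  by (cases i) auto

text \<open>Every stage makes at least one more cluster good and, by \<open>good_mono\<close>,
  spoils none; so \<open>k\<close> stages suffice for \<open>k'\<close> clusters.\<close>

lemma anchors_exist: "\<exists>G. (\<forall>l. G l < B) \<and> (\<forall>i<k'. good (ancs \<delta> G k) i)"
proof -
  have "\<exists>G. (\<forall>l. G l < B) \<and> card {i. i < k' \<and> \<not> good (ancs \<delta> G m) i} \<le> k' - m" for m
  proof (induction m)
    case 0
    have "card {i. i < k' \<and> \<not> good (ancs \<delta> (\<lambda>_. 0) 0) i} \<le> card {..<k'}" by (intro card_mono) auto
    then show ?case using B by (intro exI[of _ "\<lambda>_. 0"]) auto
  next
    case (Suc m)
    then obtain G where G: "\<forall>l. G l < B" "card {i. i < k' \<and> \<not> good (ancs \<delta> G m) i} \<le> k' - m" by blast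
    let ?as = "ancs \<delta> G m" let ?X = "{i. i < k' \<and> \<not> good ?as i}"
    have sub: "{i. i < k' \<and> \<not> good (ancs \<delta> G' (Suc m)) i} \<subseteq> ?X" if "ancs \<delta> G' m = ?as" for G'
      using good_mono[OF ancs_nonempty] that by auto
    show ?case
    proof (cases "?X = {}")
      case True
      then have "{i. i < k' \<and> \<not> good (ancs \<delta> G (Suc m)) i} = {}" using sub[of G] by blast
      then show ?thesis using G(1) by (intro exI[of _ G]) (simp only: card.empty, simp)
    next
      case False
      then obtain i g where i: "i < k'" "\<not> good ?as i" "g < B" "good (?as @ [pick \<delta> ?as g]) i"
        using anchor_step[OF ancs_nonempty ancs_points, of G m] by blast
      let ?G = "G(m := g)"
      have eq: "ancs \<delta> ?G m = ?as" by (intro ancs_cong) auto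
      have "{i. i < k' \<and> \<not> good (ancs \<delta> ?G (Suc m)) i} \<subseteq> ?X - {i}"
        using sub[OF eq] i(4) eq by auto
      then have "card {i. i < k' \<and> \<not> good (ancs \<delta> ?G (Suc m)) i} \<le> card (?X - {i})"
        by (intro card_mono) auto
      also have "\<dots> = card ?X - 1" using i by (intro card_Diff_singleton) auto
      also have "\<dots> \<le> k' - Suc m" using G by simp
      finally have c: "card {i. i < k' \<and> \<not> good (ancs \<delta> ?G (Suc m)) i} \<le> k' - Suc m" .
      have "\<forall>l. ?G l < B" using G i(3) by auto
      then show ?thesis
      proof (intro exI[of _ ?G] conjI)
        show "card {i. i < k' \<and> \<not> good (ancs \<delta> ?G (Suc m)) i} \<le> k' - Suc m" by (rule c)
      qed
    qed
  qed
  from this[of k] k' obtain G where G: "\<forall>l. G l < B" "card {i. i < k' \<and> \<not> good (ancs \<delta> G k) i} = 0" by auto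
  then have "{i. i < k' \<and> \<not> good (ancs \<delta> G k) i} = {}" by (subst (asm) card_0_eq) auto
  then show ?thesis using G(1) by blast
qed

text \<open>For the largest admissible exponent, either the next power is below \<open>D\<close>,
  which costs the factor \<open>1 + e\<close>, or the exponents are exhausted and the power is at
  most \<open>e / n\<close>. The latter error adds up to \<open>e * R\<close> over at most n
  clients.\<close>

lemma radius_exists:
  assumes "0 \<le> D" "D \<le> R"
  shows "\<exists>t<B. D \<le> R * \<eta> ^ t \<and> R * \<eta> ^ t \<le> (1 + e) * D + e / n * R"
proof -
  have \<eta>: "0 < \<eta>" "\<eta> * (1 + e) = 1" using e by (auto simp: \<eta>_def)
  define t where "t = Max {t. t < B \<and> D \<le> R * \<eta> ^ t}"
  have ne: "{t. t < B \<and> D \<le> R * \<eta> ^ t} \<noteq> {}" using assms B by (auto intro!: exI[of _ 0])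
  have t: "t < B" "D \<le> R * \<eta> ^ t" using Max_in[OF _ ne] by (auto simp: t_def)
  have mx: "t' \<le> t" if "t' < B" "D \<le> R * \<eta> ^ t'" for t' unfolding t_def using that by (intro Max_ge) auto
  have "R * \<eta> ^ t \<le> (1 + e) * D + e / n * R"
  proof (cases "Suc t < B")
    case True
    then have "R * \<eta> ^ Suc t < D" using mx[of "Suc t"] by fastforce
    then have "(1 + e) * (R * \<eta> ^ Suc t) \<le> (1 + e) * D" using e by (intro mult_left_mono) auto
    moreover have "(1 + e) * (R * \<eta> ^ Suc t) = (\<eta> * (1 + e)) * (R * \<eta> ^ t)" by simp
    moreover have "\<dots> = R * \<eta> ^ t" by (simp only: \<eta> mult_1)
    moreover have "0 \<le> e / n * R" using e assms by simp
    ultimately show ?thesis by linarith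
  next
    case False
    then have tB: "t = B - 1" using t by simp
    have "(1 + e) ^ t * \<eta> ^ t = 1" using \<eta> by (simp add: power_mult_distrib[symmetric] mult.commute)
    then have "\<eta> ^ t = 1 / (1 + e) ^ t" using e by (simp add: field_simps)
    also have "\<dots> \<le> e / n"
      using B(2) n_pos e unfolding tB[symmetric] by (simp add: field_simps)
    finally have "R * \<eta> ^ t \<le> R * (e / n)" using assms by (intro mult_left_mono) auto
    moreover have "0 \<le> (1 + e) * D" using e assms by simp
    ultimately show ?thesis by (simp add: mult.commute)
  qed
  then show ?thesis using t by blast
qed

lemma real_p: "0 < p" "p \<le> 1" "p * N = 1" "1 / (1 + p) = N / (N + 1)"
  using N by (auto simp: p_def field_simps)

lemma rounding_exists:
  assumes S: "length S = M * k'" "N \<le> M" "set S \<subseteq> Fc"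
    and cover: "\<And>t i. t < M \<Longrightarrow> i < k' \<Longrightarrow> S ! (t * k' + i) \<in> F i"
    and D: "\<And>j. j \<in> C \<Longrightarrow> \<exists>i<k'. \<forall>f\<in>F i. d j f \<le> D j"
  shows "\<exists>J\<subseteq>{..<length S}. J \<noteq> {} \<and> val ((\<lambda>l. S ! l) ` J)
    \<le> p * sum_list (map cost S) + fractional_greedy.conn C d p D S"
proof -
  interpret fractional_greedy C d p D using finite_CF real_p by unfold_locales auto
  define Bl where "Bl i = (\<lambda>t. t * k' + i) ` {..<N}" for i
  have kp: "0 < k'" using k' by simp
  have sub: "Bl i \<subseteq> {..<length S}" if "i < k'" for i
  proof
    fix l assume "l \<in> Bl i"
    then obtain t where t: "t < N" "l = t * k' + i" by (auto simp: Bl_def)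
    then have "l < Suc t * k'" using that by simp
    also have "\<dots> \<le> M * k'" using t S(2) by (intro mult_le_mono1) auto
    finally show "l \<in> {..<length S}" using S by simp
  qed
  have card: "card (Bl i) = N" for i
    unfolding Bl_def using kp by (subst card_image) (auto simp: inj_on_def)
  have disj: "Bl i \<inter> Bl i' = {}" if "i < i'" "i' < k'" for i i'
  proof -
    have "l mod k' = i" if "l \<in> Bl i" "i < k'" for l i using that by (auto simp: Bl_def)
    then show ?thesis using that by (metis disjoint_iff less_trans nat_neq_iff)
  qed
  obtain J where J: "J \<subseteq> {..<length S}" "\<forall>i<k'. J \<inter> Bl i \<noteq> {}"
    "(\<Sum>l\<in>J. cost (S ! l)) + (\<Sum>j\<in>C. Min (insert (D j) ((\<lambda>l. d j (S ! l)) ` J)))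
    \<le> p * (\<Sum>l<length S. cost (S ! l)) + (\<Sum>j\<in>C. exp_min p (\<lambda>y. y) (D j) (\<lambda>l. d j (S ! l)) {..<length S})"
    using round_blocks[where R = "{..<length S}" and N = N and p = p and k = k' and Bl = Bl and
      cost = "\<lambda>l. cost (S ! l)" and C = C and x = D and d = "\<lambda>j l. d j (S ! l)"]
      sub card disj N p_def by auto
  let ?T = "(\<lambda>l. S ! l) ` J"
  have fJ: "finite J" using J(1) finite_subset by blast
  have J0: "J \<noteq> {}" using J(2) kp by blast
  have TF: "?T \<subseteq> Fc"
    by (intro image_subsetI subsetD[OF S(3)] nth_mem) (use J(1) in auto)
  \<comment> \<open>A facility occurring several times in the list is paid only once in the
    set.\<close>
  have "(\<Sum>f\<in>?T. cost f) \<le> (\<Sum>l\<in>J. cost (S ! l))"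
    using sum_image_le[OF fJ, of cost "\<lambda>l. S ! l"] TF cost_nonneg by (auto simp: o_def)
  moreover have "(\<Sum>j\<in>C. Min ((\<lambda>f. d j f) ` ?T)) \<le> (\<Sum>j\<in>C. Min (insert (D j) ((\<lambda>l. d j (S ! l)) ` J)))"
  proof (intro sum_mono)
    fix j assume "j \<in> C"
    then obtain i where i: "i < k'" "\<forall>f\<in>F i. d j f \<le> D j" using D by blast
    obtain l where l: "l \<in> J" "l \<in> Bl i" using J(2) i by blast
    then obtain t where "t < N" "l = t * k' + i" by (auto simp: Bl_def)
    then have "d j (S ! l) \<le> D j" using cover[of t i] i S(2) by auto
    moreover have "Min ((\<lambda>l. d j (S ! l)) ` J) \<le> d j (S ! l)" using l fJ by auto
    ultimately show "Min ((\<lambda>f. d j f) ` ?T) \<le> Min (insert (D j) ((\<lambda>l. d j (S ! l)) ` J))"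
      using fJ J0 by (simp add: image_image)
  qed
  moreover have "sum_list (map cost S) = (\<Sum>l<length S. cost (S ! l))"
    by (simp add: sum_list_sum_nth lessThan_atLeast0)
  ultimately show ?thesis using J(1,3) J0 unfolding val_def conn_def by (intro exI[of _ J]) auto
qed

text \<open>A client of cluster \<open>i\<close> pays its own distance, \<open>D i\<close> to reach
  the anchor, and a radius of about \<open>(1 + e) * D i\<close>. The sum of the
  \<open>m i * D i\<close> is at most \<open>(1 + 2 * e) * Cst\<close>, so the total is
  \<open>3 + 6 * e + 4 * (e * e)\<close> times \<open>Cst\<close>, which \<open>e \<le> 1\<close>
  turns into \<open>3 + 10 * e\<close>.\<close>

lemma guesses_exist:
  "\<exists>G v v' b. (\<forall>l. G l < B) \<and> (\<forall>i<k. G (k + i) \<le> k) \<and> v < n \<and> v' < n \<and> G (3 * k) = k' \<and>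
     (\<forall>i<k'. b i < n \<and> anch G i = b i \<and> d (fs i) (b i) \<le> rad G v v' i) \<and>
     (\<Sum>j\<in>C. d j (b (\<phi> j)) + rad G v v' (\<phi> j)) \<le> (3 + 10 * e) * Cst \<and> G (3 * k + 1) = M"
  if M: "M < B"
proof -
  obtain G0 where G0: "\<forall>l. G0 l < B" "\<And>i. i < k' \<Longrightarrow> good (ancs \<delta> G0 k) i"
    using anchors_exist by blast
  define as where "as = ancs \<delta> G0 k"
  define D where "D i = wt as (fs i)" for i
  have as: "as \<noteq> []" "set as \<subseteq> {..<n}" "length as = Suc k"
    using ancs_nonempty ancs_points by (auto simp: as_def)
  have D0: "0 \<le> D i" for i using wt_nonneg[OF as(1)] by (simp add: D_def)
  have "\<exists>b<Suc k. D i = d (fs i) (as ! b)" for i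
    using wt_attained[OF as(1), of "fs i"] as(3) by (auto simp: D_def in_set_conv_nth)
  then obtain b where b: "\<And>i. b i < Suc k" "\<And>i. D i = d (fs i) (as ! b i)" by metis
  have "0 \<in> {..<k'}" using k' by simp
  then have fin: "finite (D ` {..<k'})" "D ` {..<k'} \<noteq> {}" by blast+
  obtain i0 where i0: "i0 < k'" "\<And>l. l < k' \<Longrightarrow> D l \<le> D i0"
    using Max_in[OF fin] Max_ge[OF fin(1)] by fastforce
  have "\<exists>t<B. D i \<le> D i0 * \<eta> ^ t \<and> D i0 * \<eta> ^ t \<le> (1 + e) * D i + e / n * D i0" if "i < k'" for i
    using radius_exists[OF D0 i0(2)[OF that]] .
  then obtain t where t: "\<And>i. i < k' \<Longrightarrow> t i < B" "\<And>i. i < k' \<Longrightarrow> D i \<le> D i0 * \<eta> ^ t i"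
    "\<And>i. i < k' \<Longrightarrow> D i0 * \<eta> ^ t i \<le> (1 + e) * D i + e / n * D i0" by metis
  \<comment> \<open>The digits from \<open>3 * k + 2\<close> on stay 0 here; they are set once the
    greedy list is fixed.\<close>
  define G where "G l = (if l < k then G0 l else if l < 2 * k then b (l - k) else
     if l < 3 * k then (if l - 2 * k < k' then t (l - 2 * k) else 0) else
     if l = 3 * k then k' else if l = 3 * k + 1 then M else 0)" for l
  have bB: "b i < B" for i using b(1)[of i] B(3) by simp
  have GB: "\<forall>l. G l < B" 
  proof
    fix l show "G l < B"
      using G0(1) bB[of "l - k"] t(1)[of "l - 2 * k"] k' B(3) M by (simp add: G_def)
  qed
  have anc: "ancs \<delta> G k = as" unfolding as_def by (intro ancs_cong) (auto simp: G_def)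
  have bn: "as ! b i < n" for i
  proof -
    have "as ! b i \<in> set as" using b(1)[of i] as(3) by (intro nth_mem) simp
    then show ?thesis using as(2) by blast
  qed
  define v v' where "v = fs i0" and "v' = as ! b i0"
  have vv: "v < n" "v' < n" "d v v' = D i0"
    using in_points i0 bn b(2)[of i0] by (auto simp: v_def v'_def)
  have an: "anch G i = as ! b i" if "i < k'" for i
    using that k' anc by (simp add: anch_def G_def)
  have rd: "rad G v v' i = D i0 * \<eta> ^ t i" if "i < k'" for i
    using that k' vv by (simp add: rad_def G_def)
  define m where "m i = real (card (cl i))" for i
  have mD: "m i * D i \<le> (1 + e) * cc i + e / k * Cst" if "i < k'" for i
    using G0(2)[OF that] by (simp add: good_def as_def D_def m_def)
  have sm: "(\<Sum>i<k'. m i * D i) \<le> (1 + 2 * e) * Cst"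
  proof -
    have "(\<Sum>i<k'. m i * D i) \<le> (\<Sum>i<k'. (1 + e) * cc i + e / k * Cst)" using mD by (intro sum_mono) auto
    also have "\<dots> = (1 + e) * Cst + k' * (e / k * Cst)" by (simp add: sum.distrib Cst_eq sum_distrib_left)
    also have "\<dots> \<le> (1 + e) * Cst + k * (e / k * Cst)"
      using k_pos e Cst_nonneg by (intro add_left_mono mult_right_mono) auto
    also have "\<dots> = (1 + 2 * e) * Cst" using k_pos by (simp add: algebra_simps)
    finally show ?thesis .
  qed
  \<comment> \<open>Clusters are nonempty, so the largest distance to an anchor is itself paid at
    least once in \<open>sm\<close>; this makes it a harmless scale for the radii.\<close>
  have R: "D i0 \<le> (1 + 2 * e) * Cst"
  proof -
    have "1 * D i0 \<le> m i0 * D i0" using card_cl[OF i0(1)] D0 by (intro mult_right_mono) (auto simp: m_def)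
    also have "\<dots> \<le> (\<Sum>i<k'. m i * D i)" using i0(1) D0 by (intro member_le_sum) (auto simp: m_def)
    finally show ?thesis using sm by simp
  qed
  have mn: "(\<Sum>i<k'. m i) \<le> n"
  proof -
    have "(\<Sum>i<k'. m i) = (\<Sum>j\<in>C. 1)" unfolding sum_cl m_def by simp
    also have "\<dots> \<le> n" using card_mono[OF _ C_sub] by simp
    finally show ?thesis .
  qed
  have "(\<Sum>j\<in>C. d j (as ! b (\<phi> j)) + rad G v v' (\<phi> j))
     = (\<Sum>i<k'. \<Sum>j\<in>cl i. d j (as ! b i) + D i0 * \<eta> ^ t i)"
    unfolding sum_cl by (intro sum.cong refl) (auto simp: cl_def rd)
  also have "\<dots> \<le> (\<Sum>i<k'. \<Sum>j\<in>cl i. d j (fs i) + (D i + ((1 + e) * D i + e / n * D i0)))"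
  proof (intro sum_mono)
    fix i j assume i: "i \<in> {..<k'}" and j: "j \<in> cl i"
    have "d j (as ! b i) \<le> d j (fs i) + d (fs i) (as ! b i)"
      using in_points(1)[of j] in_points(2)[of i] i j bn cl_sub[of i] by (intro d_tri) auto
    then show "d j (as ! b i) + D i0 * \<eta> ^ t i \<le> d j (fs i) + (D i + ((1 + e) * D i + e / n * D i0))"
      using t(3)[of i] i b(2)[of i] by auto
  qed
  also have "\<dots> = (\<Sum>i<k'. cc i + (2 + e) * (m i * D i) + e / n * D i0 * m i)"
    by (simp add: sum.distrib cc_def m_def algebra_simps)
  also have "\<dots> = Cst + (2 + e) * (\<Sum>i<k'. m i * D i) + e / n * D i0 * (\<Sum>i<k'. m i)"
    by (simp add: sum.distrib Cst_eq sum_distrib_left)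
  also have "\<dots> \<le> Cst + (2 + e) * ((1 + 2 * e) * Cst) + e / n * D i0 * n"
    using sm mn e D0 by (intro add_mono mult_left_mono) auto
  also have "e / n * D i0 * n = e * D i0" using n_pos by simp
  also have "Cst + (2 + e) * ((1 + 2 * e) * Cst) + e * D i0
      \<le> Cst + (2 + e) * ((1 + 2 * e) * Cst) + e * ((1 + 2 * e) * Cst)"
    using R e by (intro add_left_mono mult_left_mono) auto
  also have "Cst + (2 + e) * ((1 + 2 * e) * Cst) + e * ((1 + 2 * e) * Cst) = (3 + 6 * e + 4 * (e * e)) * Cst"
    by (simp add: algebra_simps)
  also have "\<dots> \<le> (3 + 6 * e + 4 * e) * Cst"
    using e Cst_nonneg by (intro mult_right_mono add_left_mono) (auto simp: mult_left_le)
  also have "(3 + 6 * e + 4 * e) * Cst = (3 + 10 * e) * Cst" by (simp add: algebra_simps)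
  finally have "(\<Sum>j\<in>C. d j (as ! b (\<phi> j)) + rad G v v' (\<phi> j)) \<le> (3 + 10 * e) * Cst" .
  moreover have "\<forall>i<k'. as ! b i < n \<and> anch G i = as ! b i \<and> d (fs i) (as ! b i) \<le> rad G v v' i"
    by (simp add: an rd t(2) bn b(2)[symmetric])
  moreover have "G (3 * k) = k'" "G (3 * k + 1) = M" using k' by (simp_all add: G_def)
  moreover have "\<forall>i<k. G (k + i) \<le> k" using b(1) by (simp add: G_def less_Suc_eq_le)
  ultimately show ?thesis using GB vv(1,2)
    by (intro exI[of _ G] exI[of _ v] exI[of _ v'] exI[of _ "\<lambda>i. as ! b i"] conjI) simp_all
qed

lemma solution_exists:
  "\<exists>G v v'. (\<forall>l. G l < B) \<and> (\<forall>i<k. G (k + i) \<le> k) \<and> v < n \<and> v' < n \<and> solset G v v' \<noteq> {} \<and>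
     val (solset G v v') \<le> (alpha_FL + 5 / N + 10 * e) * (Oc + Cst)"
proof -
  obtain M where M: "N \<le> M" "M \<le> 4 * N + 5"
    "M / N * Oc + Cst + 2 * Cst * (N / (N + 1)) ^ M \<le> (alpha_FL + 5 / N) * (Oc + Cst)"
    using rounds_exist[OF Oc_nonneg Cst_nonneg N] by auto
  have MB: "M < B" using M B M0_def by simp
  obtain G v v' b where G: "\<forall>l. G l < B" "v < n" "v' < n" "G (3 * k) = k'"
     "\<And>i. i < k' \<Longrightarrow> b i < n \<and> anch G i = b i \<and> d (fs i) (b i) \<le> rad G v v' i"
     "(\<Sum>j\<in>C. d j (b (\<phi> j)) + rad G v v' (\<phi> j)) \<le> (3 + 10 * e) * Cst" "G (3 * k + 1) = M"
     "\<forall>i<k. G (k + i) \<le> k"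
    using guesses_exist[OF MB] by blast
  define D where "D = dummy G v v'"
  interpret fractional_greedy C d p D using finite_CF real_p by unfold_locales auto
  define F where "F i = {f \<in> Fc. d f (anch G i) \<le> rad G v v' i}" for i
  have cls: "classes G = k'" "rounds G = M" unfolding classes_def rounds_def G(4,7) using k' M M0_def by simp_all
  define S where "S = glist G v v'"
  define \<beta> where "\<beta> = 1 / (1 + p)"
  have S: "S = greedy (sel G v v') k' (\<lambda>t. \<beta> ^ (M - t)) M" by (simp add: S_def glist_def cls \<beta>_def)
  have ex: "\<exists>f<n. f \<in> Fc \<and> d f (anch G i) \<le> rad G v v' i" if "i < k'" for i
    using G(5)[OF that] fs[OF that] in_points(2)[OF that] by (intro exI[of _ "fs i"]) auto
  have selF: "sel G v v' i c S' \<in> F i" if "i < k'" for i c S'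
    using amin_props(2)[OF ex[OF that]] by (simp add: sel_def F_def)
  have selmin: "cost (sel G v v' i c S') - c * gain S' (sel G v v' i c S') \<le> cost (fs i) - c * gain S' (fs i)"
    if "i < k'" for i c S'
    using amin_props(3)[OF ex[OF that], of "fs i" "\<lambda>f. cost f - c * gain S' f"]
      G(5)[OF that] fs[OF that] in_points(2)[OF that] by (simp add: sel_def D_def)
  have Dmin: "D j = Min ((\<lambda>i. d j (anch G i) + rad G v v' i) ` {..<k'})" for j
  proof -
    have "{i. i < k \<and> i < k'} = {..<k'}" using k' by auto
    moreover have "\<exists>i<k. i < k'" using k' by (intro exI[of _ 0]) auto
    ultimately show ?thesis unfolding D_def dummy_def cls by (subst minval_eq_Min) auto
  qed
  have Dle: "D j \<le> d j (b (\<phi> j)) + rad G v v' (\<phi> j)" if "j \<in> C" for j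
    using G(5)[OF \<phi>[OF that]] \<phi>[OF that] unfolding Dmin by (intro Min_le image_eqI[of _ _ "\<phi> j"]) auto
  \<comment> \<open>For the empty list every client pays \<open>D j\<close>; the excess over
    \<open>Cst\<close> obtained here is what the rounds contract by
    \<open>\<beta> ^ M\<close>.\<close>
  have "conn [] = (\<Sum>j\<in>C. D j)" by (simp add: conn_def)
  also have "\<dots> \<le> (3 + 10 * e) * Cst" using G(6) sum_mono[OF Dle, of C "\<lambda>j. j"] by simp
  finally have c0: "conn [] - Cst \<le> (2 + 10 * e) * Cst" by (simp add: algebra_simps)
  have p0: "0 < 1 + p" using real_p by simp
  have \<beta>: "0 \<le> \<beta>" "\<beta> \<le> 1" "\<beta> * (1 + p) = 1"
    using real_p(1) by (auto simp: \<beta>_def)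
  have \<beta>4: "\<beta> = N / (N + 1)" unfolding \<beta>_def by (rule real_p(4))
  have "p * sum_list (map cost S) + \<beta> ^ (M - M) * (conn S - Cst)
    \<le> M * p * Oc + \<beta> ^ (M - 0) * (conn [] - Cst)"
    unfolding S
  proof (rule greedy_bound[OF selmin \<phi> _ _ Oc_def Cst_def])
    show "0 \<le> \<beta> ^ (M - t)" for t using \<beta> by simp
    show "\<beta> ^ (M - Suc t) = \<beta> ^ (M - t) * (1 + p)" if "t < M" for t
    proof -
      have "M - t = Suc (M - Suc t)" using that by simp
      then have "\<beta> ^ (M - t) * (1 + p) = \<beta> ^ (M - Suc t) * (\<beta> * (1 + p))" by simp
      then show ?thesis by (simp only: \<beta>(3))
    qed
  qed auto
  then have "p * sum_list (map cost S) + conn S \<le> M * p * Oc + Cst + \<beta> ^ M * (conn [] - Cst)" by simp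
  also have "\<dots> \<le> M * p * Oc + Cst + \<beta> ^ M * ((2 + 10 * e) * Cst)"
    using c0 \<beta> by (intro add_left_mono mult_left_mono) auto
  also have "\<dots> = (M / N * Oc + Cst + 2 * Cst * \<beta> ^ M) + \<beta> ^ M * (10 * e * Cst)"
    by (simp add: p_def algebra_simps)
  \<comment> \<open>The discount \<open>\<beta> ^ M\<close> is given up for the error term only; for
    the main term \<open>2 * Cst * \<beta> ^ M\<close> it is what \<open>rounds_exist\<close>
    balances against the opening costs.\<close>
  also have "\<dots> \<le> (alpha_FL + 5 / N) * (Oc + Cst) + 1 * (10 * e * Cst)"
    using M(3) \<beta> e Cst_nonneg unfolding \<beta>4[symmetric]
    by (intro add_mono mult_right_mono power_le_one) auto
  also have "\<dots> \<le> (alpha_FL + 5 / N + 10 * e) * (Oc + Cst)"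
    using e Oc_nonneg by (simp add: algebra_simps)
  finally have tot: "p * sum_list (map cost S) + conn S \<le> (alpha_FL + 5 / N + 10 * e) * (Oc + Cst)" .
  have len: "length S = M * k'" by (simp add: S)
  have cover: "S ! (t * k' + i) \<in> F i" if "t < M" "i < k'" for t i
    using greedy_nth[OF that, of "sel G v v'"] selF[OF that(2)] unfolding S by metis
  have SF: "set S \<subseteq> Fc"
  proof
    fix s assume "s \<in> set S"
    then obtain l where l: "l < M * k'" "s = S ! l" by (auto simp: in_set_conv_nth len)
    have "S ! (l div k' * k' + l mod k') \<in> F (l mod k')"
      using l k' by (intro cover) (auto simp: less_mult_imp_div_less)
    then show "s \<in> Fc" using l by (simp add: F_def)
  qed
  have "\<exists>i<k'. \<forall>f\<in>F i. d j f \<le> D j" if j: "j \<in> C" for j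
  proof -
    have "0 \<in> {..<k'}" using k' by simp
    then have "D j \<in> (\<lambda>i. d j (anch G i) + rad G v v' i) ` {..<k'}"
      unfolding Dmin by (intro Min_in) blast+
    then obtain i where i: "i < k'" "D j = d j (anch G i) + rad G v v' i" by blast
    have "d j f \<le> D j" if "f \<in> F i" for f
    proof -
      have "d j f \<le> d j (anch G i) + d (anch G i) f"
        using in_points j that Fc_sub G(5)[OF i(1)] by (intro d_tri) (auto simp: F_def)
      then show ?thesis using that i(2) by (simp add: F_def d_sym)
    qed
    then show ?thesis using i(1) by blast
  qed
  from rounding_exists[OF len M(1) SF cover this]
  obtain J where J: "J \<subseteq> {..<length S}" "J \<noteq> {}" "val ((\<lambda>l. S ! l) ` J) \<le> p * sum_list (map cost S) + conn S"
    by blast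
  \<comment> \<open>The last digits are the characteristic function of \<open>J\<close>; changing
    them does not affect the list on which \<open>J\<close> depends.\<close>
  define G' where "G' l = (if l < 3 * k + 2 then G l else if l - (3 * k + 2) \<in> J then 1 else 0)" for l
  have gl: "glist G' v v' = S" unfolding S_def by (intro glist_cong) (auto simp: G'_def)
  have sol: "solset G' v v' = (\<lambda>l. S ! l) ` J"
  proof (intro set_eqI iffI)
    fix s assume "s \<in> solset G' v v'"
    then have "\<exists>l<length S. s = S ! l \<and> 1 \<le> G' (3 * k + 2 + l) \<and> s \<in> Fc"
      unfolding solset_def gl mem_Collect_eq .
    then obtain l where "s = S ! l" "1 \<le> G' (3 * k + 2 + l)" by blast
    then show "s \<in> (\<lambda>l. S ! l) ` J" by (auto simp: G'_def split: if_splits)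
  next
    fix s assume "s \<in> (\<lambda>l. S ! l) ` J"
    then obtain l where l: "l \<in> J" "s = S ! l" by blast
    have len: "l < length S" using J(1) l(1) by blast
    have "S ! l \<in> Fc" by (rule subsetD[OF SF nth_mem[OF len]])
    moreover have "1 \<le> G' (3 * k + 2 + l)" using l by (simp add: G'_def)
    ultimately show "s \<in> solset G' v v'" unfolding solset_def gl mem_Collect_eq
      using len l(2) by (intro exI[of _ l]) simp
  qed
  have "1 < B" using B M0_def by simp
  then have "\<forall>l. G' l < B" using G(1) by (auto simp: G'_def)
  moreover have "\<forall>i<k. G' (k + i) \<le> k" using G(8) by (simp add: G'_def)
  moreover have "solset G' v v' \<noteq> {}" unfolding sol using J(2) by blast
  moreover have "val (solset G' v v') \<le> (alpha_FL + 5 / N + 10 * e) * (Oc + Cst)"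
    unfolding sol using J(3) tot by linarith
  ultimately show ?thesis using G(2,3) by blast
qed

end

section \<open>Minimization by a scan from left to right\<close>

lemma amin_eqI:
  assumes "i < n" "P i" "\<And>j. j < n \<Longrightarrow> P j \<Longrightarrow> e i \<le> e j" "\<And>j. j < i \<Longrightarrow> P j \<Longrightarrow> e i < e j"
  shows "amin P e n = i"
proof -
  have "(LEAST i. i < n \<and> P i \<and> (\<forall>j<n. P j \<longrightarrow> e i \<le> e j)) = i"
  proof (rule Least_equality)
    fix y assume y: "y < n \<and> P y \<and> (\<forall>j<n. P j \<longrightarrow> e y \<le> e j)"
    show "i \<le> y"
    proof (rule ccontr)
      assume "\<not> i \<le> y"
      then have "e i < e y" using assms(4)[of y] y by simp
      moreover have "e y \<le> e i" using y assms by auto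
      ultimately show False by simp
    qed
  qed (use assms in auto)
  then show ?thesis using assms by (auto simp: amin_def)
qed

lemma amin_strict:
  assumes "\<exists>i<n. P i" "j < amin P e n" "P j" shows "e (amin P e n) < e j"
proof (rule ccontr)
  assume not: "\<not> ?thesis"
  note a = amin_props[OF assms(1), where e = e]
  have "j < n" using a(1) assms(2) by simp
  then have "\<forall>l<n. P l \<longrightarrow> e j \<le> e l" using a(3) not by fastforce
  then have "(LEAST i. i < n \<and> P i \<and> (\<forall>j<n. P j \<longrightarrow> e i \<le> e j)) \<le> j"
    using \<open>j < n\<close> assms(3) by (intro Least_le) auto
  then show False using assms(1,2) by (auto simp: amin_def)
qed

lemma amin_Suc:
  "amin P e (Suc n) =
     (if P n \<and> ((\<forall>i<n. \<not> P i) \<or> \<not> e (amin P e n) \<le> e n) then n else amin P e n)"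
proof (cases "\<exists>i<n. P i")
  case True
  note a = amin_props[OF True, where e = e] and st = amin_strict[OF True, where e = e]
  show ?thesis
  proof (cases "P n \<and> \<not> e (amin P e n) \<le> e n")
    case T: True
    have "e n < e j" if "j < n" "P j" for j using a(3)[OF that] T by linarith
    then have "amin P e (Suc n) = n" using T by (intro amin_eqI) (auto simp: less_Suc_eq less_imp_le)
    then show ?thesis using T by simp
  next
    case F: False
    have "amin P e (Suc n) = amin P e n"
    proof (rule amin_eqI)
      fix j assume "j < Suc n" "P j"
      then show "e (amin P e n) \<le> e j" using a(3)[of j] F by (cases "j = n") auto
    next
      fix j assume "j < amin P e n" "P j"
      then show "e (amin P e n) < e j" by (rule st)
    qed (use a(1,2) in auto)
    then show ?thesis using True F by auto
  qed
next
  case False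
  show ?thesis
  proof (cases "P n")
    case T: True
    then have "amin P e (Suc n) = n" using False by (intro amin_eqI) (auto simp: less_Suc_eq)
    then show ?thesis using T False by auto
  qed (use False in \<open>auto simp: amin_def less_Suc_eq\<close>)
qed

text \<open>Loops are to be treated by \<open>sem_For_inv\<close> and never unfolded into
  \<open>fold\<close>; without the weak congruence rule the simplifier also works inside the
  branches of conditionals.\<close>

declare sem.simps(7) [simp del] if_weak_cong [cong del]

section \<open>The program\<close>

text \<open>Arrays over the natural numbers: 3 multiples of \<open>n\<close>, 4 digits, 5 anchors, 6 facilities not hit
  yet, 7 current subset, 8 length of the greedy list, 9 carry, 10 and 11 existence and position of a
  minimum, 13 whether a solution was found.  Real arrays: 2 weights, 3 powers of \<open>\<eta>\<close>, 4 and 5 values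
  and probabilities of the connection costs (for client \<open>j\<close> at the indices congruent to \<open>j\<close> modulo \<open>n\<close>),
  6 weight of the current round, 7 best cost, 8 connection costs, 10 a minimum.
  Registers: 0 \<open>n\<close>, 1 \<open>k\<close>, 2 base of the digits, 3 number of digits, 4 number of digit strings,
  5 \<open>M0\<close>; variables 10 \<open>j\<close>, 11 \<open>f\<close>, 12 \<open>x\<close>, 13 \<open>y\<close>, 14 class, 15 round, 16 atom or anchor,
  17 hitting iteration, 18 \<open>v\<close>, 19 \<open>v'\<close>, 20 counter, 21 position.\<close>

abbreviation "N0 A \<equiv> NA A (NC 0)"
abbreviation "R0 A \<equiv> RA A (NC 0)"
abbreviation "DI u w \<equiv> RA 0 (NPl (NA 3 u) w)"
abbreviation "IND a b \<equiv> RIfN a b (RC 1) (RC 0)"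
abbreviation "K3 \<equiv> NPl (NV 1) (NPl (NV 1) (NV 1))"
abbreviation "SUCC a \<equiv> NPl a (NC 1)"

definition UPDMIN :: "nat \<Rightarrow> rexp \<Rightarrow> stm" where
  "UPDMIN x e = NSt 10 (NC 0) (NC 1) ;; NSt 11 (NC 0) (NV x) ;; RSt 10 (NC 0) e"

definition ARGMIN :: "nat \<Rightarrow> nat \<Rightarrow> rexp \<Rightarrow> rexp \<Rightarrow> stm" where
  "ARGMIN x y g e = NSt 10 (NC 0) (NC 0) ;; NSt 11 (NC 0) (NC 0) ;; RSt 10 (NC 0) (RC 0) ;;
     SFor x y (SIfR (RC 1) g (SIfN (N0 10) (NC 0) (UPDMIN x e) (SIfR (R0 10) e SSkip (UPDMIN x e))) SSkip)"

text \<open>Equality up to the scratch cells of \<open>ARGMIN\<close>. The guard and the objective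
  are evaluated while these cells change, so their values must not depend on them.\<close>

definition same :: "mem \<Rightarrow> mem \<Rightarrow> bool" where
  "same \<sigma> \<tau> \<longleftrightarrow> (\<forall>A. A \<noteq> 10 \<longrightarrow> A \<noteq> 11 \<longrightarrow> fst \<tau> A = fst \<sigma> A) \<and> (\<forall>A. A \<noteq> 10 \<longrightarrow> snd \<tau> A = snd \<sigma> A)"

lemma sameD: "same \<sigma> \<tau> \<Longrightarrow> A \<noteq> 10 \<Longrightarrow> A \<noteq> 11 \<Longrightarrow> fst \<tau> A = fst \<sigma> A"
  "same \<sigma> \<tau> \<Longrightarrow> A \<noteq> 10 \<Longrightarrow> snd \<tau> A = snd \<sigma> A"
  by (auto simp: same_def)

lemma ARGMIN_sem:
  assumes g: "\<And>i \<tau>. i < \<rho> y \<Longrightarrow> same \<sigma> \<tau> \<Longrightarrow> evR g (\<rho>(x := i)) \<tau> = (if P i then 1 else 0)"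
    and e: "\<And>i \<tau>. i < \<rho> y \<Longrightarrow> P i \<Longrightarrow> same \<sigma> \<tau> \<Longrightarrow> evR e (\<rho>(x := i)) \<tau> = E i"
  shows "fst (sem (ARGMIN x y g e) \<rho> \<sigma>) 10 0 = (if \<exists>i<\<rho> y. P i then 1 else 0)"
    and "fst (sem (ARGMIN x y g e) \<rho> \<sigma>) 11 0 = amin P E (\<rho> y)"
    and "snd (sem (ARGMIN x y g e) \<rho> \<sigma>) 10 0 = minval P E (\<rho> y)"
proof -
  define I where "I i \<tau> \<longleftrightarrow> same \<sigma> \<tau> \<and> fst \<tau> 10 0 = (if \<exists>l<i. P l then 1 else 0) \<and>
    fst \<tau> 11 0 = amin P E i \<and> snd \<tau> 10 0 = minval P E i" for i and \<tau> :: mem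
  have "I (\<rho> y) (sem (ARGMIN x y g e) \<rho> \<sigma>)"
    unfolding ARGMIN_def sem.simps(4)
  proof (rule sem_For_inv)
    show "I 0 (sem (RSt 10 (NC 0) (RC 0)) \<rho> (sem (NSt 11 (NC 0) (NC 0)) \<rho> (sem (NSt 10 (NC 0) (NC 0)) \<rho> \<sigma>)))"
      by (simp add: I_def same_def amin_def minval_def)
  next
    fix i \<tau> assume i: "i < \<rho> y" and I: "I i \<tau>"
    have s: "same \<sigma> \<tau>" using I by (simp add: I_def)
    have gi: "evR g (\<rho>(x := i)) \<tau> = (if P i then 1 else 0)" using g i s by blast
    let ?B = "SIfR (RC 1) g (SIfN (N0 10) (NC 0) (UPDMIN x e) (SIfR (R0 10) e SSkip (UPDMIN x e))) SSkip"
    show "I (Suc i) (sem ?B (\<rho>(x := i)) \<tau>)"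
    proof (cases "P i")
      case False
      have "amin P E (Suc i) = amin P E i" using False by (simp add: amin_Suc)
      moreover have "(\<exists>l<Suc i. P l) = (\<exists>l<i. P l)" using False by (auto simp: less_Suc_eq)
      ultimately show ?thesis using I gi False by (auto simp: I_def minval_def)
    next
      case True
      have ei: "evR e (\<rho>(x := i)) \<tau> = E i" using e i s True by blast
      \<comment> \<open>\<open>UPDMIN\<close> evaluates \<open>e\<close> a second time, after the
        flag and the position have been overwritten.\<close>
      define \<tau>1 where "\<tau>1 = sem (NSt 11 (NC 0) (NV x)) (\<rho>(x := i)) (sem (NSt 10 (NC 0) (NC 1)) (\<rho>(x := i)) \<tau>)"
      have s1: "same \<sigma> \<tau>1" using s by (simp add: same_def \<tau>1_def)
      have e1: "evR e (\<rho>(x := i)) \<tau>1 = E i" using e i s1 True by blast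
      have upd: "I (Suc i) (sem (UPDMIN x e) (\<rho>(x := i)) \<tau>)" if "amin P E (Suc i) = i"
      proof -
        have "sem (UPDMIN x e) (\<rho>(x := i)) \<tau> = sem (RSt 10 (NC 0) e) (\<rho>(x := i)) \<tau>1"
          by (simp only: UPDMIN_def sem.simps(4) \<tau>1_def)
        moreover have "\<exists>l<Suc i. P l" using True by blast
        ultimately show ?thesis using s1 e1 that
          by (simp add: I_def minval_def same_def) (simp add: \<tau>1_def)
      qed
      show ?thesis
      proof (cases "\<exists>l<i. P l")
        case F: False
        then have "amin P E (Suc i) = i" using True by (auto simp: amin_Suc)
        then show ?thesis using upd gi True I F by (auto simp: I_def[of i])
      next
        case T: True
        have v: "snd \<tau> 10 0 = E (amin P E i)" "fst \<tau> 10 0 = 1" using I T by (auto simp: I_def minval_def)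
        show ?thesis
        proof (cases "E (amin P E i) \<le> E i")
          case le: True
          have "amin P E (Suc i) = amin P E i" using T le by (auto simp: amin_Suc)
          moreover have "\<exists>l<Suc i. P l" using T less_Suc_eq by blast
          ultimately show ?thesis using gi True ei v le I T by (simp add: I_def minval_def)
        next
          case F: False
          then have "amin P E (Suc i) = i" using True by (simp add: amin_Suc)
          then show ?thesis using upd gi True ei v F by simp
        qed
      qed
    qed
  qed
  then show "fst (sem (ARGMIN x y g e) \<rho> \<sigma>) 10 0 = (if \<exists>i<\<rho> y. P i then 1 else 0)"
    "fst (sem (ARGMIN x y g e) \<rho> \<sigma>) 11 0 = amin P E (\<rho> y)"
    "snd (sem (ARGMIN x y g e) \<rho> \<sigma>) 10 0 = minval P E (\<rho> y)" by (auto simp: I_def)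
qed

lemma wr_ARGMIN [simp]: "wrN (ARGMIN x y g e) = {10, 11}" "wrR (ARGMIN x y g e) = {10}"
  by (auto simp: ARGMIN_def UPDMIN_def)

lemma sem_frame:
  "A \<notin> wrN c \<Longrightarrow> fst (sem c \<rho> \<sigma>) A = fst \<sigma> A"
  "A \<notin> wrR c \<Longrightarrow> snd (sem c \<rho> \<sigma>) A = snd \<sigma> A"
  by (rule sem_frameN sem_frameR, assumption)+

text \<open>Loop bounds are registers, and none holds the number of present anchors; so the loop
  runs to \<open>L > k\<close> and a guard stops counting after index \<open>i\<close> in register
  14. Points that are not clients get weight 0, which lets later sums run over all points.\<close>

definition WEIGHTS :: stm where
  "WEIGHTS = SFor 10 0 (ARGMIN 16 3 (IND (NV 16) (NV 14)) (DI (NV 10) (NA 5 (NV 16))) ;;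
     RSt 2 (NV 10) (RIfN (NC 1) (NA 0 (NV 10)) (R0 10) (RC 0)))"

text \<open>There is no conversion to reals: the number k is a sum of k ones, by which
  \<open>r\<close> is divided to obtain \<delta>.\<close>

definition INBALL :: "rat \<Rightarrow> nexp \<Rightarrow> nexp \<Rightarrow> rexp" where
  "INBALL r f x = RIfN (NC 1) (NA 0 x)
     (RIfR (RMu (RDi (RC r) (RSum 21 1 (RC 1))) (RSum 13 0 (RA 2 (NV 13))))
       (RSum 13 0 (RIfR (DI f x) (DI f (NV 13)) (RC 0) (RA 2 (NV 13)))) (RC 0) (RC 1)) (RC 0)"

definition HIT :: "rat \<Rightarrow> stm" where
  "HIT r = ARGMIN 12 0 (IND (NC 1) (NA 0 (NV 12)))
       (RMi (RC 0) (RSum 11 0 (RIfN (NC 1) (NA 6 (NV 11)) (INBALL r (NV 11) (NV 12)) (RC 0)))) ;;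
     SFor 11 0 (SIfR (RC 1) (INBALL r (NV 11) (N0 11)) (NSt 6 (NV 11) (NC 0)) SSkip)"

text \<open>The guard lets exactly the hitting steps from 0 to the guessed index run, so the
  position cell still holds the point of the last of them when the loop ends.\<close>

definition STAGE :: "rat \<Rightarrow> stm" where
  "STAGE r = WEIGHTS ;; SFor 11 0 (NSt 6 (NV 11) (NA 1 (NV 11))) ;;
     SFor 17 2 (SIfN (NV 17) (NA 4 (NV 14)) (HIT r) SSkip) ;; NSt 5 (SUCC (NV 14)) (N0 11)"

definition ANCHORS :: "rat \<Rightarrow> stm" where
  "ANCHORS r = NSt 5 (NC 0) (NC 0) ;; SFor 14 1 (STAGE r)"

locale fl_prog = fl_model +
  fixes B L :: nat and r\<delta> r\<eta> rp :: rat
  assumes C_nonempty: "C \<noteq> {}" and k_pos: "1 \<le> k"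
    and r\<delta>: "\<delta> = real_of_rat r\<delta> / real k" and r\<eta>: "\<eta> = real_of_rat r\<eta>" and rp: "p = real_of_rat rp"
    and p: "0 < p" "p \<le> 1"
    and L: "L = 3 * k + 2 + M0 * k"
begin

definition env :: "(nat \<Rightarrow> nat) \<Rightarrow> bool" where
  "env \<rho> \<longleftrightarrow> \<rho> 0 = n \<and> \<rho> 1 = k \<and> \<rho> 2 = B \<and> \<rho> 3 = L \<and> \<rho> 5 = M0"

lemma env_upd [simp]: "10 \<le> x \<Longrightarrow> env (\<rho>(x := i)) = env \<rho>"
  by (auto simp: env_def)

lemma envD: "env \<rho> \<Longrightarrow> \<rho> 0 = n" "env \<rho> \<Longrightarrow> \<rho> (Suc 0) = k" "env \<rho> \<Longrightarrow> \<rho> 1 = k" "env \<rho> \<Longrightarrow> \<rho> 2 = B"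
  "env \<rho> \<Longrightarrow> \<rho> 3 = L" "env \<rho> \<Longrightarrow> \<rho> 5 = M0"
  by (auto simp: env_def)

text \<open>Natural numbers cannot be multiplied; the table of multiples of \<open>n\<close> gives
  the rows of the distance matrix for \<open>u < n\<close>, and the layers of the cost distributions
  for \<open>u < L\<close>.\<close>

definition ready :: "mem \<Rightarrow> bool" where
  "ready \<sigma> \<longleftrightarrow> fst \<sigma> 0 = (\<lambda>v. if v \<in> C then 1 else 0) \<and> fst \<sigma> 1 = (\<lambda>v. if v \<in> Fc then 1 else 0) \<and>
     (\<forall>u. u < n \<or> u < L \<longrightarrow> fst \<sigma> 3 u = u * n) \<and> (\<forall>u<n. \<forall>w<n. snd \<sigma> 0 (u * n + w) = d u w) \<and>
     (\<forall>f\<in>Fc. snd \<sigma> 1 f = cost f) \<and> (\<forall>t<B. snd \<sigma> 3 t = \<eta> ^ t)"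

lemma readyD:
  "ready \<sigma> \<Longrightarrow> fst \<sigma> 0 = (\<lambda>v. if v \<in> C then 1 else 0)"
  "ready \<sigma> \<Longrightarrow> fst \<sigma> (Suc 0) = (\<lambda>v. if v \<in> Fc then 1 else 0)"
  "ready \<sigma> \<Longrightarrow> u < n \<Longrightarrow> fst \<sigma> 3 u = u * n"
  "ready \<sigma> \<Longrightarrow> u < L \<Longrightarrow> fst \<sigma> 3 u = u * n"
  "ready \<sigma> \<Longrightarrow> u < n \<Longrightarrow> w < n \<Longrightarrow> snd \<sigma> 0 (u * n + w) = d u w"
  "ready \<sigma> \<Longrightarrow> f \<in> Fc \<Longrightarrow> snd \<sigma> (Suc 0) f = cost f"
  "ready \<sigma> \<Longrightarrow> t < B \<Longrightarrow> snd \<sigma> 3 t = \<eta> ^ t"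
  by (auto simp: ready_def)

lemma ready_frame:
  assumes "ready \<sigma>" "fst \<tau> 0 = fst \<sigma> 0" "fst \<tau> 1 = fst \<sigma> 1" "fst \<tau> 3 = fst \<sigma> 3"
    "snd \<tau> 0 = snd \<sigma> 0" "snd \<tau> 1 = snd \<sigma> 1" "snd \<tau> 3 = snd \<sigma> 3"
  shows "ready \<tau>"
  using assms by (simp add: ready_def)

lemma ready_sem:
  "ready \<sigma> \<Longrightarrow> wrN c \<inter> {0, 1, 3} = {} \<Longrightarrow> wrR c \<inter> {0, 1, 3} = {} \<Longrightarrow> ready (sem c \<rho> \<sigma>)"
  by (rule ready_frame[of \<sigma>]) (auto simp: sem_frame)

lemma ready_same: "ready \<sigma> \<Longrightarrow> same \<sigma> \<tau> \<Longrightarrow> ready \<tau>"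
  by (rule ready_frame) (auto simp: same_def)

lemma C_ex: "\<exists>x<n. x \<in> C" using C_nonempty C_sub by auto

lemma n_pos: "0 < n" using C_ex by auto

lemma sum_C: "(\<Sum>j<n. if j \<in> C then g j else 0) = (\<Sum>j\<in>C. g j)" for g :: "nat \<Rightarrow> real"
proof -
  have "(\<Sum>j<n. if j \<in> C then g j else 0) = (\<Sum>j\<in>{..<n} \<inter> C. g j)" by (simp add: sum.inter_restrict)
  also have "{..<n} \<inter> C = C" using C_sub by auto
  finally show ?thesis .
qed

lemma hitpt_n: "hitpt \<delta> as X < n"
  unfolding hitpt_def by (rule amin_props[OF C_ex])

lemma ancs_n: "a \<in> set (ancs \<delta> G i) \<Longrightarrow> a < n"
  using n_pos by (induction i) (auto simp: pick_def hitpt_n)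

definition anc_ok :: "(nat \<Rightarrow> nat) \<Rightarrow> nat \<Rightarrow> mem \<Rightarrow> bool" where
  "anc_ok G i \<sigma> \<longleftrightarrow> (\<forall>a\<le>i. fst \<sigma> 5 a = ancs \<delta> G i ! a)"

lemma anc_ok_n: "anc_ok G i \<sigma> \<Longrightarrow> a \<le> i \<Longrightarrow> fst \<sigma> 5 a < n"
  using ancs_n[of _ G i] nth_mem[of a "ancs \<delta> G i"] by (auto simp: anc_ok_def)

lemma WEIGHTS_sem:
  assumes "env \<rho>" "ready \<sigma>" "\<rho> 14 = i" "i < k" "anc_ok G i \<sigma>"
  shows "\<forall>j<n. snd (sem WEIGHTS \<rho> \<sigma>) 2 j = (if j \<in> C then wt (ancs \<delta> G i) j else 0)"
proof -
  define I where "I l \<tau> \<longleftrightarrow> ready \<tau> \<and> fst \<tau> 5 = fst \<sigma> 5 \<and>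
    (\<forall>j<l. snd \<tau> 2 j = (if j \<in> C then wt (ancs \<delta> G i) j else 0))" for l and \<tau> :: mem
  have "I (\<rho> 0) (sem WEIGHTS \<rho> \<sigma>)" unfolding WEIGHTS_def
  proof (rule sem_For_inv)
    show "I 0 \<sigma>" using assms by (simp add: I_def)
  next
    fix j \<tau> assume j: "j < \<rho> 0" and I: "I j \<tau>"
    let ?\<rho> = "\<rho>(10 := j)" let ?A = "ARGMIN 16 3 (IND (NV 16) (NV 14)) (DI (NV 10) (NA 5 (NV 16)))"
    have jn: "j < n" using j assms by (simp add: envD)
    have st: "ready \<tau>" using I by (simp add: I_def)
    have f5: "fst \<tau> 5 a = ancs \<delta> G i ! a" "fst \<tau> 5 a < n" if "a \<le> i" for a
      using I assms(5) that anc_ok_n[OF assms(5), of a] by (auto simp: I_def anc_ok_def)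
    have "snd (sem ?A ?\<rho> \<tau>) 10 0 = minval (\<lambda>a. a \<le> i) (\<lambda>a. d j (ancs \<delta> G i ! a)) (?\<rho> 3)"
    proof (rule ARGMIN_sem(3))
      fix a \<tau>' assume "same \<tau> \<tau>'"
      then show "evR (IND (NV 16) (NV 14)) (?\<rho>(16 := a)) \<tau>' = (if a \<le> i then 1 else 0)"
        using assms by simp
    next
      fix a \<tau>' assume a: "a \<le> i" and s: "same \<tau> \<tau>'"
      have "ready \<tau>'" "fst \<tau>' 5 = fst \<tau> 5" using ready_same[OF st s] sameD[OF s] by auto
      then show "evR (DI (NV 10) (NA 5 (NV 16))) (?\<rho>(16 := a)) \<tau>' = d j (ancs \<delta> G i ! a)"
        using jn f5[OF a] by (simp add: readyD)
    qed
    also have "?\<rho> 3 = L" using assms by (simp add: envD)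
    also have "minval (\<lambda>a. a \<le> i) (\<lambda>a. d j (ancs \<delta> G i ! a)) L = wt (ancs \<delta> G i) j"
    proof -
      have "{a. a < L \<and> a \<le> i} = {..<length (ancs \<delta> G i)}" using assms(4) L by auto
      moreover have "\<exists>a<L. a \<le> i" using L by (intro exI[of _ 0]) auto
      moreover have "(\<lambda>a. d j (ancs \<delta> G i ! a)) ` {..<length (ancs \<delta> G i)} = (\<lambda>a. d j a) ` set (ancs \<delta> G i)"
        unfolding set_conv_nth by auto
      ultimately show ?thesis by (simp only: minval_eq_Min wt_def)
    qed
    finally have m: "snd (sem ?A ?\<rho> \<tau>) 10 0 = wt (ancs \<delta> G i) j" .
    have "ready (sem ?A ?\<rho> \<tau>)" using st by (intro ready_sem) auto
    then show "I (Suc j) (sem (?A ;; RSt 2 (NV 10) (RIfN (NC 1) (NA 0 (NV 10)) (R0 10) (RC 0))) ?\<rho> \<tau>)"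
      using I m by (auto simp: I_def ready_def sem_frame less_Suc_eq)
  qed
  then show ?thesis using assms by (simp add: I_def envD)
qed

lemma INBALL_ev:
  assumes "env \<rho>" "ready \<tau>" "\<forall>j<n. snd \<tau> 2 j = (if j \<in> C then wt as j else 0)"
    and "evN f \<rho> \<tau> = f'" "evN x \<rho> \<tau> = x'" "f' < n" "x' < n"
    and "\<And>y. evN f (\<rho>(13 := y)) \<tau> = f'" "\<And>y. evN x (\<rho>(13 := y)) \<tau> = x'"
  shows "evR (INBALL r\<delta> f x) \<rho> \<tau> = (if inball \<delta> as f' x' then 1 else 0)"
proof -
  have 1: "(\<Sum>y<n. snd \<tau> 2 y) = (\<Sum>y\<in>C. wt as y)"
    unfolding sum_C[symmetric] using assms(3) by (intro sum.cong) auto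
  have 2: "(\<Sum>y<n. if snd \<tau> 0 (fst \<tau> 3 f' + x') \<le> snd \<tau> 0 (fst \<tau> 3 f' + y) then 0 else snd \<tau> 2 y)
      = (\<Sum>y\<in>C. if d f' x' \<le> d f' y then 0 else wt as y)"
    unfolding sum_C[symmetric] using assms(2,3,6,7) by (intro sum.cong) (auto simp: readyD)
  show ?thesis
    unfolding INBALL_def inball_def evR.simps evN.simps using assms 1 2 by (simp add: envD readyD r\<delta> not_le[symmetric])
qed

definition alive_ok :: "nat list \<Rightarrow> nat \<Rightarrow> mem \<Rightarrow> bool" where
  "alive_ok as m \<sigma> \<longleftrightarrow> (\<forall>f<n. fst \<sigma> 6 f = (if f \<in> alive \<delta> as m then 1 else 0))"

lemma HIT_sem:
  assumes "env \<rho>" "ready \<sigma>" "\<forall>j<n. snd \<sigma> 2 j = (if j \<in> C then wt as j else 0)" "alive_ok as m \<sigma>"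
  shows "alive_ok as (Suc m) (sem (HIT r\<delta>) \<rho> \<sigma>)" "fst (sem (HIT r\<delta>) \<rho> \<sigma>) 11 0 = pick \<delta> as m"
proof -
  let ?A = "ARGMIN 12 0 (IND (NC 1) (NA 0 (NV 12)))
       (RMi (RC 0) (RSum 11 0 (RIfN (NC 1) (NA 6 (NV 11)) (INBALL r\<delta> (NV 11) (NV 12)) (RC 0))))"
  let ?\<sigma> = "sem ?A \<rho> \<sigma>"
  have n: "\<rho> 0 = n" using assms by (simp add: envD)
  have "fst ?\<sigma> 11 0 = amin (\<lambda>x. x \<in> C) (\<lambda>x. - real (card {f \<in> alive \<delta> as m. inball \<delta> as f x})) (\<rho> 0)"
  proof (rule ARGMIN_sem(2))
    fix x \<tau> assume s: "same \<sigma> \<tau>"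
    have "ready \<tau>" using ready_same[OF assms(2) s] .
    then show "evR (IND (NC 1) (NA 0 (NV 12))) (\<rho>(12 := x)) \<tau> = (if x \<in> C then 1 else 0)"
      by (simp add: readyD)
  next
    fix x \<tau> assume x: "x < \<rho> 0" and s: "same \<sigma> \<tau>"
    have st: "ready \<tau>" using ready_same[OF assms(2) s] .
    have w: "\<forall>j<n. snd \<tau> 2 j = (if j \<in> C then wt as j else 0)" using assms(3) sameD[OF s] by simp
    have ib: "evR (INBALL r\<delta> (NV 11) (NV 12)) (\<rho>(12 := x, 11 := f)) \<tau> = (if inball \<delta> as f x then 1 else 0)"
      if "f < n" for f
      using that x n assms(1) by (intro INBALL_ev[OF _ st w]) auto
    have n': "(\<rho>(12 := x)) 0 = n" using n by simp
    have "(\<Sum>f<n. if 1 \<le> fst \<tau> 6 f then evR (INBALL r\<delta> (NV 11) (NV 12)) (\<rho>(12 := x, 11 := f)) \<tau> else 0)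
      = (\<Sum>f<n. if f \<in> {f \<in> alive \<delta> as m. inball \<delta> as f x} then 1 else 0)"
      using assms(4) ib sameD[OF s] by (intro sum.cong) (auto simp: alive_ok_def)
    also have "\<dots> = real (card ({..<n} \<inter> {f \<in> alive \<delta> as m. inball \<delta> as f x}))"
      by (subst sum.inter_restrict[symmetric]) auto
    also have "{..<n} \<inter> {f \<in> alive \<delta> as m. inball \<delta> as f x} = {f \<in> alive \<delta> as m. inball \<delta> as f x}"
      using alive_sub Fc_sub by blast
    finally show "evR (RMi (RC 0) (RSum 11 0 (RIfN (NC 1) (NA 6 (NV 11)) (INBALL r\<delta> (NV 11) (NV 12)) (RC 0))))
       (\<rho>(12 := x)) \<tau> = - real (card {f \<in> alive \<delta> as m. inball \<delta> as f x})"
      unfolding evR.simps evN.simps using n n' by (simp del: fun_upd_apply add: fun_upd_same)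
  qed
  then have h: "fst ?\<sigma> 11 0 = pick \<delta> as m" by (simp add: n pick_def hitpt_def)
  let ?F = "SFor 11 0 (SIfR (RC 1) (INBALL r\<delta> (NV 11) (N0 11)) (NSt 6 (NV 11) (NC 0)) SSkip)"
  have st: "ready ?\<sigma>" using assms(2) by (intro ready_sem) auto
  have w: "\<forall>j<n. snd ?\<sigma> 2 j = (if j \<in> C then wt as j else 0)" using assms(3) by (simp add: sem_frame)
  have al: "alive_ok as m ?\<sigma>" using assms(4) by (simp add: alive_ok_def sem_frame)
  define I where "I l \<tau> \<longleftrightarrow> ready \<tau> \<and> snd \<tau> = snd ?\<sigma> \<and> fst \<tau> 11 = fst ?\<sigma> 11 \<and>
    (\<forall>f<n. fst \<tau> 6 f = (if f \<in> alive \<delta> as (if f < l then Suc m else m) then 1 else 0))" for l and \<tau> :: mem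
  have "I (\<rho> 0) (sem ?F \<rho> ?\<sigma>)"
  proof (rule sem_For_inv)
    show "I 0 ?\<sigma>" using st al by (simp add: I_def alive_ok_def)
  next
    fix f \<tau> assume f: "f < \<rho> 0" and I: "I f \<tau>"
    have hn: "fst \<tau> 11 0 = pick \<delta> as m" "pick \<delta> as m < n" using I h hitpt_n by (auto simp: I_def pick_def)
    have ib: "evR (INBALL r\<delta> (NV 11) (N0 11)) (\<rho>(11 := f)) \<tau> = (if inball \<delta> as f (pick \<delta> as m) then 1 else 0)"
      by (rule INBALL_ev) (use I f n hn w assms(1) in \<open>auto simp: I_def\<close>)
    show "I (Suc f) (sem (SIfR (RC 1) (INBALL r\<delta> (NV 11) (N0 11)) (NSt 6 (NV 11) (NC 0)) SSkip) (\<rho>(11 := f)) \<tau>)"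
      using I ib by (auto simp: I_def ready_def less_Suc_eq pick_def)
  qed
  then show "alive_ok as (Suc m) (sem (HIT r\<delta>) \<rho> \<sigma>)" "fst (sem (HIT r\<delta>) \<rho> \<sigma>) 11 0 = pick \<delta> as m"
    using h unfolding HIT_def by (auto simp: I_def alive_ok_def n)
qed

lemma wr_HIT [simp]: "wrN (HIT r) = {10, 11, 6}" "wrR (HIT r) = {10}"
  by (auto simp: HIT_def)

lemma wr_WEIGHTS [simp]: "wrN WEIGHTS = {10, 11}" "wrR WEIGHTS = {10, 2}"
  by (auto simp: WEIGHTS_def)

lemma STAGE_sem:
  assumes "env \<rho>" "ready \<sigma>" "\<rho> 14 = i" "i < k" "anc_ok G i \<sigma>" "fst \<sigma> 4 = G" "G i < B"
  shows "anc_ok G (Suc i) (sem (STAGE r\<delta>) \<rho> \<sigma>)"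
proof -
  let ?as = "ancs \<delta> G i"
  define \<sigma>1 where "\<sigma>1 = sem WEIGHTS \<rho> \<sigma>"
  have 1: "ready \<sigma>1" "fst \<sigma>1 5 = fst \<sigma> 5" "fst \<sigma>1 4 = G"
    "\<forall>j<n. snd \<sigma>1 2 j = (if j \<in> C then wt ?as j else 0)"
    using assms WEIGHTS_sem[OF assms(1-5)] unfolding \<sigma>1_def by (auto intro: ready_sem simp: sem_frame)
  let ?F = "SFor 11 0 (NSt 6 (NV 11) (NA 1 (NV 11)))"
  define \<sigma>2 where "\<sigma>2 = sem ?F \<rho> \<sigma>1"
  have n: "\<rho> 0 = n" "\<rho> 2 = B" using assms by (auto simp: envD)
  have "\<forall>f<\<rho> 0. fst \<sigma>2 6 f = fst \<sigma>1 1 f"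
  proof -
    define I where "I l \<tau> \<longleftrightarrow> fst \<tau> 1 = fst \<sigma>1 1 \<and> (\<forall>f<l. fst \<tau> 6 f = fst \<sigma>1 1 f)" for l and \<tau> :: mem
    have "I (\<rho> 0) \<sigma>2" unfolding \<sigma>2_def
      by (rule sem_For_inv) (auto simp: I_def less_Suc_eq)
    then show ?thesis by (simp add: I_def)
  qed
  then have al: "alive_ok ?as 0 \<sigma>2" using 1(1) n by (simp add: alive_ok_def readyD)
  have 2: "ready \<sigma>2" "fst \<sigma>2 5 = fst \<sigma> 5" "fst \<sigma>2 4 = G"
    "\<forall>j<n. snd \<sigma>2 2 j = (if j \<in> C then wt ?as j else 0)"
    using 1 unfolding \<sigma>2_def by (auto intro: ready_sem simp: sem_frame)
  let ?H = "SFor 17 2 (SIfN (NV 17) (NA 4 (NV 14)) (HIT r\<delta>) SSkip)"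
  define \<sigma>3 where "\<sigma>3 = sem ?H \<rho> \<sigma>2"
  \<comment> \<open>Freezing is expressed by \<open>min\<close>: beyond step \<open>G i\<close>
    neither the remaining facilities nor the last point hit change.\<close>
  define I where "I l \<tau> \<longleftrightarrow> ready \<tau> \<and> fst \<tau> 5 = fst \<sigma> 5 \<and> fst \<tau> 4 = G \<and> snd \<tau> 2 = snd \<sigma>2 2 \<and>
    alive_ok ?as (min l (Suc (G i))) \<tau> \<and> (0 < l \<longrightarrow> fst \<tau> 11 0 = pick \<delta> ?as (min (l - 1) (G i)))" for l and \<tau> :: mem
  have "I (\<rho> 2) \<sigma>3" unfolding \<sigma>3_def
  proof (rule sem_For_inv)
    show "I 0 \<sigma>2" using 2 al by (simp add: I_def)
  next
    fix l \<tau> assume I: "I l \<tau>"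
    show "I (Suc l) (sem (SIfN (NV 17) (NA 4 (NV 14)) (HIT r\<delta>) SSkip) (\<rho>(17 := l)) \<tau>)"
    proof (cases "l \<le> G i")
      case True
      have a: "alive_ok ?as l \<tau>" using I True by (simp add: I_def min_def)
      have e: "env (\<rho>(17 := l))" using assms by simp
      have w: "\<forall>j<n. snd \<tau> 2 j = (if j \<in> C then wt ?as j else 0)" using 2 I by (simp add: I_def)
      have st: "ready \<tau>" using I by (simp add: I_def)
      have "ready (sem (HIT r\<delta>) (\<rho>(17 := l)) \<tau>)" using st by (intro ready_sem) auto
      then show ?thesis using HIT_sem[OF e st w a] I True assms(3)
        by (simp add: I_def sem_frame min_def)
    next
      case False
      then have "min (Suc l) (Suc (G i)) = min l (Suc (G i))" "min (Suc l - 1) (G i) = min (l - 1) (G i)" "0 < l"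
        by auto
      then show ?thesis using I assms(3) False unfolding I_def by simp
    qed
  qed
  then have "I B \<sigma>3" by (simp only: n(2))
  then have "fst \<sigma>3 5 = fst \<sigma> 5" "fst \<sigma>3 11 0 = pick \<delta> ?as (min (B - 1) (G i))"
    using assms(7) unfolding I_def by auto
  moreover have "min (B - 1) (G i) = G i" using assms(7) by simp
  ultimately have 3: "fst \<sigma>3 5 = fst \<sigma> 5" "fst \<sigma>3 11 0 = pick \<delta> ?as (G i)" by simp_all
  have "sem (STAGE r\<delta>) \<rho> \<sigma> = sem (NSt 5 (SUCC (NV 14)) (N0 11)) \<rho> \<sigma>3"
    unfolding STAGE_def \<sigma>3_def \<sigma>2_def \<sigma>1_def sem.simps(4) ..
  then show ?thesis using 3 assms(3,5) by (auto simp: anc_ok_def nth_append le_Suc_eq)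
qed

lemma wr_STAGE [simp]: "wrN (STAGE r) = {5, 6, 10, 11}" "wrR (STAGE r) = {2, 10}"
  by (auto simp: STAGE_def)

lemma ANCHORS_sem:
  assumes "env \<rho>" "ready \<sigma>" "fst \<sigma> 4 = G" "\<And>i. i < k \<Longrightarrow> G i < B"
  shows "anc_ok G k (sem (ANCHORS r\<delta>) \<rho> \<sigma>)"
proof -
  define I where "I i \<tau> \<longleftrightarrow> ready \<tau> \<and> fst \<tau> 4 = G \<and> anc_ok G i \<tau>" for i and \<tau> :: mem
  have "I (\<rho> 1) (sem (ANCHORS r\<delta>) \<rho> \<sigma>)" unfolding ANCHORS_def sem.simps(4)
  proof (rule sem_For_inv)
    show "I 0 (sem (NSt 5 (NC 0) (NC 0)) \<rho> \<sigma>)" using assms by (simp add: I_def anc_ok_def ready_def)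
  next
    fix i \<tau> assume i: "i < \<rho> 1" and I: "I i \<tau>"
    have "anc_ok G (Suc i) (sem (STAGE r\<delta>) (\<rho>(14 := i)) \<tau>)"
      using i I assms by (intro STAGE_sem) (auto simp: I_def envD)
    moreover have "ready (sem (STAGE r\<delta>) (\<rho>(14 := i)) \<tau>)" using I by (intro ready_sem) (auto simp: I_def)
    ultimately show "I (Suc i) (sem (STAGE r\<delta>) (\<rho>(14 := i)) \<tau>)" using I by (simp add: I_def sem_frame)
  qed
  then show ?thesis using assms by (simp add: I_def envD)
qed

end

section \<open>The greedy rounds and their exact cost distributions\<close>

abbreviation "AI \<equiv> NA 5 (NA 4 (NPl (NV 1) (NV 14)))"
abbreviation "RI \<equiv> RMu (DI (NV 18) (NV 19)) (RA 3 (NA 4 (NPl (NV 1) (NPl (NV 1) (NV 14)))))"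
abbreviation "ATOM \<equiv> NPl (NA 3 (NV 16)) (NV 10)"
abbreviation "NEW \<equiv> NPl (NA 3 (SUCC (N0 8))) (NV 10)"

definition DUMMIES :: stm where
  "DUMMIES = SFor 10 0 (ARGMIN 14 1 (IND (SUCC (NV 14)) (NA 4 K3)) (RPl (DI (NV 10) AI) RI) ;;
     RSt 4 (NV 10) (R0 10) ;; RSt 5 (NV 10) (RC 1))"

definition GINIT :: "rat \<Rightarrow> stm" where
  "GINIT rb = NSt 8 (NC 0) (NC 0) ;; SFor 11 0 (NSt 7 (NV 11) (NC 0)) ;; RSt 6 (NC 0) (RC 1) ;;
     SFor 15 5 (SIfN (SUCC (NV 15)) (NA 4 (SUCC K3)) (RSt 6 (NC 0) (RMu (R0 6) (RC rb))) SSkip)"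

definition SELECT :: stm where
  "SELECT = ARGMIN 11 0 (RIfN (NC 1) (NA 1 (NV 11)) (RIfR (DI (NV 11) AI) RI (RC 1) (RC 0)) (RC 0))
     (RMi (RA 1 (NV 11)) (RMu (R0 6) (RSum 10 0 (RIfN (NC 1) (NA 0 (NV 10))
       (RSum 16 3 (RIfN (NV 16) (N0 8) (RMu (RA 5 ATOM)
         (RIfR (RA 4 ATOM) (DI (NV 10) (NV 11)) (RC 0) (RMi (RA 4 ATOM) (DI (NV 10) (NV 11))))) (RC 0)))
       (RC 0)))))"

text \<open>With probability p the value V of an atom drops to the minimum of V and the new
  distance. So the fraction p of the mass of all atoms above that distance moves to one new atom,
  and the rest is scaled by 1 - p; the moved mass is summed up before the scaling destroys
  it.\<close>

definition COLUMN :: "rat \<Rightarrow> stm" where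
  "COLUMN rp = RSt 5 NEW (RMu (RC rp) (RSum 16 3 (RIfN (NV 16) (N0 8)
       (RIfR (RA 4 ATOM) (DI (NV 10) (N0 11)) (RC 0) (RA 5 ATOM)) (RC 0)))) ;;
     RSt 4 NEW (DI (NV 10) (N0 11)) ;;
     SFor 16 3 (SIfN (NV 16) (N0 8) (SIfR (RA 4 ATOM) (DI (NV 10) (N0 11)) SSkip
       (RSt 5 ATOM (RMu (RC (1 - rp)) (RA 5 ATOM)))) SSkip)"

text \<open>The length in array 8 has already been incremented, so \<open>3 * k + 1\<close> plus it
  is the digit \<open>3 * k + 2 + l\<close> of the entry \<open>l\<close> just added.\<close>

definition CHOOSE :: stm where
  "CHOOSE = SIfN (NC 1) (NA 4 (NPl (SUCC K3) (N0 8)))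
     (SIfN (NC 1) (NA 1 (N0 11)) (NSt 7 (N0 11) (NC 1)) SSkip) SSkip"

definition ADD :: "rat \<Rightarrow> stm" where
  "ADD rp = SELECT ;; SFor 10 0 (COLUMN rp) ;; NSt 8 (NC 0) (SUCC (N0 8)) ;; CHOOSE"

definition ROUND :: "rat \<Rightarrow> rat \<Rightarrow> stm" where
  "ROUND rp rb = SFor 14 1 (SIfN (SUCC (NV 14)) (NA 4 K3) (ADD rp) SSkip) ;; RSt 6 (NC 0) (RDi (R0 6) (RC rb))"

definition GREEDY :: "rat \<Rightarrow> rat \<Rightarrow> stm" where
  "GREEDY rp rb = SFor 15 5 (SIfN (SUCC (NV 15)) (NA 4 (SUCC K3)) (ROUND rp rb) SSkip)"

lemma wr_simps [simp]:
  "wrN DUMMIES = {10, 11}" "wrR DUMMIES = {4, 5, 10}"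
  "wrN (GINIT rb) = {7, 8}" "wrR (GINIT rb) = {6}"
  "wrN SELECT = {10, 11}" "wrR SELECT = {10}"
  "wrN (COLUMN rp) = {}" "wrR (COLUMN rp) = {4, 5}"
  "wrN CHOOSE = {7}" "wrR CHOOSE = {}"
  "wrN (ADD rp) = {7, 8, 10, 11}" "wrR (ADD rp) = {4, 5, 10}"
  "wrN (ROUND rp rb) = {7, 8, 10, 11}" "wrR (ROUND rp rb) = {4, 5, 6, 10}"
  "wrN (GREEDY rp rb) = {7, 8, 10, 11}" "wrR (GREEDY rp rb) = {4, 5, 6, 10}"
  by (auto simp: DUMMIES_def GINIT_def SELECT_def COLUMN_def CHOOSE_def ADD_def ROUND_def GREEDY_def)

lemma index_eq:
  fixes j j' n :: nat assumes "j < n" "j' < n"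
  shows "a * n + j = a' * n + j' \<longleftrightarrow> a = a' \<and> j = j'"
proof
  assume eq: "a * n + j = a' * n + j'"
  have "j = (a * n + j) mod n" using assms by simp
  also have "\<dots> = j'" unfolding eq using assms by simp
  finally have "j = j'" .
  then show "a = a' \<and> j = j'" using eq assms by auto
qed auto

lemma sum_upto: "m < L \<Longrightarrow> (\<Sum>a<L. if a \<le> m then g a else 0) = (\<Sum>a\<le>m. g a)" for g :: "nat \<Rightarrow> real"
proof -
  assume "m < L"
  then have "{..<L} \<inter> {..m} = {..m}" by auto
  moreover have "(\<Sum>a<L. if a \<in> {..m} then g a else 0) = sum g ({..<L} \<inter> {..m})"
    by (subst sum.inter_restrict) auto
  ultimately show ?thesis by simp
qed

locale fl_body = fl_prog +
  fixes rb :: rat and G :: "nat \<Rightarrow> nat" and v v' :: nat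
  assumes rb: "real_of_rat rb = 1 / (1 + p)"
    and G_less: "\<And>l. l < L \<Longrightarrow> G l < B" and G_anch: "\<And>i. i < k \<Longrightarrow> G (k + i) \<le> k"
    and v: "v < n" "v' < n"
begin

definition envv :: "(nat \<Rightarrow> nat) \<Rightarrow> bool" where
  "envv \<rho> \<longleftrightarrow> env \<rho> \<and> \<rho> 18 = v \<and> \<rho> 19 = v'"

lemma envv_upd [simp]: "10 \<le> x \<Longrightarrow> x \<noteq> 18 \<Longrightarrow> x \<noteq> 19 \<Longrightarrow> envv (\<rho>(x := i)) = envv \<rho>"
  by (auto simp: envv_def)

lemma envvD: "envv \<rho> \<Longrightarrow> \<rho> 0 = n" "envv \<rho> \<Longrightarrow> \<rho> (Suc 0) = k" "envv \<rho> \<Longrightarrow> \<rho> 1 = k"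
  "envv \<rho> \<Longrightarrow> \<rho> 3 = L" "envv \<rho> \<Longrightarrow> \<rho> 5 = M0" "envv \<rho> \<Longrightarrow> \<rho> 18 = v" "envv \<rho> \<Longrightarrow> \<rho> 19 = v'"
  by (auto simp: env_def envv_def)

definition anchored :: "mem \<Rightarrow> bool" where
  "anchored \<sigma> \<longleftrightarrow> ready \<sigma> \<and> fst \<sigma> 4 = G \<and> anc_ok G k \<sigma>"

lemma anchored_sem:
  assumes "anchored \<sigma>" "wrN c \<inter> {0, 1, 3, 4, 5} = {}" "wrR c \<inter> {0, 1, 3} = {}"
  shows "anchored (sem c \<rho> \<sigma>)"
proof -
  have "ready (sem c \<rho> \<sigma>)" using assms by (intro ready_sem) (auto simp: anchored_def)
  moreover have "fst (sem c \<rho> \<sigma>) 4 = fst \<sigma> 4" "fst (sem c \<rho> \<sigma>) 5 = fst \<sigma> 5"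
    using assms by (auto intro!: sem_frame)
  ultimately show ?thesis using assms by (simp add: anchored_def anc_ok_def)
qed

lemma anchored_same: "anchored \<sigma> \<Longrightarrow> same \<sigma> \<tau> \<Longrightarrow> anchored \<tau>"
  using sameD(1)[of \<sigma> \<tau> 4] sameD(1)[of \<sigma> \<tau> 5] ready_same[of \<sigma> \<tau>] by (simp add: anchored_def anc_ok_def)

lemma AI_ev:
  assumes "anchored \<tau>" "i < k"
  shows "fst \<tau> 5 (fst \<tau> 4 (k + i)) = anch G i" "anch G i < n"
proof -
  have "G (k + i) \<le> k" using G_anch assms by blast
  then show "fst \<tau> 5 (fst \<tau> 4 (k + i)) = anch G i" "anch G i < n"
    using assms anc_ok_n[of G k \<tau> "G (k + i)"] by (auto simp: anchored_def anc_ok_def anch_def)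
qed

lemma RI_ev:
  assumes "anchored \<tau>" "i < k"
  shows "snd \<tau> 0 (fst \<tau> 3 v + v') * snd \<tau> 3 (fst \<tau> 4 (k + (k + i))) = rad G v v' i"
proof -
  have "G (2 * k + i) < B" using assms L by (intro G_less) auto
  moreover have "fst \<tau> 4 (k + (k + i)) = G (2 * k + i)" using assms by (simp add: anchored_def mult_2 add.assoc)
  ultimately show ?thesis using assms v by (simp add: anchored_def rad_def readyD)
qed

lemma K3: "k + (k + k) = 3 * k" by simp

lemma classes_iff: "i < k \<Longrightarrow> Suc i \<le> G (3 * k) \<longleftrightarrow> i < classes G"
  by (auto simp: classes_def)

lemma rounds_iff: "t < M0 \<Longrightarrow> Suc t \<le> G (Suc (3 * k)) \<longleftrightarrow> t < rounds G"
  by (auto simp: rounds_def)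

text \<open>The minimum takes at most \<open>length S + 1\<close> values, so its distribution can be
  stored exactly. Quantifying over \<open>\<phi>\<close> makes the table yield every gain, and fits
  the recursion \<open>exp_min_snoc\<close>, which changes \<open>\<phi>\<close>.\<close>

definition atoms :: "nat list \<Rightarrow> mem \<Rightarrow> nat \<Rightarrow> bool" where
  "atoms S \<sigma> j \<longleftrightarrow> (\<forall>\<phi>. (\<Sum>a\<le>length S. snd \<sigma> 5 (a * n + j) * \<phi> (snd \<sigma> 4 (a * n + j))) =
     exp_min p \<phi> (dummy G v v' j) (\<lambda>l. d j (S ! l)) {..<length S})"

lemma atoms_cong:
  assumes "\<And>a. snd \<sigma>' 4 (a * n + j) = snd \<sigma> 4 (a * n + j) \<and> snd \<sigma>' 5 (a * n + j) = snd \<sigma> 5 (a * n + j)"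
    and "atoms S \<sigma> j"
  shows "atoms S \<sigma>' j"
  using assms(2) unfolding atoms_def assms(1)[THEN conjunct1] assms(1)[THEN conjunct2] .

lemma DUMMIES_sem:
  assumes "envv \<rho>" "anchored \<sigma>"
  shows "\<forall>j<n. atoms [] (sem DUMMIES \<rho> \<sigma>) j"
proof -
  define I where "I l \<tau> \<longleftrightarrow> anchored \<tau> \<and> (\<forall>j<l. snd \<tau> 4 j = dummy G v v' j \<and> snd \<tau> 5 j = 1)"
    for l and \<tau> :: mem
  have "I (\<rho> 0) (sem DUMMIES \<rho> \<sigma>)" unfolding DUMMIES_def
  proof (rule sem_For_inv)
    show "I 0 \<sigma>" using assms by (simp add: I_def)
  next
    fix j \<tau> assume j: "j < \<rho> 0" and I: "I j \<tau>"
    let ?\<rho> = "\<rho>(10 := j)"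
    let ?A = "ARGMIN 14 1 (IND (SUCC (NV 14)) (NA 4 K3)) (RPl (DI (NV 10) AI) RI)"
    have jn: "j < n" using j assms by (simp add: envvD)
    have an: "anchored \<tau>" using I by (simp add: I_def)
    have r1: "?\<rho> 1 = k" using assms by (simp add: envvD)
    have "snd (sem ?A ?\<rho> \<tau>) 10 0 = minval (\<lambda>i. i < classes G) (\<lambda>i. d j (anch G i) + rad G v v' i) (?\<rho> 1)"
    proof (rule ARGMIN_sem(3))
      fix i \<tau>' assume i: "i < ?\<rho> 1" and s: "same \<tau> \<tau>'"
      have "fst \<tau>' 4 = G" using anchored_same[OF an s] by (simp add: anchored_def)
      then show "evR (IND (SUCC (NV 14)) (NA 4 K3)) (?\<rho>(14 := i)) \<tau>' = (if i < classes G then 1 else 0)"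
        using i assms classes_iff[of i] by (simp add: envvD K3)
    next
      fix i \<tau>' assume i: "i < ?\<rho> 1" and s: "same \<tau> \<tau>'"
      have an': "anchored \<tau>'" using anchored_same[OF an s] .
      have ik: "i < k" using i r1 by simp
      have "ready \<tau>'" using an' by (simp add: anchored_def)
      then show "evR (RPl (DI (NV 10) AI) RI) (?\<rho>(14 := i)) \<tau>' = d j (anch G i) + rad G v v' i"
        using AI_ev[OF an' ik] RI_ev[OF an' ik] jn assms(1) by (simp add: envvD readyD)
    qed
    then have m: "snd (sem ?A ?\<rho> \<tau>) 10 0 = dummy G v v' j" by (simp add: r1[simplified] dummy_def)
    have "anchored (sem (?A ;; RSt 4 (NV 10) (R0 10) ;; RSt 5 (NV 10) (RC 1)) ?\<rho> \<tau>)"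
      using an by (intro anchored_sem) auto
    then show "I (Suc j) (sem (?A ;; RSt 4 (NV 10) (R0 10) ;; RSt 5 (NV 10) (RC 1)) ?\<rho> \<tau>)"
      using I m by (auto simp: I_def sem_frame less_Suc_eq)
  qed
  then show ?thesis using assms by (simp add: I_def envvD atoms_def)
qed

definition sub :: "nat list \<Rightarrow> nat set" where
  "sub S = {s. \<exists>l<length S. s = S ! l \<and> 1 \<le> G (3 * k + 2 + l) \<and> s \<in> Fc}"

definition state :: "nat list \<Rightarrow> mem \<Rightarrow> bool" where
  "state S \<sigma> \<longleftrightarrow> anchored \<sigma> \<and> fst \<sigma> 8 0 = length S \<and> (\<forall>j<n. atoms S \<sigma> j) \<and>
     (\<forall>f<n. fst \<sigma> 7 f \<noteq> 0 \<longleftrightarrow> f \<in> sub S)"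

lemma GINIT_sem:
  assumes "envv \<rho>" "anchored \<sigma>" "\<forall>j<n. atoms [] \<sigma> j"
  shows "state [] (sem (GINIT rb) \<rho> \<sigma>)" "snd (sem (GINIT rb) \<rho> \<sigma>) 6 0 = (1 / (1 + p)) ^ rounds G"
proof -
  define \<sigma>1 where "\<sigma>1 = sem (NSt 8 (NC 0) (NC 0)) \<rho> \<sigma>"
  define \<sigma>2 where "\<sigma>2 = sem (SFor 11 0 (NSt 7 (NV 11) (NC 0))) \<rho> \<sigma>1"
  define \<sigma>3 where "\<sigma>3 = sem (RSt 6 (NC 0) (RC 1)) \<rho> \<sigma>2"
  define I where "I l \<tau> \<longleftrightarrow> (\<forall>f<l. fst \<tau> 7 f = 0)" for l :: nat and \<tau> :: mem
  have "I (\<rho> 0) \<sigma>2" unfolding \<sigma>2_def by (rule sem_For_inv) (auto simp: I_def less_Suc_eq)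
  then have 7: "\<forall>f<n. fst \<sigma>2 7 f = 0" using assms by (simp add: I_def envvD)
  have 8: "fst \<sigma>2 8 0 = 0" unfolding \<sigma>2_def \<sigma>1_def by (simp add: sem_frame)
  let ?F = "SFor 15 5 (SIfN (SUCC (NV 15)) (NA 4 (SUCC K3)) (RSt 6 (NC 0) (RMu (R0 6) (RC rb))) SSkip)"
  have G: "sem (GINIT rb) \<rho> \<sigma> = sem ?F \<rho> \<sigma>3"
    unfolding GINIT_def \<sigma>3_def \<sigma>2_def \<sigma>1_def sem.simps(4) ..
  have an: "anchored (sem (GINIT rb) \<rho> \<sigma>)" using assms by (intro anchored_sem) auto
  have "fst (sem ?F \<rho> \<sigma>3) 7 = fst \<sigma>2 7" "fst (sem ?F \<rho> \<sigma>3) 8 = fst \<sigma>2 8" "fst \<sigma>3 4 = fst \<sigma> 4"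
    unfolding \<sigma>3_def \<sigma>2_def \<sigma>1_def by (auto simp: sem_frame)
  moreover have "\<forall>j<n. atoms [] (sem (GINIT rb) \<rho> \<sigma>) j" using assms(3) by (simp add: atoms_def sem_frame)
  ultimately show "state [] (sem (GINIT rb) \<rho> \<sigma>)"
    using an 7 8 unfolding G by (simp add: state_def sub_def)
  define J where "J l \<tau> \<longleftrightarrow> fst \<tau> 4 = G \<and> snd \<tau> 6 0 = (1 / (1 + p)) ^ min l (G (3 * k + 1))"
    for l and \<tau> :: mem
  have "J (\<rho> 5) (sem ?F \<rho> \<sigma>3)"
  proof (rule sem_For_inv)
    show "J 0 \<sigma>3" using \<open>fst \<sigma>3 4 = fst \<sigma> 4\<close> assms(2) by (simp add: J_def \<sigma>3_def anchored_def)
  next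
    fix t \<tau> assume J: "J t \<tau>"
    have cond: "evN (SUCC (NV 15)) (\<rho>(15 := t)) \<tau> \<le> evN (NA 4 (SUCC K3)) (\<rho>(15 := t)) \<tau> \<longleftrightarrow> t < G (3 * k + 1)"
      using J assms(1) by (simp add: J_def envvD K3 Suc_le_eq)
    show "J (Suc t) (sem (SIfN (SUCC (NV 15)) (NA 4 (SUCC K3)) (RSt 6 (NC 0) (RMu (R0 6) (RC rb))) SSkip)
        (\<rho>(15 := t)) \<tau>)"
    proof (cases "t < G (3 * k + 1)")
      case True
      then have "min t (G (3 * k + 1)) = t" "min (Suc t) (G (3 * k + 1)) = Suc t" by auto
      then show ?thesis using J True rb unfolding J_def sem.simps(5) cond by simp
    next
      case False
      then have "min t (G (3 * k + 1)) = G (3 * k + 1)" "min (Suc t) (G (3 * k + 1)) = G (3 * k + 1)" by auto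
      then show ?thesis using J False unfolding J_def sem.simps(5) cond by simp
    qed
  qed
  then show "snd (sem (GINIT rb) \<rho> \<sigma>) 6 0 = (1 / (1 + p)) ^ rounds G"
    unfolding G using assms(1) by (simp add: J_def envvD rounds_def)
qed

interpretation fg: fractional_greedy C d p "dummy G v v'"
  using finite_CF p by unfold_locales auto

lemma SELECT_sem:
  assumes "envv \<rho>" "state S \<sigma>" "\<rho> 14 = i" "i < k" "length S < L"
  shows "fst (sem SELECT \<rho> \<sigma>) 11 0 = sel G v v' i (snd \<sigma> 6 0) S"
proof -
  let ?c = "snd \<sigma> 6 0"
  have r0: "\<rho> 0 = n" using assms by (simp add: envvD)
  have "fst (sem SELECT \<rho> \<sigma>) 11 0 = amin (\<lambda>f. f \<in> Fc \<and> d f (anch G i) \<le> rad G v v' i)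
     (\<lambda>f. cost f - ?c * fg.gain S f) (\<rho> 0)"
    unfolding SELECT_def
  proof (rule ARGMIN_sem(2))
    fix f \<tau> assume f: "f < \<rho> 0" and s: "same \<sigma> \<tau>"
    have an: "anchored \<tau>" using anchored_same[OF _ s] assms(2) by (simp add: state_def)
    then have rd: "ready \<tau>" by (simp add: anchored_def)
    show "evR (RIfN (NC 1) (NA 1 (NV 11)) (RIfR (DI (NV 11) AI) RI (RC 1) (RC 0)) (RC 0)) (\<rho>(11 := f)) \<tau> =
      (if f \<in> Fc \<and> d f (anch G i) \<le> rad G v v' i then 1 else 0)"
      using AI_ev[OF an assms(4)] RI_ev[OF an assms(4)] rd f assms(1,3) r0 by (simp add: envvD readyD)
  next
    fix f \<tau> assume f: "f < \<rho> 0" and P: "f \<in> Fc \<and> d f (anch G i) \<le> rad G v v' i" and s: "same \<sigma> \<tau>"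
    have rd: "ready \<tau>" using ready_same[OF _ s] assms(2) by (simp add: state_def anchored_def)
    have eqs: "fst \<tau> 8 = fst \<sigma> 8" "snd \<tau> 4 = snd \<sigma> 4" "snd \<tau> 5 = snd \<sigma> 5" "snd \<tau> 6 = snd \<sigma> 6"
      using sameD[OF s] by auto
    have len: "fst \<sigma> 8 0 = length S" using assms(2) by (simp add: state_def)
    let ?h = "\<lambda>j a. snd \<tau> 5 (a * n + j) * (if snd \<tau> 4 (a * n + j) \<le> d j f then 0 else snd \<tau> 4 (a * n + j) - d j f)"
    have "(\<Sum>j<n. if j \<in> C then \<Sum>a<L. if a \<le> length S then ?h j a else 0 else 0)
      = (\<Sum>j\<in>C. \<Sum>a\<le>length S. ?h j a)"
      unfolding sum_C sum_upto[OF assms(5)] ..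
    also have "\<dots> = fg.gain S f" unfolding fg.gain_def
    proof (intro sum.cong refl)
      fix j assume "j \<in> C"
      then have "atoms S \<sigma> j" using assms(2) C_sub by (auto simp: state_def)
      then have "(\<Sum>a\<le>length S. snd \<sigma> 5 (a * n + j) * max 0 (snd \<sigma> 4 (a * n + j) - d j f)) =
        exp_min p (\<lambda>y. max 0 (y - d j f)) (dummy G v v' j) (\<lambda>l. d j (S ! l)) {..<length S}"
        unfolding atoms_def by (rule allE) 
      moreover have "(\<Sum>a\<le>length S. ?h j a) = (\<Sum>a\<le>length S. snd \<sigma> 5 (a * n + j) * max 0 (snd \<sigma> 4 (a * n + j) - d j f))"
        unfolding eqs by (intro sum.cong refl arg_cong2[where f = "(*)"]) auto
      ultimately show "(\<Sum>a\<le>length S. ?h j a) =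
        exp_min p (\<lambda>y. max 0 (y - d j f)) (dummy G v v' j) (\<lambda>l. d j (S ! l)) {..<length S}" by simp
    qed
    finally have g: "(\<Sum>j<n. if j \<in> C then \<Sum>a<L. if a \<le> length S then ?h j a else 0 else 0) = fg.gain S f" .
    let ?e = "RSum 10 0 (RIfN (NC 1) (NA 0 (NV 10))
       (RSum 16 3 (RIfN (NV 16) (N0 8) (RMu (RA 5 ATOM)
         (RIfR (RA 4 ATOM) (DI (NV 10) (NV 11)) (RC 0) (RMi (RA 4 ATOM) (DI (NV 10) (NV 11))))) (RC 0))) (RC 0))"
    have "evR ?e (\<rho>(11 := f)) \<tau> = (\<Sum>j<n. if j \<in> C then \<Sum>a<L. if a \<le> length S then ?h j a else 0 else 0)"
      using assms(1) rd f r0 eqs len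
      by (simp add: envvD, intro sum.cong refl) (auto simp: readyD envvD intro!: sum.cong)
    then show "evR (RMi (RA 1 (NV 11)) (RMu (R0 6) ?e)) (\<rho>(11 := f)) \<tau> = cost f - ?c * fg.gain S f"
      using g P rd eqs by (simp add: readyD)
  qed
  then show ?thesis by (simp add: sel_def r0)
qed

lemma COLUMN_sem:
  assumes "envv \<rho>" "ready \<sigma>" "\<rho> 10 = j" "j < n" "fst \<sigma> 8 0 = m" "Suc m < L" "fst \<sigma> 11 0 = s" "s < n"
  defines "V \<equiv> \<lambda>a. snd \<sigma> 4 (a * n + j)" and "P \<equiv> \<lambda>a. snd \<sigma> 5 (a * n + j)"
    and "\<sigma>' \<equiv> sem (COLUMN rp) \<rho> \<sigma>"
  shows "\<And>a. a \<le> m \<Longrightarrow> snd \<sigma>' 4 (a * n + j) = V a" "snd \<sigma>' 4 (Suc m * n + j) = d j s"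
    "\<And>a. a \<le> m \<Longrightarrow> snd \<sigma>' 5 (a * n + j) = (if V a \<le> d j s then P a else (1 - p) * P a)"
    "snd \<sigma>' 5 (Suc m * n + j) = p * (\<Sum>a\<le>m. if V a \<le> d j s then 0 else P a)"
    "\<And>a j'. j' < n \<Longrightarrow> j' \<noteq> j \<Longrightarrow> snd \<sigma>' 4 (a * n + j') = snd \<sigma> 4 (a * n + j') \<and>
       snd \<sigma>' 5 (a * n + j') = snd \<sigma> 5 (a * n + j')"
proof -
  let ?i = "Suc m * n + j"
  let ?c1 = "RSt 5 NEW (RMu (RC rp) (RSum 16 3 (RIfN (NV 16) (N0 8)
       (RIfR (RA 4 ATOM) (DI (NV 10) (N0 11)) (RC 0) (RA 5 ATOM)) (RC 0))))"
  let ?c2 = "RSt 4 NEW (DI (NV 10) (N0 11))"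
  let ?b = "SIfN (NV 16) (N0 8) (SIfR (RA 4 ATOM) (DI (NV 10) (N0 11)) SSkip
       (RSt 5 ATOM (RMu (RC (1 - rp)) (RA 5 ATOM)))) SSkip"
  have L3: "\<rho> 3 = L" using assms(1) by (simp add: envvD)
  define \<sigma>1 where "\<sigma>1 = sem ?c1 \<rho> \<sigma>"
  define \<sigma>2 where "\<sigma>2 = sem ?c2 \<rho> \<sigma>1"
  have new: "evN NEW \<rho> \<sigma> = ?i" using assms by (simp add: readyD)
  have mass: "evR (RSum 16 3 (RIfN (NV 16) (N0 8)
       (RIfR (RA 4 ATOM) (DI (NV 10) (N0 11)) (RC 0) (RA 5 ATOM)) (RC 0))) \<rho> \<sigma>
     = (\<Sum>a\<le>m. if V a \<le> d j s then 0 else P a)"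
    unfolding sum_upto[symmetric, of m L, OF Suc_lessD[OF assms(6)]]
    using assms(2-8) L3 by (simp, intro sum.cong refl) (auto simp: readyD V_def P_def)
  have 1: "fst \<sigma>1 = fst \<sigma>" "snd \<sigma>1 = (snd \<sigma>)(5 := (snd \<sigma> 5)(?i := p * (\<Sum>a\<le>m. if V a \<le> d j s then 0 else P a)))"
    unfolding \<sigma>1_def sem.simps(3) new using mass rp by (simp_all del: evR.simps(6))
  have rd1: "ready \<sigma>1" using assms(2) unfolding \<sigma>1_def by (intro ready_sem) auto
  have 2: "fst \<sigma>2 = fst \<sigma>" "snd \<sigma>2 4 = (snd \<sigma> 4)(?i := d j s)" "snd \<sigma>2 5 = snd \<sigma>1 5"
    unfolding \<sigma>2_def using assms rd1 1 by (simp_all add: readyD)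
  have rd2: "ready \<sigma>2" using rd1 unfolding \<sigma>2_def by (intro ready_sem) auto
  have e: "\<sigma>' = sem (SFor 16 3 ?b) \<rho> \<sigma>2"
    unfolding \<sigma>'_def COLUMN_def \<sigma>2_def \<sigma>1_def sem.simps(4) ..
  \<comment> \<open>The invariant describes all columns at once; by \<open>index_eq\<close> neither
    other clients nor the new layer \<open>Suc m\<close> are touched by the scaling.\<close>
  define I where "I l \<tau> \<longleftrightarrow> ready \<tau> \<and> fst \<tau> = fst \<sigma> \<and> snd \<tau> 4 = snd \<sigma>2 4 \<and>
    (\<forall>a j'. j' < n \<longrightarrow> snd \<tau> 5 (a * n + j') =
      (if j' = j \<and> a < l \<and> a \<le> m \<and> \<not> V a \<le> d j s then (1 - p) * P a else snd \<sigma>2 5 (a * n + j')))" for l and \<tau> :: mem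
  have sV: "snd \<sigma>2 4 (a * n + j) = V a" "snd \<sigma>2 5 (a * n + j) = P a" if "a \<le> m" for a
    using that index_eq[OF assms(4,4), of a "Suc m"] by (auto simp: 1 2 V_def P_def)
  have "I (\<rho> 3) \<sigma>'" unfolding e
  proof (rule sem_For_inv)
    show "I 0 \<sigma>2" using rd2 2 by (simp add: I_def)
  next
    fix a \<tau> assume a: "a < \<rho> 3" and I: "I a \<tau>"
    have rd: "ready \<tau>" using I by (simp add: I_def)
    have at: "evN ATOM (\<rho>(16 := a)) \<tau> = a * n + j" using a L3 rd assms(3) by (simp add: readyD)
    have dd: "evR (DI (NV 10) (N0 11)) (\<rho>(16 := a)) \<tau> = d j s"
      using I rd assms(2-4,7,8) by (simp add: I_def readyD)
    have P: "snd \<tau> 5 (a * n + j) = snd \<sigma>2 5 (a * n + j)" using I assms(4) by (auto simp: I_def)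
    have V: "snd \<tau> 4 (a * n + j) = snd \<sigma>2 4 (a * n + j)" using I by (auto simp: I_def)
    show "I (Suc a) (sem ?b (\<rho>(16 := a)) \<tau>)"
    proof (cases "a \<le> m \<and> \<not> V a \<le> d j s")
      case False
      have "sem ?b (\<rho>(16 := a)) \<tau> = \<tau>"
        using False I sV V at dd assms(5) by (auto simp: I_def simp del: evN.simps(4))
      moreover have "(b < Suc a \<and> b \<le> m \<and> \<not> V b \<le> d j s) = (b < a \<and> b \<le> m \<and> \<not> V b \<le> d j s)" for b
        using False by (auto simp: less_Suc_eq)
      ultimately show ?thesis using I by (simp add: I_def)
    next
      case True
      have u: "sem ?b (\<rho>(16 := a)) \<tau> = (fst \<tau>, (snd \<tau>)(5 := (snd \<tau> 5)(a * n + j := (1 - p) * P a)))"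
        using True I sV V P at dd assms(5) rp by (auto simp: I_def of_rat_diff simp del: evN.simps(4))
      have "ready (sem ?b (\<rho>(16 := a)) \<tau>)" using rd by (intro ready_sem) auto
      then show ?thesis using I True unfolding u
        by (auto simp: I_def less_Suc_eq index_eq assms(4))
    qed
  qed
  then have I: "I L \<sigma>'" by (simp only: L3)
  show "snd \<sigma>' 4 (a * n + j) = V a" if "a \<le> m" for a using I sV[OF that] by (simp add: I_def)
  show "snd \<sigma>' 4 (Suc m * n + j) = d j s" using I 2 by (simp add: I_def)
  show "snd \<sigma>' 5 (a * n + j) = (if V a \<le> d j s then P a else (1 - p) * P a)" if "a \<le> m" for a
    using I sV[OF that] that assms(4,6) by (auto simp: I_def)
  show "snd \<sigma>' 5 (Suc m * n + j) = p * (\<Sum>a\<le>m. if V a \<le> d j s then 0 else P a)"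
  proof -
    have "snd \<sigma>' 5 (Suc m * n + j) = snd \<sigma>2 5 (Suc m * n + j)"
      using I assms(4) unfolding I_def by (metis Suc_n_not_le_n)
    then show ?thesis using 1 2 by simp
  qed
  show "snd \<sigma>' 4 (a * n + j') = snd \<sigma> 4 (a * n + j') \<and> snd \<sigma>' 5 (a * n + j') = snd \<sigma> 5 (a * n + j')"
    if "j' < n" "j' \<noteq> j" for a j'
  proof -
    have "a * n + j' \<noteq> ?i" using index_eq[OF that(1) assms(4), of a "Suc m"] that by simp
    then show ?thesis using I that 1 2 by (simp add: I_def)
  qed
qed

text \<open>Every old atom contributes \<open>p * \<phi> (min V d) + (1 - p) * \<phi> V\<close>, as
  in \<open>exp_min_snoc\<close>; only atoms with V > d feed the new one, since otherwise the
  minimum is V itself.\<close>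

lemma atoms_snoc:
  assumes "atoms S \<sigma> j" "length S = m"
    and "\<And>a. a \<le> m \<Longrightarrow> snd \<sigma>' 4 (a * n + j) = snd \<sigma> 4 (a * n + j)" "snd \<sigma>' 4 (Suc m * n + j) = d j s"
    and "\<And>a. a \<le> m \<Longrightarrow> snd \<sigma>' 5 (a * n + j) =
      (if snd \<sigma> 4 (a * n + j) \<le> d j s then snd \<sigma> 5 (a * n + j) else (1 - p) * snd \<sigma> 5 (a * n + j))"
    and "snd \<sigma>' 5 (Suc m * n + j) =
      p * (\<Sum>a\<le>m. if snd \<sigma> 4 (a * n + j) \<le> d j s then 0 else snd \<sigma> 5 (a * n + j))"
  shows "atoms (S @ [s]) \<sigma>' j"
  unfolding atoms_def
proof
  fix \<phi>
  let ?V = "\<lambda>a. snd \<sigma> 4 (a * n + j)" let ?P = "\<lambda>a. snd \<sigma> 5 (a * n + j)"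
  have A: "(\<Sum>a\<le>m. ?P a * \<psi> (?V a)) = exp_min p \<psi> (dummy G v v' j) (\<lambda>l. d j (S ! l)) {..<length S}" for \<psi>
    using assms(1,2) by (simp add: atoms_def)
  have "(\<Sum>a\<le>length (S @ [s]). snd \<sigma>' 5 (a * n + j) * \<phi> (snd \<sigma>' 4 (a * n + j)))
    = (\<Sum>a\<le>m. snd \<sigma>' 5 (a * n + j) * \<phi> (snd \<sigma>' 4 (a * n + j))) + snd \<sigma>' 5 (Suc m * n + j) * \<phi> (d j s)"
    using assms(2,4) by simp
  also have "\<dots> = (\<Sum>a\<le>m. (if ?V a \<le> d j s then ?P a else (1 - p) * ?P a) * \<phi> (?V a)
      + p * (if ?V a \<le> d j s then 0 else ?P a) * \<phi> (d j s))"
    unfolding assms(6) sum.distrib sum_distrib_left sum_distrib_right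
  proof (rule arg_cong2[where f = "(+)"])
    show "(\<Sum>a\<le>m. snd \<sigma>' 5 (a * n + j) * \<phi> (snd \<sigma>' 4 (a * n + j)))
      = (\<Sum>a\<le>m. (if ?V a \<le> d j s then ?P a else (1 - p) * ?P a) * \<phi> (?V a))"
      by (intro sum.cong refl) (simp only: assms(3,5) atMost_iff)
  qed (rule refl)
  also have "\<dots> = (\<Sum>a\<le>m. p * (?P a * \<phi> (min (?V a) (d j s))) + (1 - p) * (?P a * \<phi> (?V a)))"
    by (intro sum.cong refl) (auto simp: min_def algebra_simps)
  also have "\<dots> = p * (\<Sum>a\<le>m. ?P a * \<phi> (min (?V a) (d j s))) + (1 - p) * (\<Sum>a\<le>m. ?P a * \<phi> (?V a))"
    by (simp add: sum.distrib sum_distrib_left)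
  also have "\<dots> = exp_min p \<phi> (dummy G v v' j) (\<lambda>l. d j ((S @ [s]) ! l)) {..<length (S @ [s])}"
    unfolding fg.exp_min_snoc A A[of "\<lambda>y. \<phi> (min y (d j s))"] ..
  finally show "(\<Sum>a\<le>length (S @ [s]). snd \<sigma>' 5 (a * n + j) * \<phi> (snd \<sigma>' 4 (a * n + j)))
    = exp_min p \<phi> (dummy G v v' j) (\<lambda>l. d j ((S @ [s]) ! l)) {..<length (S @ [s])}" .
qed

lemma sel_n: "sel G v v' i c S < n"
proof (cases "\<exists>f<n. f \<in> Fc \<and> d f (anch G i) \<le> rad G v v' i")
  case True
  show ?thesis unfolding sel_def by (rule amin_props(1)[OF True])
next
  case False
  show ?thesis unfolding sel_def amin_def if_not_P[OF False] by (rule n_pos)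
qed

lemma sub_snoc: "sub (S @ [s]) = sub S \<union> (if 1 \<le> G (3 * k + 2 + length S) \<and> s \<in> Fc then {s} else {})"
proof -
  have "t \<in> sub (S @ [s]) \<longleftrightarrow> t \<in> sub S \<or> (t = s \<and> 1 \<le> G (3 * k + 2 + length S) \<and> t \<in> Fc)" for t
    unfolding sub_def mem_Collect_eq length_append_singleton Ex_less_Suc
    by (simp add: nth_append cong: conj_cong) blast
  then show ?thesis by auto
qed

lemma ADD_sem:
  assumes "envv \<rho>" "state S \<sigma>" "\<rho> 14 = i" "i < k" "Suc (length S) < L"
  shows "state (S @ [sel G v v' i (snd \<sigma> 6 0) S]) (sem (ADD rp) \<rho> \<sigma>)"
proof -
  let ?s = "sel G v v' i (snd \<sigma> 6 0) S" let ?m = "length S"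
  define \<sigma>1 where "\<sigma>1 = sem SELECT \<rho> \<sigma>"
  have s: "fst \<sigma>1 11 0 = ?s" unfolding \<sigma>1_def by (rule SELECT_sem) (use assms in auto)
  have an1: "anchored \<sigma>1" unfolding \<sigma>1_def using assms(2) by (intro anchored_sem) (auto simp: state_def)
  have 1: "fst \<sigma>1 8 0 = ?m" "\<forall>j<n. atoms S \<sigma>1 j" "fst \<sigma>1 7 = fst \<sigma> 7"
    using assms(2) unfolding \<sigma>1_def by (auto simp: state_def atoms_def sem_frame)
  define \<sigma>2 where "\<sigma>2 = sem (SFor 10 0 (COLUMN rp)) \<rho> \<sigma>1"
  define I where "I l \<tau> \<longleftrightarrow> ready \<tau> \<and> fst \<tau> = fst \<sigma>1 \<and> (\<forall>j<n. atoms (if j < l then S @ [?s] else S) \<tau> j)"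
    for l and \<tau> :: mem
  have "I (\<rho> 0) \<sigma>2" unfolding \<sigma>2_def
  proof (rule sem_For_inv)
    show "I 0 \<sigma>1" using an1 1 by (simp add: I_def anchored_def)
  next
    fix j \<tau> assume j: "j < \<rho> 0" and I: "I j \<tau>"
    have jn: "j < n" using j assms(1) by (simp add: envvD)
    have pre: "envv (\<rho>(10 := j))" "ready \<tau>" "(\<rho>(10 := j)) 10 = j" "fst \<tau> 8 0 = ?m" "fst \<tau> 11 0 = ?s"
      using assms(1) I 1 s by (auto simp: I_def)
    note c = COLUMN_sem[OF pre(1-3) jn pre(4) assms(5) pre(5) sel_n]
    let ?\<tau> = "sem (COLUMN rp) (\<rho>(10 := j)) \<tau>"
    have "ready ?\<tau>" using pre by (intro ready_sem) auto
    moreover have "fst ?\<tau> = fst \<tau>" by (rule ext) (simp add: sem_frame)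
    moreover have "atoms (if j' < Suc j then S @ [?s] else S) ?\<tau> j'" if j': "j' < n" for j'
    proof (cases "j' = j")
      case True
      have "atoms (if j < j then S @ [?s] else S) \<tau> j" using I jn unfolding I_def by blast
      then have "atoms S \<tau> j" by simp
      then have "atoms (S @ [?s]) ?\<tau> j"
        by (rule atoms_snoc[OF _ refl]) (erule c(1), rule c(2), erule c(3), rule c(4))
      then show ?thesis using True by simp
    next
      case False
      have "atoms (if j' < j then S @ [?s] else S) \<tau> j'" using I j' by (simp add: I_def)
      then have "atoms (if j' < j then S @ [?s] else S) ?\<tau> j'"
        by (rule atoms_cong[OF c(5)[OF j' False]])
      then show ?thesis using False by (simp add: less_Suc_eq)
    qed
    ultimately show "I (Suc j) ?\<tau>" using I by (simp add: I_def)
  qed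
  then have 2: "fst \<sigma>2 = fst \<sigma>1" "\<forall>j<n. atoms (S @ [?s]) \<sigma>2 j" using assms(1) by (auto simp: I_def envvD)
  define \<sigma>3 where "\<sigma>3 = sem (NSt 8 (NC 0) (SUCC (N0 8))) \<rho> \<sigma>2"
  have e: "sem (ADD rp) \<rho> \<sigma> = sem CHOOSE \<rho> \<sigma>3"
    unfolding ADD_def \<sigma>3_def \<sigma>2_def \<sigma>1_def sem.simps(4) ..
  have an: "anchored (sem (ADD rp) \<rho> \<sigma>)" using assms(2) by (intro anchored_sem) (auto simp: state_def)
  have "snd (sem CHOOSE \<rho> \<sigma>3) = snd \<sigma>2" by (rule ext) (simp add: sem_frame \<sigma>3_def)
  then have at: "\<forall>j<n. atoms (S @ [?s]) (sem (ADD rp) \<rho> \<sigma>) j" using 2 unfolding e by (simp add: atoms_def)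
  have 8: "fst (sem (ADD rp) \<rho> \<sigma>) 8 0 = length (S @ [?s])"
    unfolding e using 2 1 by (simp add: sem_frame \<sigma>3_def)
  have 3: "fst \<sigma>3 8 0 = Suc ?m" "fst \<sigma>3 11 0 = ?s" "fst \<sigma>3 4 = G" "fst \<sigma>3 7 = fst \<sigma> 7" "fst \<sigma>3 1 = fst \<sigma>1 1"
    using 1 2 s an1 by (auto simp: \<sigma>3_def anchored_def)
  have f1: "fst \<sigma>3 1 f = (if f \<in> Fc then 1 else 0)" for f using 3(5) an1 by (simp add: anchored_def readyD)
  have k3: "k + (k + k) + 1 + Suc ?m = 3 * k + 2 + ?m" by simp
  have ev: "evN (NA 4 (NPl (SUCC K3) (N0 8))) \<rho> \<sigma>3 = G (3 * k + 2 + ?m)"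
  proof -
    have "evN (NA 4 (NPl (SUCC K3) (N0 8))) \<rho> \<sigma>3 = G (k + (k + k) + 1 + Suc ?m)"
      using 3 assms(1) by (simp add: envvD)
    then show ?thesis by (simp only: k3)
  qed
  have ev1: "evN (NA 1 (N0 11)) \<rho> \<sigma>3 = (if ?s \<in> Fc then 1 else 0)" using 3(2) f1 by simp
  have 7: "fst (sem CHOOSE \<rho> \<sigma>3) 7 =
    (if 1 \<le> G (3 * k + 2 + ?m) \<and> ?s \<in> Fc then (fst \<sigma> 7)(?s := 1) else fst \<sigma> 7)"
    unfolding CHOOSE_def sem.simps(5) ev ev1 using 3(2,4) by simp
  have "fst (sem (ADD rp) \<rho> \<sigma>) 7 f \<noteq> 0 \<longleftrightarrow> f \<in> sub (S @ [?s])" if "f < n" for f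
  proof -
    have old: "fst \<sigma> 7 f \<noteq> 0 \<longleftrightarrow> f \<in> sub S" using assms(2) that by (simp add: state_def)
    show ?thesis unfolding e 7 sub_snoc using old by simp
  qed
  then show ?thesis using an at 8 by (simp add: state_def)
qed

lemma ROUND_sem:
  assumes "envv \<rho>" "state S \<sigma>" "length S + k < L - 1" "snd \<sigma> 6 0 = c"
  shows "state (greedy_round (sel G v v') c S (classes G)) (sem (ROUND rp rb) \<rho> \<sigma>)"
    and "snd (sem (ROUND rp rb) \<rho> \<sigma>) 6 0 = c * (1 + p)"
proof -
  let ?F = "SFor 14 1 (SIfN (SUCC (NV 14)) (NA 4 K3) (ADD rp) SSkip)"
  define I where "I i \<tau> \<longleftrightarrow> state (greedy_round (sel G v v') c S (min i (classes G))) \<tau> \<and> snd \<tau> 6 = snd \<sigma> 6" for i \<tau>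
  have r1: "\<rho> 1 = k" using assms by (simp add: envvD)
  have "I (\<rho> 1) (sem ?F \<rho> \<sigma>)"
  proof (rule sem_For_inv)
    show "I 0 \<sigma>" using assms by (simp add: I_def)
  next
    fix i \<tau> assume i: "i < \<rho> 1" and I: "I i \<tau>"
    have ik: "i < k" using i r1 by simp
    have G4: "fst \<tau> 4 = G" using I by (simp add: I_def state_def anchored_def)
    have cond: "evN (SUCC (NV 14)) (\<rho>(14 := i)) \<tau> \<le> evN (NA 4 K3) (\<rho>(14 := i)) \<tau> \<longleftrightarrow> i < classes G"
      using G4 assms(1) classes_iff[OF ik] by (simp add: envvD K3)
    show "I (Suc i) (sem (SIfN (SUCC (NV 14)) (NA 4 K3) (ADD rp) SSkip) (\<rho>(14 := i)) \<tau>)"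
    proof (cases "i < classes G")
      case True
      have st: "state (greedy_round (sel G v v') c S i) \<tau>" "snd \<tau> 6 0 = c"
        using I True assms(4) by (auto simp: I_def min_def)
      have "state (greedy_round (sel G v v') c S i @ [sel G v v' i (snd \<tau> 6 0) (greedy_round (sel G v v') c S i)])
        (sem (ADD rp) (\<rho>(14 := i)) \<tau>)"
        using assms(1,3) st ik by (intro ADD_sem) auto
      moreover have "snd (sem (ADD rp) (\<rho>(14 := i)) \<tau>) 6 = snd \<sigma> 6" using I by (simp add: I_def sem_frame)
      ultimately show ?thesis using True st(2) unfolding I_def sem.simps(5) cond by (simp add: min_def)
    next
      case False
      then have "min i (classes G) = classes G" "min (Suc i) (classes G) = classes G" by auto
      then show ?thesis using I False unfolding I_def sem.simps(5) cond by simp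
    qed
  qed
  then have "I k (sem ?F \<rho> \<sigma>)" by (simp only: r1)
  moreover have "min k (classes G) = classes G" by (simp add: classes_def)
  ultimately have 1: "state (greedy_round (sel G v v') c S (classes G)) (sem ?F \<rho> \<sigma>)"
    "snd (sem ?F \<rho> \<sigma>) 6 0 = c"
    using assms(4) by (auto simp: I_def)
  let ?\<sigma> = "sem ?F \<rho> \<sigma>"
  have e: "sem (ROUND rp rb) \<rho> \<sigma> = sem (RSt 6 (NC 0) (RDi (R0 6) (RC rb))) \<rho> ?\<sigma>"
    unfolding ROUND_def sem.simps(4) ..
  have "anchored (sem (ROUND rp rb) \<rho> \<sigma>)" using assms(2) by (intro anchored_sem) (auto simp: state_def)
  then show "state (greedy_round (sel G v v') c S (classes G)) (sem (ROUND rp rb) \<rho> \<sigma>)"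
    using 1(1) unfolding e by (simp add: state_def atoms_def)
  show "snd (sem (ROUND rp rb) \<rho> \<sigma>) 6 0 = c * (1 + p)" unfolding e using 1(2) rb by simp
qed

lemma GREEDY_sem:
  assumes "envv \<rho>" "state [] \<sigma>" "snd \<sigma> 6 0 = (1 / (1 + p)) ^ rounds G"
  shows "state (glist G v v') (sem (GREEDY rp rb) \<rho> \<sigma>)"
proof -
  let ?g = "greedy (sel G v v') (classes G) (\<lambda>t. (1 / (1 + p)) ^ (rounds G - t))"
  define I where "I t \<tau> \<longleftrightarrow> state (?g (min t (rounds G))) \<tau> \<and> snd \<tau> 6 0 = (1 / (1 + p)) ^ (rounds G - t)" for t \<tau>
  have r5: "\<rho> 5 = M0" using assms by (simp add: envvD)
  have "I (\<rho> 5) (sem (GREEDY rp rb) \<rho> \<sigma>)" unfolding GREEDY_def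
  proof (rule sem_For_inv)
    show "I 0 \<sigma>" using assms by (simp add: I_def)
  next
    fix t \<tau> assume t: "t < \<rho> 5" and I: "I t \<tau>"
    have tM: "t < M0" using t r5 by simp
    have G4: "fst \<tau> 4 = G" using I by (simp add: I_def state_def anchored_def)
    have cond: "evN (SUCC (NV 15)) (\<rho>(15 := t)) \<tau> \<le> evN (NA 4 (SUCC K3)) (\<rho>(15 := t)) \<tau> \<longleftrightarrow> t < rounds G"
      using G4 assms(1) rounds_iff[OF tM] by (simp add: envvD K3)
    show "I (Suc t) (sem (SIfN (SUCC (NV 15)) (NA 4 (SUCC K3)) (ROUND rp rb) SSkip) (\<rho>(15 := t)) \<tau>)"
    proof (cases "t < rounds G")
      case True
      have st: "state (?g t) \<tau>" using I True by (simp add: I_def min_def)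
      have c: "snd \<tau> 6 0 = (1 / (1 + p)) ^ (rounds G - t)" using I by (simp add: I_def)
      \<comment> \<open>The list never exceeds \<open>M0 * k\<close> entries, so all layers have
        indices below \<open>L\<close>; hence the number of digits also serves as the bound of the
        loops over atoms.\<close>
      have "t * classes G + k \<le> Suc t * k" by (simp add: classes_def)
      also have "\<dots> \<le> M0 * k" using tM by (intro mult_right_mono) auto
      finally have len: "length (?g t) + k < L - 1" using L by simp
      have "rounds G - t = Suc (rounds G - Suc t)" using True by simp
      then have "(1 / (1 + p)) ^ (rounds G - t) * (1 + p) = (1 / (1 + p)) ^ (rounds G - Suc t)"
        using p by simp
      then show ?thesis using ROUND_sem[OF _ st len c, of "\<rho>(15 := t)"] assms(1) True
        unfolding I_def sem.simps(5) cond by (simp add: min_def)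
    next
      case False
      then have "min t (rounds G) = rounds G" "min (Suc t) (rounds G) = rounds G"
        "rounds G - t = 0" "rounds G - Suc t = 0" by auto
      then show ?thesis using I False unfolding I_def sem.simps(5) cond by simp
    qed
  qed
  moreover have "min M0 (rounds G) = rounds G" by (simp add: rounds_def)
  ultimately show ?thesis by (simp add: I_def r5 glist_def)
qed

lemma sub_glist: "sub (glist G v v') = solset G v v'"
  by (simp add: sub_def solset_def)

end

section \<open>Evaluating one guess and keeping the best solution\<close>

definition COST :: rexp where
  "COST = RPl (RSum 11 0 (RIfN (NC 1) (NA 7 (NV 11)) (RA 1 (NV 11)) (RC 0)))
     (RSum 10 0 (RIfN (NC 1) (NA 0 (NV 10)) (RA 8 (NV 10)) (RC 0)))"

definition UPDATE :: stm where
  "UPDATE = NSt 13 (NC 0) (NC 1) ;; RSt 7 (NC 0) COST ;; SFor 11 0 (NSt 2 (NV 11) (NA 7 (NV 11)))"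

text \<open>The second \<open>ARGMIN\<close>, with a constant objective, only tests whether the
  current subset is nonempty; array 13 tells whether there is a previous best to compare
  with.\<close>

definition EVAL :: stm where
  "EVAL = SFor 10 0 (ARGMIN 11 0 (IND (NC 1) (NA 7 (NV 11))) (DI (NV 10) (NV 11)) ;; RSt 8 (NV 10) (R0 10)) ;;
     ARGMIN 11 0 (IND (NC 1) (NA 7 (NV 11))) (RC 0) ;;
     SIfN (NC 1) (N0 10) (SIfN (NC 1) (N0 13) (SIfR (R0 7) COST SSkip UPDATE) UPDATE) SSkip"

definition BODY :: "rat \<Rightarrow> rat \<Rightarrow> rat \<Rightarrow> stm" where
  "BODY r\<delta> rp rb = ANCHORS r\<delta> ;; DUMMIES ;; GINIT rb ;; GREEDY rp rb ;; EVAL"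

definition INC :: stm where
  "INC = NSt 9 (NC 0) (NC 1) ;; SFor 21 3 (SIfN (NC 1) (N0 9)
     (SIfN (NPl (NA 4 (NV 21)) (NC 2)) (NV 2) (NSt 4 (NV 21) (SUCC (NA 4 (NV 21))) ;; NSt 9 (NC 0) (NC 0))
       (NSt 4 (NV 21) (NC 0))) SSkip)"

definition SEARCH :: "rat \<Rightarrow> rat \<Rightarrow> rat \<Rightarrow> stm" where
  "SEARCH r\<delta> rp rb = SFor 20 4 (SFor 18 0 (SFor 19 0 (BODY r\<delta> rp rb)) ;; INC)"

lemma wr_simps' [simp]:
  "wrN (ANCHORS r) = {5, 6, 10, 11}" "wrR (ANCHORS r) = {2, 10}"
  "wrN UPDATE = {2, 13}" "wrR UPDATE = {7}"
  "wrN EVAL = {2, 10, 11, 13}" "wrR EVAL = {7, 8, 10}"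
  "wrN (BODY r\<delta> rp rb) = {2, 5, 6, 7, 8, 10, 11, 13}" "wrR (BODY r\<delta> rp rb) = {2, 4, 5, 6, 7, 8, 10}"
  "wrN INC = {4, 9}" "wrR INC = {}"
  by (auto simp: ANCHORS_def STAGE_def WEIGHTS_def HIT_def UPDATE_def EVAL_def BODY_def INC_def)

context fl_prog
begin

text \<open>This holds for every guess, however meaningless: what is evaluated is then a set of
  facilities at its true cost, so that wrong guesses cannot spoil the best solution.\<close>

definition safe :: "mem \<Rightarrow> bool" where
  "safe \<sigma> \<longleftrightarrow> ready \<sigma> \<and> (\<forall>f<n. fst \<sigma> 7 f \<noteq> 0 \<longrightarrow> f \<in> Fc)"

lemma safe_frame:
  "safe \<sigma> \<Longrightarrow> wrN c \<inter> {0, 1, 3, 7} = {} \<Longrightarrow> wrR c \<inter> {0, 1, 3} = {} \<Longrightarrow> safe (sem c \<rho> \<sigma>)"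
  unfolding safe_def using ready_sem[of \<sigma> c \<rho>] sem_frameN[of 7 c \<rho> \<sigma>] by auto

lemma safe_For:
  "safe \<sigma> \<Longrightarrow> (\<And>i \<tau>. safe \<tau> \<Longrightarrow> safe (sem c (\<rho>(x := i)) \<tau>)) \<Longrightarrow> safe (sem (SFor x y c) \<rho> \<sigma>)"
  by (rule sem_For_inv[where I = "\<lambda>_. safe"])

lemma safe_CHOOSE: "safe \<sigma> \<Longrightarrow> safe (sem CHOOSE \<rho> \<sigma>)"
proof -
  assume s: "safe \<sigma>"
  have "ready (sem CHOOSE \<rho> \<sigma>)" using s by (intro ready_sem) (auto simp: safe_def)
  then show ?thesis using s by (auto simp: CHOOSE_def safe_def readyD)
qed

lemma safe_ADD: "safe \<sigma> \<Longrightarrow> safe (sem (ADD rp) \<rho> \<sigma>)"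
  unfolding ADD_def sem.simps(4) by (intro safe_CHOOSE safe_frame) auto

lemma safe_GREEDY: "safe \<sigma> \<Longrightarrow> safe (sem (GREEDY rp rb) \<rho> \<sigma>)"
proof -
  have r: "safe (sem (ROUND rp rb) \<rho> \<tau>)" if "safe \<tau>" for \<rho> \<tau>
    unfolding ROUND_def sem.simps(4)
  proof (rule safe_frame)
    show "safe (sem (SFor 14 1 (SIfN (SUCC (NV 14)) (NA 4 K3) (ADD rp) SSkip)) \<rho> \<tau>)"
      using that by (rule safe_For) (simp add: safe_ADD)
  qed auto
  show "safe \<sigma> \<Longrightarrow> safe (sem (GREEDY rp rb) \<rho> \<sigma>)"
    unfolding GREEDY_def by (rule safe_For) (simp_all add: r)
qed

lemma safe_GINIT: "safe \<sigma> \<Longrightarrow> safe (sem (GINIT rb) \<rho> \<sigma>)"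
proof -
  assume s: "safe \<sigma>"
  have 1: "safe (sem (NSt 7 (NV 11) (NC 0)) \<rho> \<tau>)" if "safe \<tau>" for \<rho> \<tau>
  proof -
    have "ready (sem (NSt 7 (NV 11) (NC 0)) \<rho> \<tau>)" using that by (intro ready_sem) (auto simp: safe_def)
    then show ?thesis using that by (auto simp: safe_def)
  qed
  have 2: "safe (sem (SFor 11 0 (NSt 7 (NV 11) (NC 0))) \<rho> (sem (NSt 8 (NC 0) (NC 0)) \<rho> \<sigma>))"
  proof (rule safe_For)
    show "safe (sem (NSt 8 (NC 0) (NC 0)) \<rho> \<sigma>)" using s by (rule safe_frame) auto
  qed (rule 1)
  show ?thesis unfolding GINIT_def sem.simps(4)
  proof (rule safe_frame[OF safe_frame[OF 2]])
  qed auto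
qed

definition Tset :: "mem \<Rightarrow> nat set" where
  "Tset \<sigma> = {f. f < n \<and> fst \<sigma> 7 f \<noteq> 0}"

definition Oset :: "mem \<Rightarrow> nat set" where
  "Oset \<sigma> = {f. f < n \<and> fst \<sigma> 2 f \<noteq> 0}"

definition best_ok :: "mem \<Rightarrow> bool" where
  "best_ok \<sigma> \<longleftrightarrow> fst \<sigma> 13 0 \<noteq> 0 \<longrightarrow> Oset \<sigma> \<noteq> {} \<and> Oset \<sigma> \<subseteq> Fc \<and> snd \<sigma> 7 0 = val (Oset \<sigma>)"

text \<open>Preserved by further evaluations, because the recorded cost only decreases; one good
  guess is never lost.\<close>

definition reached :: "mem \<Rightarrow> real \<Rightarrow> bool" where
  "reached \<sigma> x \<longleftrightarrow> fst \<sigma> 13 0 \<noteq> 0 \<and> snd \<sigma> 7 0 \<le> x"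

lemma COST_ev:
  assumes "\<rho> 0 = n" "safe \<sigma>" "\<forall>j<n. snd \<sigma> 8 j = minval (\<lambda>f. fst \<sigma> 7 f \<noteq> 0) (d j) n" "Tset \<sigma> \<noteq> {}"
  shows "evR COST \<rho> \<sigma> = val (Tset \<sigma>)"
proof -
  have "(\<Sum>f<n. if 1 \<le> fst \<sigma> 7 f then snd \<sigma> 1 f else 0) = (\<Sum>f<n. if f \<in> Tset \<sigma> then cost f else 0)"
    using assms(2) by (intro sum.cong refl) (auto simp: Tset_def safe_def readyD)
  also have "\<dots> = (\<Sum>f\<in>{..<n} \<inter> Tset \<sigma>. cost f)" by (simp add: sum.inter_restrict)
  also have "{..<n} \<inter> Tset \<sigma> = Tset \<sigma>" by (auto simp: Tset_def)
  finally have 1: "(\<Sum>f<n. if 1 \<le> fst \<sigma> 7 f then snd \<sigma> 1 f else 0) = (\<Sum>f\<in>Tset \<sigma>. cost f)" .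
  have ex: "\<exists>f<n. fst \<sigma> 7 f \<noteq> 0" using assms(4) by (auto simp: Tset_def)
  have 2: "(\<Sum>j<n. if 1 \<le> fst \<sigma> 0 j then snd \<sigma> 8 j else 0) = (\<Sum>j\<in>C. Min ((\<lambda>f. d j f) ` Tset \<sigma>))"
    unfolding sum_C[symmetric]
  proof (intro sum.cong refl)
    fix j assume j: "j \<in> {..<n}"
    then have "snd \<sigma> 8 j = Min ((\<lambda>f. d j f) ` Tset \<sigma>)"
      using assms(3) minval_eq_Min[OF ex, of "d j"] by (auto simp: Tset_def)
    then show "(if 1 \<le> fst \<sigma> 0 j then snd \<sigma> 8 j else 0) = (if j \<in> C then Min ((\<lambda>f. d j f) ` Tset \<sigma>) else 0)"
      using assms(2) by (simp add: safe_def readyD)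
  qed
  show ?thesis unfolding COST_def val_def using 1 2 assms(1) by simp
qed

lemma EVAL_sem:
  assumes "env \<rho>" "safe \<sigma>" "best_ok \<sigma>"
  shows "best_ok (sem EVAL \<rho> \<sigma>)" and "Tset \<sigma> \<noteq> {} \<Longrightarrow> reached (sem EVAL \<rho> \<sigma>) (val (Tset \<sigma>))"
    and "reached \<sigma> x \<Longrightarrow> reached (sem EVAL \<rho> \<sigma>) x"
proof -
  have r0: "\<rho> 0 = n" using assms(1) by (simp add: envD)
  let ?P = "\<lambda>f. fst \<sigma> 7 f \<noteq> 0"
  let ?A = "ARGMIN 11 0 (IND (NC 1) (NA 7 (NV 11))) (DI (NV 10) (NV 11))"
  let ?F = "SFor 10 0 (?A ;; RSt 8 (NV 10) (R0 10))"
  define \<sigma>1 where "\<sigma>1 = sem ?F \<rho> \<sigma>"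
  define I where "I l \<tau> \<longleftrightarrow> safe \<tau> \<and> fst \<tau> 7 = fst \<sigma> 7 \<and> (\<forall>j<l. snd \<tau> 8 j = minval ?P (d j) n)"
    for l and \<tau> :: mem
  have "I (\<rho> 0) \<sigma>1" unfolding \<sigma>1_def
  proof (rule sem_For_inv)
    show "I 0 \<sigma>" using assms by (simp add: I_def)
  next
    fix j \<tau> assume j: "j < \<rho> 0" and I: "I j \<tau>"
    let ?\<rho> = "\<rho>(10 := j)"
    have "snd (sem ?A ?\<rho> \<tau>) 10 0 = minval ?P (d j) (?\<rho> 0)"
    proof (rule ARGMIN_sem(3))
      fix f \<tau>' assume "same \<tau> \<tau>'"
      then have "fst \<tau>' 7 = fst \<sigma> 7" using I sameD[of \<tau> \<tau>'] by (simp add: I_def)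
      then show "evR (IND (NC 1) (NA 7 (NV 11))) (?\<rho>(11 := f)) \<tau>' = (if ?P f then 1 else 0)" by simp
    next
      fix f \<tau>' assume f: "f < ?\<rho> 0" and s: "same \<tau> \<tau>'"
      have "ready \<tau>'" using I ready_same[OF _ s] by (simp add: I_def safe_def)
      then show "evR (DI (NV 10) (NV 11)) (?\<rho>(11 := f)) \<tau>' = d j f" using f j r0 by (simp add: readyD)
    qed
    then have m: "snd (sem ?A ?\<rho> \<tau>) 10 0 = minval ?P (d j) n" using r0 by simp
    have "safe (sem (?A ;; RSt 8 (NV 10) (R0 10)) ?\<rho> \<tau>)" using I by (intro safe_frame) (auto simp: I_def)
    then show "I (Suc j) (sem (?A ;; RSt 8 (NV 10) (R0 10)) ?\<rho> \<tau>)"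
      using I m by (auto simp: I_def sem_frame less_Suc_eq)
  qed
  then have 1: "safe \<sigma>1" "fst \<sigma>1 7 = fst \<sigma> 7" "\<forall>j<n. snd \<sigma>1 8 j = minval ?P (d j) n"
    by (auto simp: I_def r0)
  let ?E = "ARGMIN 11 0 (IND (NC 1) (NA 7 (NV 11))) (RC 0)"
  define \<sigma>2 where "\<sigma>2 = sem ?E \<rho> \<sigma>1"
  have "fst \<sigma>2 10 0 = (if \<exists>f<\<rho> 0. ?P f then 1 else 0)" unfolding \<sigma>2_def
  proof (rule ARGMIN_sem(1)[where E = "\<lambda>_. 0"])
    fix f \<tau>' assume "same \<sigma>1 \<tau>'"
    then have "fst \<tau>' 7 = fst \<sigma> 7" using 1 sameD[of \<sigma>1 \<tau>'] by simp
    then show "evR (IND (NC 1) (NA 7 (NV 11))) (\<rho>(11 := f)) \<tau>' = (if ?P f then 1 else 0)" by simp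
  qed simp
  then have fl: "fst \<sigma>2 10 0 = (if Tset \<sigma> \<noteq> {} then 1 else 0)" by (auto simp: r0 Tset_def)
  have 2: "safe \<sigma>2" "fst \<sigma>2 7 = fst \<sigma> 7" "\<forall>j<n. snd \<sigma>2 8 j = minval (\<lambda>f. fst \<sigma>2 7 f \<noteq> 0) (d j) n"
    using 1 safe_frame[of \<sigma>1 ?E \<rho>] unfolding \<sigma>2_def by (auto simp: sem_frame)
  have old: "fst \<sigma>2 13 = fst \<sigma> 13" "fst \<sigma>2 2 = fst \<sigma> 2" "snd \<sigma>2 7 = snd \<sigma> 7"
    unfolding \<sigma>2_def \<sigma>1_def by (simp_all add: sem_frame)
  have T2: "Tset \<sigma>2 = Tset \<sigma>" using 2 by (simp add: Tset_def)
  have b2: "best_ok \<sigma>2" using assms(3) old by (simp add: best_ok_def Oset_def)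
  have e: "sem EVAL \<rho> \<sigma> = (if 1 \<le> fst \<sigma>2 10 0 then if 1 \<le> fst \<sigma>2 13 0 then
      if snd \<sigma>2 7 0 \<le> evR COST \<rho> \<sigma>2 then \<sigma>2 else sem UPDATE \<rho> \<sigma>2 else sem UPDATE \<rho> \<sigma>2 else \<sigma>2)"
    unfolding EVAL_def \<sigma>2_def \<sigma>1_def by simp
  have upd: "fst (sem UPDATE \<rho> \<sigma>2) 13 0 = 1" "snd (sem UPDATE \<rho> \<sigma>2) 7 0 = val (Tset \<sigma>)"
    "Oset (sem UPDATE \<rho> \<sigma>2) = Tset \<sigma>" if ne: "Tset \<sigma> \<noteq> {}"
  proof -
    define \<sigma>3 where "\<sigma>3 = sem (NSt 13 (NC 0) (NC 1)) \<rho> \<sigma>2"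
    define \<sigma>4 where "\<sigma>4 = sem (RSt 7 (NC 0) COST) \<rho> \<sigma>3"
    have "safe \<sigma>3" unfolding \<sigma>3_def using 2(1) by (rule safe_frame) auto
    moreover have "fst \<sigma>3 7 = fst \<sigma>2 7" "snd \<sigma>3 = snd \<sigma>2" "fst \<sigma>3 13 0 = 1" by (simp_all add: \<sigma>3_def)
    moreover from this have "Tset \<sigma>3 = Tset \<sigma>" using T2 by (simp add: Tset_def)
    ultimately have c: "evR COST \<rho> \<sigma>3 = val (Tset \<sigma>)" "fst \<sigma>3 13 0 = 1" "fst \<sigma>3 7 = fst \<sigma> 7"
      using COST_ev[where \<rho> = \<rho> and \<sigma> = \<sigma>3] r0 2 ne by auto
    have 4: "fst \<sigma>4 = fst \<sigma>3" "snd \<sigma>4 7 0 = val (Tset \<sigma>)" using c by (simp_all add: \<sigma>4_def)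
    let ?G = "SFor 11 0 (NSt 2 (NV 11) (NA 7 (NV 11)))"
    have u: "sem UPDATE \<rho> \<sigma>2 = sem ?G \<rho> \<sigma>4" unfolding UPDATE_def \<sigma>4_def \<sigma>3_def sem.simps(4) ..
    define J where "J l \<tau> \<longleftrightarrow> fst \<tau> 7 = fst \<sigma> 7 \<and> (\<forall>f<l. fst \<tau> 2 f = fst \<sigma> 7 f)" for l and \<tau> :: mem
    have "J (\<rho> 0) (sem ?G \<rho> \<sigma>4)"
      by (rule sem_For_inv) (use 4 c in \<open>auto simp: J_def less_Suc_eq\<close>)
    then show "Oset (sem UPDATE \<rho> \<sigma>2) = Tset \<sigma>" unfolding u by (auto simp: J_def Oset_def Tset_def r0)
    show "fst (sem UPDATE \<rho> \<sigma>2) 13 0 = 1" "snd (sem UPDATE \<rho> \<sigma>2) 7 0 = val (Tset \<sigma>)"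
      unfolding u using 4 c by (simp_all add: sem_frame)
  qed
  have cst: "evR COST \<rho> \<sigma>2 = val (Tset \<sigma>)" if "Tset \<sigma> \<noteq> {}"
    using COST_ev[where \<rho> = \<rho> and \<sigma> = \<sigma>2] r0 2(1,3) that unfolding T2 by blast
  have TF: "Tset \<sigma> \<subseteq> Fc" using assms(2) by (auto simp: Tset_def safe_def)
  show "best_ok (sem EVAL \<rho> \<sigma>)"
    unfolding e using fl b2 upd TF by (auto simp: best_ok_def)
  show "reached (sem EVAL \<rho> \<sigma>) (val (Tset \<sigma>))" if "Tset \<sigma> \<noteq> {}"
    unfolding e using fl upd[OF that] cst[OF that] that by (auto simp: reached_def)
  show "reached (sem EVAL \<rho> \<sigma>) x" if "reached \<sigma> x"
    unfolding e using fl upd cst that old by (auto simp: reached_def)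
qed

lemma BODY_any:
  assumes "env \<rho>" "safe \<sigma>" "best_ok \<sigma>"
  shows "safe (sem (BODY r\<delta> rp rb) \<rho> \<sigma>)" "best_ok (sem (BODY r\<delta> rp rb) \<rho> \<sigma>)"
    and "reached \<sigma> x \<Longrightarrow> reached (sem (BODY r\<delta> rp rb) \<rho> \<sigma>) x"
proof -
  define \<sigma>1 where "\<sigma>1 = sem (GREEDY rp rb) \<rho> (sem (GINIT rb) \<rho> (sem DUMMIES \<rho> (sem (ANCHORS r\<delta>) \<rho> \<sigma>)))"
  have e: "sem (BODY r\<delta> rp rb) \<rho> \<sigma> = sem EVAL \<rho> \<sigma>1" unfolding BODY_def \<sigma>1_def sem.simps(4) ..
  have s: "safe \<sigma>1" unfolding \<sigma>1_def
    by (intro safe_GREEDY safe_GINIT safe_frame assms(2)) auto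
  have "fst \<sigma>1 13 = fst \<sigma> 13" "fst \<sigma>1 2 = fst \<sigma> 2" "snd \<sigma>1 7 = snd \<sigma> 7"
    unfolding \<sigma>1_def by (simp_all add: sem_frame)
  then have b: "best_ok \<sigma>1" and r: "reached \<sigma> x \<Longrightarrow> reached \<sigma>1 x" for x
    using assms(3) by (auto simp: best_ok_def Oset_def reached_def)
  show "safe (sem (BODY r\<delta> rp rb) \<rho> \<sigma>)" unfolding e using s by (rule safe_frame) auto
  show "best_ok (sem (BODY r\<delta> rp rb) \<rho> \<sigma>)" unfolding e by (rule EVAL_sem(1)[OF assms(1) s b])
  show "reached \<sigma> x \<Longrightarrow> reached (sem (BODY r\<delta> rp rb) \<rho> \<sigma>) x" unfolding e by (rule EVAL_sem(3)[OF assms(1) s b r])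
qed

end

context fl_body
begin

lemma BODY_solset:
  assumes "envv \<rho>" "safe \<sigma>" "best_ok \<sigma>" "fst \<sigma> 4 = G" "solset G v v' \<noteq> {}"
  shows "reached (sem (BODY r\<delta> rp rb) \<rho> \<sigma>) (val (solset G v v'))"
proof -
  have env: "env \<rho>" using assms(1) by (simp add: envv_def)
  have rdy: "ready \<sigma>" using assms(2) by (simp add: safe_def)
  define \<sigma>1 where "\<sigma>1 = sem (ANCHORS r\<delta>) \<rho> \<sigma>"
  define \<sigma>2 where "\<sigma>2 = sem DUMMIES \<rho> \<sigma>1"
  define \<sigma>3 where "\<sigma>3 = sem (GINIT rb) \<rho> \<sigma>2"
  define \<sigma>4 where "\<sigma>4 = sem (GREEDY rp rb) \<rho> \<sigma>3"
  have e: "sem (BODY r\<delta> rp rb) \<rho> \<sigma> = sem EVAL \<rho> \<sigma>4"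
    unfolding BODY_def \<sigma>4_def \<sigma>3_def \<sigma>2_def \<sigma>1_def sem.simps(4) ..
  have "anc_ok G k \<sigma>1" unfolding \<sigma>1_def
    by (rule ANCHORS_sem[OF env rdy assms(4)]) (use L in \<open>auto intro: G_less\<close>)
  moreover have "ready \<sigma>1" "fst \<sigma>1 4 = G"
    using assms(2,4) unfolding \<sigma>1_def by (auto simp: safe_def sem_frame intro!: ready_sem)
  ultimately have 1: "anchored \<sigma>1" by (simp add: anchored_def)
  have 2: "\<forall>j<n. atoms [] \<sigma>2 j" unfolding \<sigma>2_def by (rule DUMMIES_sem[OF assms(1) 1])
  have an2: "anchored \<sigma>2" unfolding \<sigma>2_def using 1 by (rule anchored_sem) auto
  have "state (glist G v v') \<sigma>4" unfolding \<sigma>4_def \<sigma>3_def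
    by (rule GREEDY_sem[OF assms(1) GINIT_sem[OF assms(1) an2 2]])
  then have T: "Tset \<sigma>4 = solset G v v'"
    using Fc_sub by (auto simp: Tset_def state_def sub_glist) (auto simp: solset_def)
  have s: "safe \<sigma>4" unfolding \<sigma>4_def \<sigma>3_def \<sigma>2_def \<sigma>1_def
    by (intro safe_GREEDY safe_GINIT safe_frame assms(2)) auto
  have "fst \<sigma>4 13 = fst \<sigma> 13" "fst \<sigma>4 2 = fst \<sigma> 2" "snd \<sigma>4 7 = snd \<sigma> 7"
    unfolding \<sigma>4_def \<sigma>3_def \<sigma>2_def \<sigma>1_def by (simp_all add: sem_frame)
  then have b: "best_ok \<sigma>4" using assms(3) by (simp add: best_ok_def Oset_def)
  show ?thesis unfolding e T[symmetric] using assms(5) by (intro EVAL_sem(2)[OF env s b]) (simp add: T)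
qed

end

section \<open>Enumerating the guesses\<close>

definition digval :: "nat \<Rightarrow> (nat \<Rightarrow> nat) \<Rightarrow> nat \<Rightarrow> nat" where
  "digval B G L = (\<Sum>l<L. G l * B ^ l)"

lemma digval_less:
  assumes "\<And>l. l < L \<Longrightarrow> G l < B" shows "digval B G L < B ^ L"
  using assms
proof (induction L)
  case (Suc L)
  have "digval B G L < B ^ L" using Suc by auto
  moreover have "Suc (G L) * B ^ L \<le> B * B ^ L" using Suc.prems[of L] by (intro mult_le_mono1) auto
  ultimately show ?case by (simp add: digval_def)
qed (simp add: digval_def)

lemma digval_inj:
  assumes "\<And>l. l < L \<Longrightarrow> G l < B" "\<And>l. l < L \<Longrightarrow> G' l < B" "digval B G L = digval B G' L" "l < L"
  shows "G l = G' l"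
  using assms
proof (induction L)
  case (Suc L)
  have lt: "digval B G L < B ^ L" "digval B G' L < B ^ L" using Suc.prems by (auto intro: digval_less)
  have eq: "G L * B ^ L + digval B G L = G' L * B ^ L + digval B G' L"
    using Suc.prems(3) by (simp add: digval_def)
  have "G L = G' L \<and> digval B G L = digval B G' L" using eq index_eq[OF lt, of "G L" "G' L"] by simp
  then show ?case using Suc by (cases "l = L") auto
qed simp

lemma INC_sem:
  assumes "\<rho> 2 = B" "\<rho> 3 = L" "\<And>l. l < L \<Longrightarrow> fst \<sigma> 4 l < B" "Suc (digval B (fst \<sigma> 4) L) < B ^ L"
  shows "\<And>l. l < L \<Longrightarrow> fst (sem INC \<rho> \<sigma>) 4 l < B"
    and "digval B (fst (sem INC \<rho> \<sigma>) 4) L = Suc (digval B (fst \<sigma> 4) L)"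
    and "\<And>l. L \<le> l \<Longrightarrow> fst (sem INC \<rho> \<sigma>) 4 l = fst \<sigma> 4 l"
proof -
  let ?G = "fst \<sigma> 4"
  let ?b = "SIfN (NC 1) (N0 9)
     (SIfN (NPl (NA 4 (NV 21)) (NC 2)) (NV 2) (NSt 4 (NV 21) (SUCC (NA 4 (NV 21))) ;; NSt 9 (NC 0) (NC 0))
       (NSt 4 (NV 21) (NC 0))) SSkip"
  \<comment> \<open>The digits below \<open>i\<close> together with the carry, worth
    \<open>B ^ i\<close>, represent the old value of these digits plus 1.\<close>
  define I where "I i \<tau> \<longleftrightarrow> fst \<tau> 9 0 \<le> 1 \<and> (\<forall>l<L. fst \<tau> 4 l < B) \<and> (\<forall>l\<ge>i. fst \<tau> 4 l = ?G l) \<and>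
    digval B (fst \<tau> 4) i + fst \<tau> 9 0 * B ^ i = Suc (digval B ?G i)" for i and \<tau> :: mem
  have cong: "digval B (g(i := x)) i = digval B g i" for g i x
    unfolding digval_def by (intro sum.cong) auto
  have Suc: "digval B g (Suc i) = digval B g i + g i * B ^ i" for g i by (simp add: digval_def)
  have "I (\<rho> 3) (sem INC \<rho> \<sigma>)" unfolding INC_def sem.simps(4)
  proof (rule sem_For_inv)
    show "I 0 (sem (NSt 9 (NC 0) (NC 1)) \<rho> \<sigma>)" using assms by (simp add: I_def digval_def)
  next
    fix i \<tau> assume i: "i < \<rho> 3" and I: "I i \<tau>"
    have Gi: "fst \<tau> 4 i = ?G i" using I by (simp add: I_def)
    have GB: "?G i < B" using assms(2,3) i by simp
    show "I (Suc i) (sem ?b (\<rho>(21 := i)) \<tau>)"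
    proof (cases "fst \<tau> 9 0 = 0")
      case True
      then have "sem ?b (\<rho>(21 := i)) \<tau> = \<tau>" by simp
      then show ?thesis using I True Gi by (simp add: I_def Suc)
    next
      case False
      then have 9: "fst \<tau> 9 0 = 1" using I by (auto simp: I_def)
      have eq: "digval B (fst \<tau> 4) i + B ^ i = Suc (digval B ?G i)" using I 9 by (simp add: I_def)
      show ?thesis
      proof (cases "?G i + 2 \<le> B")
        case True
        have 4: "fst (sem ?b (\<rho>(21 := i)) \<tau>) 4 = (fst \<tau> 4)(i := Suc (?G i))"
          and n9: "fst (sem ?b (\<rho>(21 := i)) \<tau>) 9 0 = 0" using 9 True Gi assms(1) by simp_all
        have "digval B ((fst \<tau> 4)(i := Suc (?G i))) (Suc i) = Suc (digval B ?G (Suc i))"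
          unfolding Suc cong using eq by simp
        then show ?thesis using I True unfolding I_def 4 n9 by auto
      next
        case F: False
        then have GB': "Suc (?G i) = B" using GB by simp
        have 4: "fst (sem ?b (\<rho>(21 := i)) \<tau>) 4 = (fst \<tau> 4)(i := 0)"
          and n9: "fst (sem ?b (\<rho>(21 := i)) \<tau>) 9 0 = 1" using 9 F Gi assms(1) by simp_all
        have "digval B ((fst \<tau> 4)(i := 0)) (Suc i) + 1 * B ^ Suc i = digval B (fst \<tau> 4) i + Suc (?G i) * B ^ i"
          unfolding Suc cong GB' by simp
        also have "\<dots> = Suc (digval B ?G (Suc i))" unfolding Suc using eq by simp
        finally show ?thesis using I GB unfolding I_def 4 n9 by auto
      qed
    qed
  qed
  then have I: "I L (sem INC \<rho> \<sigma>)" by (simp only: assms(2))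
  have "fst (sem INC \<rho> \<sigma>) 9 0 = 0"
  proof (rule ccontr)
    assume "fst (sem INC \<rho> \<sigma>) 9 0 \<noteq> 0"
    then have "fst (sem INC \<rho> \<sigma>) 9 0 = 1" using I by (auto simp: I_def)
    then show False using I assms(4) by (simp add: I_def)
  qed
  then show "\<And>l. l < L \<Longrightarrow> fst (sem INC \<rho> \<sigma>) 4 l < B"
    "digval B (fst (sem INC \<rho> \<sigma>) 4) L = Suc (digval B (fst \<sigma> 4) L)"
    "\<And>l. L \<le> l \<Longrightarrow> fst (sem INC \<rho> \<sigma>) 4 l = fst \<sigma> 4 l"
    using I by (auto simp: I_def)
qed

context fl_prog
begin

text \<open>Digits range below \<open>B\<close> and may point past the \<open>k + 1\<close> anchors;
  the first premise exempts such strings.\<close>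

definition covered :: "rat \<Rightarrow> mem \<Rightarrow> (nat \<Rightarrow> nat) \<Rightarrow> nat \<Rightarrow> nat \<Rightarrow> bool" where
  "covered rb \<tau> G v v' \<longleftrightarrow> (\<forall>i<k. G (k + i) \<le> k) \<longrightarrow> solset G v v' \<noteq> {} \<longrightarrow> reached \<tau> (val (solset G v v'))"

lemma PAIRS_sem:
  assumes "env \<rho>" "safe \<sigma>" "best_ok \<sigma>" "fst \<sigma> 4 = G" "\<And>l. l < L \<Longrightarrow> G l < B"
    and rb: "real_of_rat rb = 1 / (1 + p)"
  defines "\<sigma>' \<equiv> sem (SFor 18 0 (SFor 19 0 (BODY r\<delta> rp rb))) \<rho> \<sigma>"
  shows "safe \<sigma>'" "best_ok \<sigma>'" "\<And>x. reached \<sigma> x \<Longrightarrow> reached \<sigma>' x" "\<forall>v<n. \<forall>v'<n. covered rb \<sigma>' G v v'"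
proof -
  have r0: "\<rho> 0 = n" using assms(1) by (simp add: envD)
  define ok where "ok \<tau> \<longleftrightarrow> safe \<tau> \<and> best_ok \<tau> \<and> fst \<tau> 4 = G \<and> (\<forall>x. reached \<sigma> x \<longrightarrow> reached \<tau> x)" for \<tau>
  have body: "ok (sem (BODY r\<delta> rp rb) \<rho>' \<tau>)" "reached \<tau> x \<Longrightarrow> reached (sem (BODY r\<delta> rp rb) \<rho>' \<tau>) x"
    "\<rho>' 18 = v \<Longrightarrow> \<rho>' 19 = v' \<Longrightarrow> v < n \<Longrightarrow> v' < n \<Longrightarrow> covered rb (sem (BODY r\<delta> rp rb) \<rho>' \<tau>) G v v'"
    if ok: "ok \<tau>" and env: "env \<rho>'" for \<rho>' \<tau> x v v'
  proof -
    have \<tau>: "safe \<tau>" "best_ok \<tau>" "fst \<tau> 4 = G" using ok by (auto simp: ok_def)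
    note any = BODY_any[OF env \<tau>(1,2)]
    show "reached \<tau> x \<Longrightarrow> reached (sem (BODY r\<delta> rp rb) \<rho>' \<tau>) x" by (rule any(3))
    show "ok (sem (BODY r\<delta> rp rb) \<rho>' \<tau>)"
      using ok any by (auto simp: ok_def sem_frame)
    show "covered rb (sem (BODY r\<delta> rp rb) \<rho>' \<tau>) G v v'" if vv: "\<rho>' 18 = v" "\<rho>' 19 = v'" "v < n" "v' < n"
      unfolding covered_def
    proof (intro impI)
      assume a: "\<forall>i<k. G (k + i) \<le> k" and ne: "solset G v v' \<noteq> {}"
      \<comment> \<open>Local to this proof, since the digits and the pair of points are data of the
        running program.\<close>
      interpret fl_body n d C Fc cost k \<delta> \<eta> p M0 B L r\<delta> r\<eta> rp rb G v v'
        using rb assms(5) a vv by unfold_locales auto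
      show "reached (sem (BODY r\<delta> rp rb) \<rho>' \<tau>) (val (solset G v v'))"
        by (rule BODY_solset[OF _ \<tau> ne]) (use env vv in \<open>simp add: envv_def\<close>)
    qed
  qed
  have cov_mono: "covered rb \<tau> G v v' \<Longrightarrow> (\<And>x. reached \<tau> x \<Longrightarrow> reached \<tau>' x) \<Longrightarrow> covered rb \<tau>' G v v'"
    for \<tau> \<tau>' v v' by (auto simp: covered_def)
  define I where "I i \<tau> \<longleftrightarrow> ok \<tau> \<and> (\<forall>v<i. \<forall>v'<n. covered rb \<tau> G v v')" for i \<tau>
  have "I (\<rho> 0) \<sigma>'" unfolding \<sigma>'_def
  proof (rule sem_For_inv)
    show "I 0 \<sigma>" using assms by (simp add: I_def ok_def)
  next
    fix v \<tau> assume v: "v < \<rho> 0" and I: "I v \<tau>"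
    let ?\<rho> = "\<rho>(18 := v)"
    define J where "J i \<tau>' \<longleftrightarrow> I v \<tau>' \<and> (\<forall>v'<i. covered rb \<tau>' G v v')" for i \<tau>'
    have "J (?\<rho> 0) (sem (SFor 19 0 (BODY r\<delta> rp rb)) ?\<rho> \<tau>)"
    proof (rule sem_For_inv)
      show "J 0 \<tau>" using I by (simp add: J_def)
    next
      fix v' \<tau>' assume v': "v' < ?\<rho> 0" and J: "J v' \<tau>'"
      have ok': "ok \<tau>'" using J by (simp add: J_def I_def)
      have env': "env (?\<rho>(19 := v'))" using assms(1) by simp
      note b = body[OF ok' env']
      have "covered rb (sem (BODY r\<delta> rp rb) (?\<rho>(19 := v')) \<tau>') G v v'"
        by (rule b(3)) (use v v' r0 in auto)
      moreover have "covered rb (sem (BODY r\<delta> rp rb) (?\<rho>(19 := v')) \<tau>') G a c"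
        if "covered rb \<tau>' G a c" for a c
        by (rule cov_mono[OF that]) (rule b(2))
      ultimately show "J (Suc v') (sem (BODY r\<delta> rp rb) (?\<rho>(19 := v')) \<tau>')"
        using J b(1) unfolding J_def I_def by (auto simp: less_Suc_eq)
    qed
    then show "I (Suc v) (sem (SFor 19 0 (BODY r\<delta> rp rb)) ?\<rho> \<tau>)"
      by (auto simp: J_def I_def less_Suc_eq r0)
  qed
  then show "safe \<sigma>'" "best_ok \<sigma>'" "\<And>x. reached \<sigma> x \<Longrightarrow> reached \<sigma>' x" "\<forall>v<n. \<forall>v'<n. covered rb \<sigma>' G v v'"
    by (auto simp: I_def ok_def r0)
qed

lemma SEARCH_sem:
  assumes "env \<rho>" "\<rho> 4 = B ^ L" "safe \<sigma>" "best_ok \<sigma>" "\<forall>l. fst \<sigma> 4 l = 0" "0 < B"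
    and rb: "real_of_rat rb = 1 / (1 + p)"
  defines "\<sigma>' \<equiv> sem (SEARCH r\<delta> rp rb) \<rho> \<sigma>"
  shows "best_ok \<sigma>'"
    and "(\<forall>l<L. G l < B) \<Longrightarrow> (\<forall>l\<ge>L. G l = 0) \<Longrightarrow> v < n \<Longrightarrow> v' < n \<Longrightarrow> covered rb \<sigma>' G v v'"
proof -
  define dg where "dg G \<longleftrightarrow> (\<forall>l<L. G l < B) \<and> (\<forall>l\<ge>L. G l = 0)" for G :: "nat \<Rightarrow> nat"
  \<comment> \<open>Strings vanishing beyond \<open>L\<close> are determined by
    \<open>digval\<close>, so the counter identifies those already tried. The clause on the counter
    lapses at \<open>q = B ^ L\<close>, where incrementing overflows.\<close>
  define I where "I q \<tau> \<longleftrightarrow> safe \<tau> \<and> best_ok \<tau> \<and> (q < B ^ L \<longrightarrow> dg (fst \<tau> 4) \<and> digval B (fst \<tau> 4) L = q) \<and>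
    (\<forall>G v v'. dg G \<longrightarrow> digval B G L < q \<longrightarrow> v < n \<longrightarrow> v' < n \<longrightarrow> covered rb \<tau> G v v')" for q \<tau>
  have r: "\<rho> 2 = B" "\<rho> 3 = L" using assms(1) by (auto simp: envD)
  have "I (\<rho> 4) \<sigma>'" unfolding \<sigma>'_def SEARCH_def
  proof (rule sem_For_inv)
    show "I 0 \<sigma>" using assms by (simp add: I_def dg_def digval_def)
  next
    fix q \<tau> assume q: "q < \<rho> 4" and I: "I q \<tau>"
    let ?\<rho> = "\<rho>(20 := q)"
    let ?P = "SFor 18 0 (SFor 19 0 (BODY r\<delta> rp rb))"
    let ?G = "fst \<tau> 4"
    have G: "dg ?G" "digval B ?G L = q" using I q assms(2) by (auto simp: I_def)
    have env: "env ?\<rho>" using assms(1) by simp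
    define \<tau>1 where "\<tau>1 = sem ?P ?\<rho> \<tau>"
    have 1: "safe \<tau>1" "best_ok \<tau>1" "\<And>x. reached \<tau> x \<Longrightarrow> reached \<tau>1 x" "\<forall>v<n. \<forall>v'<n. covered rb \<tau>1 ?G v v'"
      using PAIRS_sem[OF env _ _ refl _ rb, of \<tau>] I G unfolding \<tau>1_def dg_def I_def by auto
    have g1: "fst \<tau>1 4 = ?G" unfolding \<tau>1_def by (simp add: sem_frame)
    define \<tau>2 where "\<tau>2 = sem INC ?\<rho> \<tau>1"
    have s2: "safe \<tau>2" unfolding \<tau>2_def using 1(1) by (rule safe_frame) auto
    have same2: "fst \<tau>2 13 = fst \<tau>1 13" "fst \<tau>2 2 = fst \<tau>1 2" "snd \<tau>2 7 = snd \<tau>1 7"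
      unfolding \<tau>2_def by (simp_all add: sem_frame)
    then have b2: "best_ok \<tau>2" and r2: "reached \<tau>1 x \<Longrightarrow> reached \<tau>2 x" for x
      using 1(2) by (auto simp: best_ok_def Oset_def reached_def)
    have d2: "dg (fst \<tau>2 4) \<and> digval B (fst \<tau>2 4) L = Suc q" if "Suc q < B ^ L"
    proof -
      have "fst \<tau>2 4 l < B" if "l < L" for l unfolding \<tau>2_def
        by (rule INC_sem(1)[where L = L]) (use r G g1 that \<open>Suc q < B ^ L\<close> in \<open>auto simp: dg_def\<close>)
      moreover have "fst \<tau>2 4 l = 0" if "L \<le> l" for l
      proof -
        have "fst \<tau>2 4 l = fst \<tau>1 4 l" unfolding \<tau>2_def
          by (rule INC_sem(3)[where L = L and B = B]) (use r G g1 that \<open>Suc q < B ^ L\<close> in \<open>auto simp: dg_def\<close>)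
        then show ?thesis using g1 G that by (simp add: dg_def)
      qed
      moreover have "digval B (fst \<tau>2 4) L = Suc (digval B (fst \<tau>1 4) L)" unfolding \<tau>2_def
        by (rule INC_sem(2)) (use r G g1 that in \<open>auto simp: dg_def\<close>)
      ultimately show ?thesis using g1 G by (simp add: dg_def)
    qed
    have "covered rb \<tau>2 G' v v'" if "dg G'" "digval B G' L < Suc q" "v < n" "v' < n" for G' v v'
    proof (cases "digval B G' L = q")
      case True
      have "G' l = ?G l" for l
      proof (cases "l < L")
        case less: True
        show ?thesis by (rule digval_inj[where L = L and B = B]) (use that G True less in \<open>auto simp: dg_def\<close>)
      qed (use that G in \<open>auto simp: dg_def\<close>)
      then have "G' = ?G" by (rule ext)
      then show ?thesis using 1(4) that r2 by (auto simp: covered_def)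
    next
      case False
      then have "covered rb \<tau> G' v v'" using that I by (auto simp: I_def)
      then show ?thesis using 1(3) r2 by (auto simp: covered_def)
    qed
    then show "I (Suc q) (sem (?P ;; INC) ?\<rho> \<tau>)"
      using s2 b2 d2 unfolding I_def sem.simps(4) \<tau>2_def \<tau>1_def by auto
  qed
  then have I: "I (B ^ L) \<sigma>'" by (simp only: assms(2))
  then show "best_ok \<sigma>'" by (simp add: I_def)
  show "covered rb \<sigma>' G v v'" if "\<forall>l<L. G l < B" "\<forall>l\<ge>L. G l = 0" "v < n" "v' < n"
    using I that digval_less[of L G B] by (auto simp: I_def dg_def)
qed

end

definition SETUP :: "rat \<Rightarrow> stm" where
  "SETUP r\<eta> = SFor 18 0 (NSt 3 (SUCC (NV 18)) (NPl (NA 3 (NV 18)) (NV 0))) ;;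
     SFor 21 3 (NSt 3 (SUCC (NV 21)) (NPl (NA 3 (NV 21)) (NV 0))) ;;
     RSt 3 (NC 0) (RC 1) ;; SFor 15 2 (RSt 3 (SUCC (NV 15)) (RMu (RA 3 (NV 15)) (RC r\<eta>)))"

text \<open>Without clients the output array stays zero, which decodes to the empty set, of cost 0.
  The constant \<open>rb\<close> serves both as \<eta> and as 1 / (1 + p), because e = p.\<close>

definition MAIN :: "rat \<Rightarrow> rat \<Rightarrow> rat \<Rightarrow> stm" where
  "MAIN r\<delta> rp rb = SIfR (RC 1) (RSum 10 0 (IND (NC 1) (NA 0 (NV 10)))) (SETUP rb ;; SEARCH r\<delta> rp rb) SSkip"

text \<open>Products by repeated addition: array 16 receives \<open>K * (k + 1)\<close>, array 14 is
  doubled until it reaches n, and array 15 grows by one such product per doubling, ending as the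
  base \<open>B\<close>; array 17 becomes the number \<open>L\<close> of digits.\<close>

definition PRELUDE1 :: "nat \<Rightarrow> nat \<Rightarrow> stm" where
  "PRELUDE1 K M0 = NSt 14 (NC 0) (NC 1) ;; NSt 16 (NC 0) (NC K) ;;
     SFor 14 1 (NSt 16 (NC 0) (NPl (N0 16) (NC K))) ;; NSt 15 (NC 0) (N0 16) ;;
     SFor 11 0 (SIfN (SUCC (N0 14)) (NV 0) (NSt 14 (NC 0) (NPl (N0 14) (N0 14)) ;;
       NSt 15 (NC 0) (NPl (N0 15) (N0 16))) SSkip) ;;
     NSt 17 (NC 0) (NC 2) ;; SFor 14 1 (NSt 17 (NC 0) (NPl (N0 17) (NC (3 + M0))))"

definition PRELUDE2 :: stm where
  "PRELUDE2 = NSt 18 (NC 0) (NC 1) ;; SFor 21 3 (NSt 19 (NC 0) (NC 0) ;;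
     SFor 22 2 (NSt 19 (NC 0) (NPl (N0 19) (N0 18))) ;; NSt 18 (NC 0) (N0 19))"

text \<open>The loop language cannot assign loop bounds. Hence the program is cut into three pieces,
  between which computed bounds are moved from arrays into registers 2 to 4.\<close>

definition LOAD :: "nat \<Rightarrow> nat \<Rightarrow> com" where
  "LOAD x A = Seq (NConst 100 0) (NLoad x A 100)"

definition PROGRAM :: "nat \<Rightarrow> nat \<Rightarrow> rat \<Rightarrow> rat \<Rightarrow> rat \<Rightarrow> com" where
  "PROGRAM K M0 r\<delta> rp rb = Seq (cS (PRELUDE1 K M0)) (Seq (LOAD 2 15) (Seq (LOAD 3 17)
     (Seq (cS PRELUDE2) (Seq (LOAD 4 18) (Seq (NConst 5 M0) (cS (MAIN r\<delta> rp rb)))))))"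

lemmas program_defs = MAIN_def SETUP_def SEARCH_def BODY_def INC_def ANCHORS_def STAGE_def WEIGHTS_def
  HIT_def INBALL_def DUMMIES_def GINIT_def GREEDY_def ROUND_def ADD_def SELECT_def COLUMN_def CHOOSE_def
  EVAL_def COST_def UPDATE_def ARGMIN_def UPDMIN_def PRELUDE1_def PRELUDE2_def

lemma wf_program:
  "wfS {0, 1} (PRELUDE1 K M0)" "wfS {0, 1, 2, 3} PRELUDE2" "wfS {0, 1, 2, 3, 4, 5} (MAIN r\<delta> rp rb)"
  by (simp_all add: program_defs)

text \<open>A generous common bound; it becomes the exponent of n in the running time.\<close>

lemma depth_program:
  "depthS (PRELUDE1 K M0) \<le> 12" "depthS PRELUDE2 \<le> 12" "depthS (MAIN r\<delta> rp rb) \<le> 12"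
  by (simp_all add: program_defs)

lemma PRELUDE1_sem:
  fixes \<sigma> :: mem and K M0 :: nat
  assumes "\<rho> 0 = n" "\<rho> 1 = k" "1 \<le> n"
  defines "\<sigma>' \<equiv> sem (PRELUDE1 K M0) \<rho> \<sigma>"
  shows "\<exists>lg. 1 \<le> lg \<and> n < 2 ^ lg \<and> 2 ^ lg \<le> 4 * n \<and> fst \<sigma>' 15 0 = K * (k + 1) * lg"
    and "fst \<sigma>' 17 0 = 3 * k + 2 + M0 * k"
proof -
  let ?F1 = "SFor 14 1 (NSt 16 (NC 0) (NPl (N0 16) (NC K)))"
  let ?F2 = "SFor 11 0 (SIfN (SUCC (N0 14)) (NV 0) (NSt 14 (NC 0) (NPl (N0 14) (N0 14)) ;;
       NSt 15 (NC 0) (NPl (N0 15) (N0 16))) SSkip)"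
  let ?F3 = "SFor 14 1 (NSt 17 (NC 0) (NPl (N0 17) (NC (3 + M0))))"
  define \<sigma>0 where "\<sigma>0 = sem (NSt 16 (NC 0) (NC K)) \<rho> (sem (NSt 14 (NC 0) (NC 1)) \<rho> \<sigma>)"
  define \<sigma>1 where "\<sigma>1 = sem ?F1 \<rho> \<sigma>0"
  define \<sigma>2 where "\<sigma>2 = sem (NSt 15 (NC 0) (N0 16)) \<rho> \<sigma>1"
  define \<sigma>3 where "\<sigma>3 = sem ?F2 \<rho> \<sigma>2"
  define \<sigma>4 where "\<sigma>4 = sem (NSt 17 (NC 0) (NC 2)) \<rho> \<sigma>3"
  have e: "\<sigma>' = sem ?F3 \<rho> \<sigma>4"
    unfolding \<sigma>'_def PRELUDE1_def \<sigma>4_def \<sigma>3_def \<sigma>2_def \<sigma>1_def \<sigma>0_def sem.simps(4) ..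
  define I where "I i \<tau> \<longleftrightarrow> fst \<tau> 14 0 = 1 \<and> fst \<tau> 16 0 = K * (i + 1)" for i :: nat and \<tau> :: mem
  have "I (\<rho> 1) \<sigma>1" unfolding \<sigma>1_def
    by (rule sem_For_inv) (auto simp: I_def \<sigma>0_def)
  then have 2: "fst \<sigma>2 14 0 = 1" "fst \<sigma>2 16 0 = K * (k + 1)" "fst \<sigma>2 15 0 = K * (k + 1)"
    using assms by (auto simp: I_def \<sigma>2_def)
  \<comment> \<open>Either the power has reached n, or each of the \<open>i\<close> iterations has
    doubled it; after n iterations the second case also gives
    \<open>n \<le> l < 2 ^ l\<close>.\<close>
  define J where "J i \<tau> \<longleftrightarrow> fst \<tau> 16 0 = K * (k + 1) \<and> (\<exists>l. fst \<tau> 14 0 = 2 ^ l \<and>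
    fst \<tau> 15 0 = K * (k + 1) * (l + 1) \<and> 2 ^ l < 2 * n \<and> (n \<le> 2 ^ l \<or> i \<le> l))" for i :: nat and \<tau> :: mem
  have "J (\<rho> 0) \<sigma>3" unfolding \<sigma>3_def
  proof (rule sem_For_inv)
    show "J 0 \<sigma>2" using 2 assms(3) by (auto simp: J_def intro!: exI[of _ 0])
  next
    fix i \<tau> assume "J i \<tau>"
    then obtain l where l: "fst \<tau> 16 0 = K * (k + 1)" "fst \<tau> 14 0 = 2 ^ l"
      "fst \<tau> 15 0 = K * (k + 1) * (l + 1)" "2 ^ l < 2 * n" "n \<le> 2 ^ l \<or> i \<le> l" by (auto simp: J_def)
    let ?b = "SIfN (SUCC (N0 14)) (NV 0) (NSt 14 (NC 0) (NPl (N0 14) (N0 14)) ;;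
       NSt 15 (NC 0) (NPl (N0 15) (N0 16))) SSkip"
    show "J (Suc i) (sem ?b (\<rho>(11 := i)) \<tau>)"
    proof (cases "2 ^ l < n")
      case True
      then have "fst (sem ?b (\<rho>(11 := i)) \<tau>) 14 0 = 2 ^ Suc l" "fst (sem ?b (\<rho>(11 := i)) \<tau>) 16 0 = K * (k + 1)"
        "fst (sem ?b (\<rho>(11 := i)) \<tau>) 15 0 = K * (k + 1) * (Suc l + 1)"
        using l assms(1) by (simp_all add: algebra_simps)
      then show ?thesis using True l(5) unfolding J_def by (intro conjI exI[of _ "Suc l"]) auto
    next
      case False
      then have "sem ?b (\<rho>(11 := i)) \<tau> = \<tau>" using l assms(1) by simp
      then show ?thesis using l False unfolding J_def by (intro conjI exI[of _ l]) auto
    qed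
  qed
  then obtain l where l: "fst \<sigma>3 15 0 = K * (k + 1) * (l + 1)" "2 ^ l < 2 * n" "n \<le> 2 ^ l \<or> n \<le> l"
    using assms(1) by (auto simp: J_def)
  have "l < 2 ^ l" by simp
  then have nl: "n \<le> 2 ^ l" using l(3) by linarith
  have "fst \<sigma>' 15 = fst \<sigma>3 15" unfolding e \<sigma>4_def by (simp add: sem_frame)
  moreover have "0 < (2::nat) ^ l" by simp
  ultimately show "\<exists>lg. 1 \<le> lg \<and> n < 2 ^ lg \<and> 2 ^ lg \<le> 4 * n \<and> fst \<sigma>' 15 0 = K * (k + 1) * lg"
    using l(1,2) nl by (intro exI[of _ "l + 1"]) auto
  define H where "H i \<tau> \<longleftrightarrow> fst \<tau> 17 0 = 2 + i * (3 + M0)" for i :: nat and \<tau> :: mem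
  have "H (\<rho> 1) \<sigma>'" unfolding e
    by (rule sem_For_inv) (auto simp: H_def \<sigma>4_def)
  then show "fst \<sigma>' 17 0 = 3 * k + 2 + M0 * k" using assms(2) by (simp add: H_def algebra_simps)
qed

lemma PRELUDE2_sem:
  assumes "\<rho> 2 = B" "\<rho> 3 = L" shows "fst (sem PRELUDE2 \<rho> \<sigma>) 18 0 = B ^ L"
proof -
  define I where "I i \<tau> \<longleftrightarrow> fst \<tau> 18 0 = B ^ i" for i :: nat and \<tau> :: mem
  have "I (\<rho> 3) (sem PRELUDE2 \<rho> \<sigma>)" unfolding PRELUDE2_def sem.simps(4)
  proof (rule sem_For_inv)
    show "I 0 (sem (NSt 18 (NC 0) (NC 1)) \<rho> \<sigma>)" by (simp add: I_def)
  next
    fix i \<tau> assume I: "I i \<tau>"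
    let ?\<rho> = "\<rho>(21 := i)"
    let ?F = "SFor 22 2 (NSt 19 (NC 0) (NPl (N0 19) (N0 18)))"
    define \<tau>1 where "\<tau>1 = sem ?F ?\<rho> (sem (NSt 19 (NC 0) (NC 0)) ?\<rho> \<tau>)"
    define J where "J u \<tau>' \<longleftrightarrow> fst \<tau>' 18 0 = B ^ i \<and> fst \<tau>' 19 0 = u * B ^ i" for u :: nat and \<tau>' :: mem
    have "J (?\<rho> 2) \<tau>1" unfolding \<tau>1_def
      by (rule sem_For_inv) (use I in \<open>auto simp: J_def I_def\<close>)
    moreover have "sem (NSt 19 (NC 0) (NC 0) ;; ?F ;; NSt 18 (NC 0) (N0 19)) ?\<rho> \<tau> =
        sem (NSt 18 (NC 0) (N0 19)) ?\<rho> \<tau>1" unfolding \<tau>1_def sem.simps(4) ..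
    ultimately show "I (Suc i) (sem (NSt 19 (NC 0) (NC 0) ;; ?F ;; NSt 18 (NC 0) (N0 19)) ?\<rho> \<tau>)"
      using assms(1) by (simp add: I_def J_def)
  qed
  then show ?thesis using assms by (simp add: I_def)
qed

lemma wr_prelude [simp]:
  "wrN (PRELUDE1 K M0) = {14, 15, 16, 17}" "wrR (PRELUDE1 K M0) = {}"
  "wrN PRELUDE2 = {18, 19}" "wrR PRELUDE2 = {}" "wrN (SETUP r) = {3}" "wrR (SETUP r) = {3}"
  by (auto simp: PRELUDE1_def PRELUDE2_def SETUP_def)

lemma (in fl_prog) SETUP_sem:
  assumes "env \<rho>" "fst \<sigma> 0 = (\<lambda>v. if v \<in> C then 1 else 0)" "fst \<sigma> 1 = (\<lambda>v. if v \<in> Fc then 1 else 0)"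
    and "fst \<sigma> 3 0 = 0" "\<forall>u<n. \<forall>w<n. snd \<sigma> 0 (u * n + w) = d u w" "\<forall>f\<in>Fc. snd \<sigma> 1 f = cost f"
  shows "ready (sem (SETUP r\<eta>) \<rho> \<sigma>)"
proof -
  note r = envD[OF assms(1)]
  let ?F1 = "SFor 18 0 (NSt 3 (SUCC (NV 18)) (NPl (NA 3 (NV 18)) (NV 0)))"
  let ?F2 = "SFor 21 3 (NSt 3 (SUCC (NV 21)) (NPl (NA 3 (NV 21)) (NV 0)))"
  let ?F3 = "SFor 15 2 (RSt 3 (SUCC (NV 15)) (RMu (RA 3 (NV 15)) (RC r\<eta>)))"
  define \<sigma>1 where "\<sigma>1 = sem ?F1 \<rho> \<sigma>"
  define \<sigma>2 where "\<sigma>2 = sem ?F2 \<rho> \<sigma>1"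
  define \<sigma>3 where "\<sigma>3 = sem (RSt 3 (NC 0) (RC 1)) \<rho> \<sigma>2"
  have e: "sem (SETUP r\<eta>) \<rho> \<sigma> = sem ?F3 \<rho> \<sigma>3"
    unfolding SETUP_def \<sigma>3_def \<sigma>2_def \<sigma>1_def sem.simps(4) ..
  define I where "I m i \<tau> \<longleftrightarrow> (\<forall>u. u \<le> m \<or> u \<le> i \<longrightarrow> fst \<tau> 3 u = u * n)" for m i :: nat and \<tau> :: mem
  have "I 0 (\<rho> 0) \<sigma>1" unfolding \<sigma>1_def
    by (rule sem_For_inv) (use assms(4) r in \<open>auto simp: I_def le_Suc_eq\<close>)
  then have 1: "I n 0 \<sigma>1" by (auto simp: I_def r)
  have "I n (\<rho> 3) \<sigma>2" unfolding \<sigma>2_def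
    by (rule sem_For_inv) (use 1 r in \<open>auto simp: I_def le_Suc_eq\<close>)
  then have 2: "u < n \<or> u < L \<Longrightarrow> fst \<sigma>2 3 u = u * n" for u by (auto simp: I_def r)
  define J where "J i \<tau> \<longleftrightarrow> (\<forall>t\<le>i. snd \<tau> 3 t = \<eta> ^ t)" for i :: nat and \<tau> :: mem
  have "J (\<rho> 2) (sem ?F3 \<rho> \<sigma>3)"
    by (rule sem_For_inv) (auto simp: J_def le_Suc_eq \<sigma>3_def r\<eta>)
  then have 3: "t < B \<Longrightarrow> snd (sem ?F3 \<rho> \<sigma>3) 3 t = \<eta> ^ t" for t by (auto simp: J_def r)
  have "fst (sem ?F3 \<rho> \<sigma>3) 3 = fst \<sigma>2 3" by (simp add: sem_frame \<sigma>3_def)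
  moreover have "fst (sem (SETUP r\<eta>) \<rho> \<sigma>) 0 = fst \<sigma> 0" "fst (sem (SETUP r\<eta>) \<rho> \<sigma>) 1 = fst \<sigma> 1"
    "snd (sem (SETUP r\<eta>) \<rho> \<sigma>) 0 = snd \<sigma> 0" "snd (sem (SETUP r\<eta>) \<rho> \<sigma>) 1 = snd \<sigma> 1"
    by (simp_all add: sem_frame)
  ultimately show ?thesis using assms 2 3 unfolding ready_def e by simp
qed

section \<open>Running the program\<close>

lemma LOAD_exec:
  assumes "corresponds X \<rho> \<sigma> s" "X \<subseteq> {..<100}" "x < 100"
  shows "\<exists>s'. exec (LOAD x A) s 2 s' \<and> corresponds (insert x X) (\<rho>(x := fst \<sigma> A 0)) \<sigma> s'"
proof -
  let ?s1 = "set_nreg 100 0 s"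
  let ?s = "set_nreg x (narr ?s1 A (nreg ?s1 100)) ?s1"
  have "exec (LOAD x A) s (1 + 1) ?s" unfolding LOAD_def by (rule exec.Seq[OF exec.NConst exec.NLoad])
  moreover have "corresponds (insert x X) (\<rho>(x := fst \<sigma> A 0)) \<sigma> ?s"
    using assms by (auto simp: corresponds_def set_nreg_def)
  ultimately show ?thesis by (auto simp: numeral_2_eq_2)
qed

lemma NConst_exec:
  assumes "corresponds X \<rho> \<sigma> s"
  shows "\<exists>s'. exec (NConst x a) s 1 s' \<and> corresponds (insert x X) (\<rho>(x := a)) \<sigma> s'"
  using assms by (intro exI[of _ "set_nreg x a s"] conjI exec.NConst) (auto simp: corresponds_def set_nreg_def)

lemma PROGRAM_exec:
  assumes s: "corresponds {0, 1} \<rho> \<sigma> s" and \<rho>: "\<rho> = (\<lambda>_. 0)(0 := n, 1 := k)" and n: "1 \<le> n"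
  shows "\<exists>lg B L. 1 \<le> lg \<and> n < 2 ^ lg \<and> 2 ^ lg \<le> 4 * n \<and> B = K * (k + 1) * lg \<and> L = 3 * k + 2 + M0 * k \<and>
    (\<forall>m. n + k + B + L + B ^ L + M0 \<le> m \<longrightarrow>
      (\<exists>s' t. exec (PROGRAM K M0 r\<delta> rp rb) s t s' \<and>
         t \<le> tS m (PRELUDE1 K M0) + tS m PRELUDE2 + tS m (MAIN r\<delta> rp rb) + 7 \<and>
         corresponds {0, 1, 2, 3, 4, 5} (\<rho>(2 := B, 3 := L, 4 := B ^ L, 5 := M0))
           (sem (MAIN r\<delta> rp rb) (\<rho>(2 := B, 3 := L, 4 := B ^ L, 5 := M0))
              (sem PRELUDE2 (\<rho>(2 := B, 3 := L)) (sem (PRELUDE1 K M0) \<rho> \<sigma>))) s'))"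
proof -
  define \<sigma>1 where "\<sigma>1 = sem (PRELUDE1 K M0) \<rho> \<sigma>"
  have r: "\<rho> 0 = n" "\<rho> 1 = k" by (auto simp: \<rho>)
  obtain lg where lg: "1 \<le> lg" "n < 2 ^ lg" "2 ^ lg \<le> 4 * n" "fst \<sigma>1 15 0 = K * (k + 1) * lg"
    using PRELUDE1_sem(1)[OF r n] unfolding \<sigma>1_def by blast
  define B L where "B = K * (k + 1) * lg" and "L = 3 * k + 2 + M0 * k"
  have L: "fst \<sigma>1 17 0 = L" unfolding \<sigma>1_def L_def by (rule PRELUDE1_sem(2)[OF r n])
  have B: "fst \<sigma>1 15 0 = B" using lg by (simp add: B_def)
  let ?\<rho>1 = "\<rho>(2 := B, 3 := L)" let ?\<rho>2 = "\<rho>(2 := B, 3 := L, 4 := B ^ L, 5 := M0)"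
  define \<sigma>2 where "\<sigma>2 = sem PRELUDE2 ?\<rho>1 \<sigma>1"
  have Z: "fst \<sigma>2 18 0 = B ^ L" unfolding \<sigma>2_def by (rule PRELUDE2_sem) auto
  have "\<exists>s' t. exec (PROGRAM K M0 r\<delta> rp rb) s t s' \<and>
         t \<le> tS m (PRELUDE1 K M0) + tS m PRELUDE2 + tS m (MAIN r\<delta> rp rb) + 7 \<and>
         corresponds {0, 1, 2, 3, 4, 5} ?\<rho>2 (sem (MAIN r\<delta> rp rb) ?\<rho>2 \<sigma>2) s'"
    if m: "n + k + B + L + B ^ L + M0 \<le> m" for m
  proof -
    have b: "\<forall>y<10. \<rho> y \<le> m" "\<forall>y<10. ?\<rho>1 y \<le> m" "\<forall>y<10. ?\<rho>2 y \<le> m" using m by (auto simp: \<rho>)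
    have sub: "{0, 1} \<subseteq> {..<100::nat}" "{0, 1, 2, 3} \<subseteq> {..<100::nat}" "{0, 1, 2, 3, 4, 5} \<subseteq> {..<100::nat}"
      by auto
    obtain s1 t1 where 1: "exec (cS (PRELUDE1 K M0)) s t1 s1" "t1 \<le> tS m (PRELUDE1 K M0)"
      "corresponds {0, 1} \<rho> \<sigma>1 s1"
      using cS_correct[OF wf_program(1)[of K M0] sub(1) s b(1)] unfolding \<sigma>1_def by blast
    obtain s2 where 2: "exec (LOAD 2 15) s1 2 s2" "corresponds (insert 2 {0, 1}) (\<rho>(2 := fst \<sigma>1 15 0)) \<sigma>1 s2"
      using LOAD_exec[OF 1(3), of 2 15] by auto
    obtain s3 where 3: "exec (LOAD 3 17) s2 2 s3"
      "corresponds (insert 3 (insert 2 {0, 1})) (\<rho>(2 := fst \<sigma>1 15 0, 3 := fst \<sigma>1 17 0)) \<sigma>1 s3"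
      using LOAD_exec[OF 2(2), of 3 17] by auto
    have X3: "insert 3 (insert 2 {0, 1}) = {0, 1, 2, 3 :: nat}" by auto
    have c3: "corresponds {0, 1, 2, 3} ?\<rho>1 \<sigma>1 s3" using 3(2) unfolding X3 B L .
    obtain s4 t4 where 4: "exec (cS PRELUDE2) s3 t4 s4" "t4 \<le> tS m PRELUDE2"
      "corresponds {0, 1, 2, 3} ?\<rho>1 \<sigma>2 s4"
      using cS_correct[OF wf_program(2) sub(2) c3 b(2)] unfolding \<sigma>2_def by blast
    obtain s5 where 5: "exec (LOAD 4 18) s4 2 s5"
      "corresponds (insert 4 {0, 1, 2, 3}) (?\<rho>1(4 := fst \<sigma>2 18 0)) \<sigma>2 s5"
      using LOAD_exec[OF 4(3), of 4 18] by auto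
    obtain s6 where 6: "exec (NConst 5 M0) s5 1 s6"
      "corresponds (insert 5 (insert 4 {0, 1, 2, 3})) (?\<rho>1(4 := fst \<sigma>2 18 0, 5 := M0)) \<sigma>2 s6"
      using NConst_exec[OF 5(2)] by blast
    have X6: "insert 5 (insert 4 {0, 1, 2, 3}) = {0, 1, 2, 3, 4, 5 :: nat}" by auto
    have c6: "corresponds {0, 1, 2, 3, 4, 5} ?\<rho>2 \<sigma>2 s6" using 6(2) unfolding X6 Z .
    obtain s7 t7 where 7: "exec (cS (MAIN r\<delta> rp rb)) s6 t7 s7" "t7 \<le> tS m (MAIN r\<delta> rp rb)"
      "corresponds {0, 1, 2, 3, 4, 5} ?\<rho>2 (sem (MAIN r\<delta> rp rb) ?\<rho>2 \<sigma>2) s7"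
      using cS_correct[OF wf_program(3)[of r\<delta> rp rb] sub(3) c6 b(3)] by blast
    have "exec (PROGRAM K M0 r\<delta> rp rb) s (t1 + (2 + (2 + (t4 + (2 + (1 + t7)))))) s7"
      unfolding PROGRAM_def
      by (rule exec.Seq[OF 1(1) exec.Seq[OF 2(1) exec.Seq[OF 3(1) exec.Seq[OF 4(1)
            exec.Seq[OF 5(1) exec.Seq[OF 6(1) 7(1)]]]]]])
    then show ?thesis using 1(2) 4(2) 7(2,3) by - (intro exI conjI, assumption, auto)
  qed
  then show ?thesis using lg(1-3) B_def L_def unfolding \<sigma>2_def \<sigma>1_def by blast
qed

text \<open>Raise \<open>x \<le> L * (x div L + 1) \<le> L * 2 ^ (x div L)\<close> to the power
  \<open>L\<close>. For \<open>x = lg\<close> this makes the number \<open>B ^ L\<close> of digit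
  strings linear in n up to a function of k.\<close>

lemma power_le_exp2:
  assumes "1 \<le> L" shows "x ^ L \<le> L ^ L * (2::nat) ^ x"
proof -
  have "x \<le> L * (x div L + 1)" using assms dividend_less_times_div[of L x] by simp
  also have "\<dots> \<le> L * 2 ^ (x div L)" by (intro mult_le_mono2) (simp add: Suc_le_eq)
  finally have "x ^ L \<le> (L * 2 ^ (x div L)) ^ L" by (rule power_mono) simp
  also have "\<dots> = L ^ L * 2 ^ (x div L * L)" by (simp add: power_mult_distrib power_mult)
  also have "\<dots> \<le> L ^ L * 2 ^ x" by (intro mult_le_mono2 power_increasing) auto
  finally show ?thesis .
qed

text \<open>The argument of \<open>tS\<close> exceeds all loop bounds and is itself at most
  \<open>w k L * n\<close>.\<close>

lemma time_bound:
  "\<exists>g :: nat \<Rightarrow> nat. \<forall>n k lg B L. 1 \<le> n \<longrightarrow> 1 \<le> lg \<longrightarrow> 2 ^ lg \<le> 4 * n \<longrightarrow> B = K * (k + 1) * lg \<longrightarrow>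
     L = 3 * k + 2 + M0 * k \<longrightarrow>
     tS (n + k + B + L + B ^ L + M0) (PRELUDE1 K M0) + tS (n + k + B + L + B ^ L + M0) PRELUDE2 +
     tS (n + k + B + L + B ^ L + M0) (MAIN r\<delta> rp rb) + 7 \<le> g k * n ^ 12"
proof -
  have "poly_bounded 12 (\<lambda>m. tS m (PRELUDE1 K M0) + tS m PRELUDE2 + tS m (MAIN r\<delta> rp rb) + 7)"
    by (intro poly_bounded_add poly_bounded_const poly_bounded_mono[OF tS_poly_bounded] depth_program)
  then obtain a where a: "\<And>m. 1 \<le> m \<Longrightarrow> tS m (PRELUDE1 K M0) + tS m PRELUDE2 + tS m (MAIN r\<delta> rp rb) + 7 \<le> a * m ^ 12"
    unfolding poly_bounded_def by blast
  define w where "w k L = 1 + k + 2 * (K * (k + 1)) ^ L * L ^ L * 4 + K * (k + 1) + L + M0 + 1" for k L :: nat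
  have "tS (n + k + B + L + B ^ L + M0) (PRELUDE1 K M0) + tS (n + k + B + L + B ^ L + M0) PRELUDE2 +
     tS (n + k + B + L + B ^ L + M0) (MAIN r\<delta> rp rb) + 7 \<le> (a * w k (3 * k + 2 + M0 * k) ^ 12) * n ^ 12"
    if h: "1 \<le> n" "1 \<le> lg" "2 ^ lg \<le> 4 * n" "B = K * (k + 1) * lg" "L = 3 * k + 2 + M0 * k" for n k lg B L
  proof -
    have L1: "1 \<le> L" using h by simp
    have "lg ^ L \<le> L ^ L * (4 * n)" using power_le_exp2[OF L1, of lg] h(3) by (meson le_trans mult_le_mono2)
    then have "B ^ L \<le> (K * (k + 1)) ^ L * (L ^ L * (4 * n))"
      unfolding h(4) power_mult_distrib[of "K * (k + 1)" lg] by (rule mult_le_mono2)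
    then have BL: "B ^ L \<le> ((K * (k + 1)) ^ L * L ^ L * 4) * n" by (simp add: mult.assoc)
    have BB: "B \<le> B ^ L" using L1 by (cases "B = 0") (auto intro: self_le_power)
    have "k \<le> k * n" "L \<le> L * n" "M0 \<le> M0 * n" using h(1) by auto
    then have "n + k + B + L + B ^ L + M0 \<le> n + k * n + L * n + M0 * n + 2 * (((K * (k + 1)) ^ L * L ^ L * 4) * n)"
      using BL BB by linarith
    also have "\<dots> \<le> w k L * n" unfolding w_def by (simp only: add_mult_distrib mult.assoc mult_1)
    finally have m: "n + k + B + L + B ^ L + M0 \<le> w k L * n" .
    have "tS (n + k + B + L + B ^ L + M0) (PRELUDE1 K M0) + tS (n + k + B + L + B ^ L + M0) PRELUDE2 +
     tS (n + k + B + L + B ^ L + M0) (MAIN r\<delta> rp rb) + 7 \<le> a * (n + k + B + L + B ^ L + M0) ^ 12"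
      using h(1) by (intro a) simp
    also have "\<dots> \<le> a * (w k L * n) ^ 12" using m by (intro mult_le_mono2 power_mono) auto
    also have "\<dots> = (a * w k L ^ 12) * n ^ 12" by (simp only: power_mult_distrib mult.assoc)
    finally show ?thesis unfolding h(5) .
  qed
  then show ?thesis by (intro exI[of _ "\<lambda>k. a * w k (3 * k + 2 + M0 * k) ^ 12"]) blast
qed

section \<open>Correctness\<close>

lemma (in fl_model) solset_cong:
  assumes "\<And>l. l < 3 * k + 2 + M0 * k \<Longrightarrow> G l = G' l"
  shows "solset G v v' = solset G' v v'"
proof -
  have g: "glist G v v' = glist G' v v'" using assms by (intro glist_cong) auto
  have "length (glist G' v v') = rounds G' * classes G'" by (simp add: glist_def)
  also have "\<dots> \<le> M0 * k" by (intro mult_le_mono) (auto simp: rounds_def classes_def)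
  finally have "G (3 * k + 2 + l) = G' (3 * k + 2 + l)" if "l < length (glist G' v v')" for l
    using that assms by auto
  then show ?thesis unfolding solset_def g by (auto simp del: add_2_eq_Suc')
qed

lemma SEARCH_solution:
  assumes cl: "fl_clusters n d C Fc cost k \<delta> \<eta> p M0 k' fs \<phi> e B N"
    and pr: "fl_prog n d C Fc cost k \<delta> \<eta> p M0 L r\<delta> r\<eta> rp"
    and rb: "real_of_rat rb = 1 / (1 + p)"
    and \<rho>: "fl_prog.env n k M0 B L \<rho>" "\<rho> 4 = B ^ L"
    and \<sigma>: "fl_prog.ready n d C Fc cost \<eta> B L \<sigma>"
      "\<forall>A\<in>{4, 7, 13}. \<forall>l. fst \<sigma> A l = 0"
    and Out: "Out = {f. f < n \<and> fst (sem (SEARCH r\<delta> rp rb) \<rho> \<sigma>) 2 f \<noteq> 0}"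
  shows "Out \<noteq> {} \<and> Out \<subseteq> Fc \<and> fl_model.val d C cost Out \<le> (alpha_FL + 5 / N + 10 * e) *
    ((\<Sum>i<k'. cost (fs i)) + (\<Sum>j\<in>C. d j (fs (\<phi> j))))"
proof -
  interpret cl: fl_clusters n d C Fc cost k \<delta> \<eta> p M0 k' fs \<phi> e B N by (rule cl)
  interpret pr: fl_prog n d C Fc cost k \<delta> \<eta> p M0 B L r\<delta> r\<eta> rp by (rule pr)
  obtain G v v' where G: "\<forall>l. G l < B" "\<forall>i<k. G (k + i) \<le> k" "v < n" "v' < n" "cl.solset G v v' \<noteq> {}"
    "cl.val (cl.solset G v v') \<le> (alpha_FL + 5 / N + 10 * e) * (cl.Oc + cl.Cst)"
    using cl.solution_exists by blast
  define G' where "G' l = (if l < L then G l else 0)" for l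
  have sol: "cl.solset G' v v' = cl.solset G v v'"
    by (intro cl.solset_cong) (auto simp: G'_def pr.L)
  have a: "\<forall>i<k. G' (k + i) \<le> k" using G(2) by (simp add: G'_def)
  let ?s = "sem (SEARCH r\<delta> rp rb) \<rho> \<sigma>"
  have s: "pr.safe \<sigma>" "pr.best_ok \<sigma>" "\<forall>l. fst \<sigma> 4 l = 0"
    using \<sigma> by (auto simp: pr.safe_def pr.best_ok_def)
  have B0: "0 < B" using cl.B(3) by simp
  have "pr.covered rb ?s G' v v'"
    by (rule pr.SEARCH_sem(2)[OF \<rho> s B0 rb]) (use G in \<open>auto simp: G'_def\<close>)
  then have r: "pr.reached ?s (cl.val (cl.solset G v v'))" using a G(5) sol by (simp add: pr.covered_def)
  have "pr.best_ok ?s" by (rule pr.SEARCH_sem(1)[OF \<rho> s B0 rb])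
  then have "pr.Oset ?s \<noteq> {} \<and> pr.Oset ?s \<subseteq> Fc \<and> snd ?s 7 0 = cl.val (pr.Oset ?s)"
    using r by (simp add: pr.best_ok_def pr.reached_def)
  moreover have "pr.Oset ?s = Out" by (simp add: pr.Oset_def Out)
  ultimately show ?thesis using r G(6) by (simp add: pr.reached_def cl.Oc_def cl.Cst_def)
qed

text \<open>The radii need \<open>(1 + e) ^ (B - 1)\<close> to be at least \<open>n * N\<close>; by
  Bernoulli \<open>(1 + e) ^ N \<ge> 2\<close>, so \<open>lg + N\<close> doublings suffice.\<close>

lemma parameters:
  fixes N k n B lg :: nat and e :: real
  assumes "1 \<le> N" "1 \<le> k" "1 \<le> lg" "1 \<le> n" "n < 2 ^ lg" "B = 48 * N ^ 3 * (k + 1) * lg"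
    and e: "e = 1 / real N"
  shows "(1 - e ^ 3 / (48 * real k)) ^ B * n < 1" "n \<le> e * (1 + e) ^ (B - 1)" "k < B" "4 * N + 5 < B"
proof -
  define \<delta> where "\<delta> = e ^ 3 / (48 * real k)"
  have N3: "1 \<le> N ^ 3" "N \<le> N ^ 3" "N * N \<le> N ^ 3" using assms(1) by (auto simp: power3_eq_cube)
  have b: "48 * N ^ 3 * ((k + 1) * lg) = B" using assms(6) by (simp only: mult.assoc)
  have kl: "k + 1 \<le> (k + 1) * lg" using mult_le_mono2[OF assms(3), of "k + 1"] by simp
  have kl': "lg \<le> (k + 1) * lg" "2 \<le> (k + 1) * lg" using kl assms(2) by (simp, linarith)
  have N0: "real N \<noteq> 0" using assms by simp
  have "k + 1 \<le> B" unfolding b[symmetric] using mult_le_mono[of 1 "48 * N ^ 3", OF _ kl] N3 by simp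
  then show "k < B" by simp
  have "48 * N ^ 3 * 2 \<le> B" unfolding b[symmetric] using kl'(2) by (intro mult_le_mono2)
  then show "4 * N + 5 < B" using N3 by linarith
  have "\<delta> \<le> 1"
  proof -
    have "e ^ 3 \<le> 1" using assms by (intro power_le_one) auto
    then show ?thesis using assms unfolding \<delta>_def by (simp add: divide_le_eq)
  qed
  \<comment> \<open>The factor \<open>48 * N ^ 3\<close> in \<open>B\<close> cancels
    \<open>e ^ 3 / 48\<close>, leaving \<open>(k + 1) / k * lg\<close>. Then
    \<open>(1 - \<delta>) ^ B \<le> exp (- real lg)\<close>, which is below
    \<open>1 / n\<close>.\<close>
  have dB: "real lg \<le> \<delta> * B"
  proof -
    define q where "q = (real k + 1) * real lg"
    have q: "real B = 48 * real N ^ 3 * q" unfolding b[symmetric] q_def by (simp add: ring_distribs)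
    have "real lg \<le> q / real k" using assms by (simp add: q_def field_simps)
    also have "\<dots> = \<delta> * B" unfolding q using N0 by (simp add: \<delta>_def e power_divide)
    finally show ?thesis .
  qed
  have "(1 - \<delta>) ^ B \<le> exp (- \<delta>) ^ B"
    using \<open>\<delta> \<le> 1\<close> exp_ge_add_one_self[of "- \<delta>"] by (intro power_mono) auto
  also have "\<dots> = exp (- (\<delta> * B))" by (simp add: exp_of_nat_mult[symmetric] mult.commute)
  also have "\<dots> \<le> exp (- real lg)" using dB by simp
  finally have 1: "(1 - \<delta>) ^ B \<le> exp (- real lg)" .
  have "real n < 2 ^ lg" using assms(5) by (metis of_nat_less_iff of_nat_numeral of_nat_power)
  also have "(2::real) ^ lg \<le> exp 1 ^ lg" using exp_ge_add_one_self[of 1] by (intro power_mono) auto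
  also have "\<dots> = exp (real lg)" by (simp add: exp_of_nat_mult[symmetric])
  finally have 2: "real n < exp (real lg)" .
  have "(1 - \<delta>) ^ B * n \<le> exp (- real lg) * n" using 1 by (intro mult_right_mono) auto
  also have "\<dots> < exp (- real lg) * exp (real lg)" using 2 by (intro mult_strict_left_mono) auto
  also have "\<dots> = 1" by (simp add: exp_minus)
  finally show "(1 - e ^ 3 / (48 * real k)) ^ B * n < 1" by (simp add: \<delta>_def)
  have e0: "0 < e" using assms by simp
  \<comment> \<open>Each doubling takes \<open>N\<close> factors \<open>1 + e\<close>:
    \<open>lg\<close> of them exceed n and \<open>N\<close> of them exceed
    \<open>N = 1 / e\<close>.\<close>
  have "N * (lg + N) + 1 \<le> 48 * N ^ 3 * lg"
  proof -
    define X where "X = N ^ 3 * lg"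
    have "N * lg \<le> X" "N * N * 1 \<le> X" "1 * 1 \<le> X"
      unfolding X_def by (rule mult_le_mono; use N3 assms in simp)+
    then have "N * (lg + N) + 1 \<le> 48 * X" unfolding add_mult_distrib2 by linarith
    then show ?thesis by (simp only: X_def mult.assoc)
  qed
  also have "\<dots> \<le> B" unfolding b[symmetric] using kl'(1) by (intro mult_le_mono2)
  finally have Bl: "N * (lg + N) \<le> B - 1" by linarith
  have "(2::real) \<le> 1 + real N * e" using N0 by (simp add: e)
  also have "\<dots> \<le> (1 + e) ^ N" using e0 by (intro Bernoulli_inequality) auto
  finally have two: "2 \<le> (1 + e) ^ N" .
  have "real n \<le> 2 ^ lg" using assms(5) by (metis less_imp_le of_nat_le_iff of_nat_numeral of_nat_power)
  also have "\<dots> \<le> 2 ^ lg * (e * 2 ^ N)"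
  proof -
    have "real N \<le> 2 ^ N" using less_exp[of N] by (metis less_imp_le of_nat_le_iff of_nat_numeral of_nat_power)
    then have "1 \<le> e * 2 ^ N" using assms N0 by (simp add: e field_simps)
    then show ?thesis by simp
  qed
  also have "\<dots> = e * 2 ^ (lg + N)" by (simp add: power_add)
  also have "\<dots> \<le> e * ((1 + e) ^ N) ^ (lg + N)" using two e0 by (intro mult_left_mono power_mono) auto
  also have "\<dots> = e * (1 + e) ^ (N * (lg + N))" by (simp add: power_mult)
  also have "\<dots> \<le> e * (1 + e) ^ (B - 1)" using Bl e0 by (intro mult_left_mono power_increasing) auto
  finally show "n \<le> e * (1 + e) ^ (B - 1)" .
qed

lemma finite_solution:
  assumes I: "fl_instance I" and S: "fl_solution I S" shows "finite S"
proof -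
  have "S \<subseteq> points I" using assms by (auto simp: fl_instance_def fl_solution_def)
  moreover have "finite (points I)" using I by (simp add: fl_instance_def)
  ultimately show ?thesis by (rule finite_subset)
qed

lemma fl_cost_nonneg:
  assumes I: "fl_instance I" and S: "fl_solution I S"
  shows "0 \<le> fl_cost I S"
proof -
  have fin: "finite S" by (rule finite_solution[OF I S])
  have "0 \<le> dist_to_set I j S" if "j \<in> clients I" for j
  proof -
    have "S \<noteq> {}" using S that by (auto simp: fl_solution_def)
    then have "dist_to_set I j S \<in> (\<lambda>f. distance I j f) ` S"
      unfolding dist_to_set_def using fin by (intro Min_in) auto
    then show ?thesis using I by (auto simp: fl_instance_def Metric_space.nonneg)
  qed
  moreover have "0 \<le> open_cost I f" if "f \<in> S" for f
    using I S that by (auto simp: fl_instance_def fl_solution_def)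
  ultimately show ?thesis unfolding fl_cost_def by (intro add_nonneg_nonneg sum_nonneg)
qed

text \<open>Facilities serving no client are dropped, which does not raise the cost since opening
  costs are nonnegative. So \<open>k'\<close> may be smaller than the parameter, and the program has
  to guess it.\<close>

lemma solution_clusters:
  assumes I: "fl_instance I" and S: "fl_solution I S" and C: "clients I \<noteq> {}"
  obtains k' :: nat and fs :: "nat \<Rightarrow> 'a" and \<phi> :: "'a \<Rightarrow> nat"
  where "1 \<le> k'" "k' \<le> card S" "\<And>i. i < k' \<Longrightarrow> fs i \<in> S" "\<And>j. j \<in> clients I \<Longrightarrow> \<phi> j < k'"
    "\<And>i. i < k' \<Longrightarrow> \<exists>j\<in>clients I. \<phi> j = i"
    "(\<Sum>i<k'. open_cost I (fs i)) + (\<Sum>j\<in>clients I. distance I j (fs (\<phi> j))) \<le> fl_cost I S"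
proof -
  have fin: "finite S" "S \<noteq> {}" using finite_solution[OF I S] S C by (auto simp: fl_solution_def)
  have "\<exists>f\<in>S. dist_to_set I j S = distance I j f" for j
  proof -
    have "dist_to_set I j S \<in> (\<lambda>f. distance I j f) ` S" unfolding dist_to_set_def using fin by (intro Min_in) auto
    then show ?thesis by blast
  qed
  then obtain \<psi> where \<psi>: "\<And>j. \<psi> j \<in> S" "\<And>j. dist_to_set I j S = distance I j (\<psi> j)" by metis
  define U where "U = \<psi> ` clients I"
  have U: "U \<noteq> {}" "U \<subseteq> S" using C \<psi>(1) by (auto simp: U_def)
  have finU: "finite U" by (rule finite_subset[OF U(2) fin(1)])
  obtain fs where fs: "bij_betw fs {0..<card U} U" using ex_bij_betw_nat_finite[OF finU] by blast
  have fs': "bij_betw fs {..<card U} U" using fs by (simp add: lessThan_atLeast0)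
  define \<phi> where "\<phi> j = inv_into {..<card U} fs (\<psi> j)" for j
  have ph: "\<phi> j < card U" "fs (\<phi> j) = \<psi> j" if "j \<in> clients I" for j
  proof -
    have "\<psi> j \<in> fs ` {..<card U}" using that fs' by (simp add: U_def bij_betw_def)
    then show "\<phi> j < card U" "fs (\<phi> j) = \<psi> j"
      unfolding \<phi>_def using inv_into_into[of "\<psi> j" fs "{..<card U}"] f_inv_into_f[of "\<psi> j" fs "{..<card U}"] by auto
  qed
  show ?thesis
  proof (rule that[of "card U" fs \<phi>])
    show "1 \<le> card U" using U(1) finU by (simp add: Suc_le_eq card_gt_0_iff)
    show "card U \<le> card S" by (rule card_mono[OF fin(1) U(2)])
    show "fs i \<in> S" if "i < card U" for i using that fs' U(2) by (auto simp: bij_betw_def)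
    show "\<phi> j < card U" if "j \<in> clients I" for j by (rule ph[OF that])
    show "\<exists>j\<in>clients I. \<phi> j = i" if i: "i < card U" for i
    proof -
      have "fs i \<in> U" using i fs' by (auto simp: bij_betw_def)
      then obtain j where j: "j \<in> clients I" "fs i = \<psi> j" by (auto simp: U_def)
      then have "\<phi> j = i" unfolding \<phi>_def j(2)[symmetric]
        using i fs' by (intro inv_into_f_f) (auto simp: bij_betw_def)
      then show ?thesis using j by blast
    qed
    have "(\<Sum>i<card U. open_cost I (fs i)) = (\<Sum>f\<in>U. open_cost I f)"
      by (rule sum.reindex_bij_betw[OF fs'])
    also have "\<dots> \<le> (\<Sum>f\<in>S. open_cost I f)"
      using fin U I S by (intro sum_mono2) (auto simp: fl_instance_def fl_solution_def)
    finally show "(\<Sum>i<card U. open_cost I (fs i)) + (\<Sum>j\<in>clients I. distance I j (fs (\<phi> j))) \<le> fl_cost I S"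
      unfolding fl_cost_def by (simp add: ph \<psi>(2))
  qed
qed

lemma approximation_algorithm:
  fixes N :: nat
  assumes N: "1 \<le> N"
  shows "\<exists>g P. fl_approx_algorithm (alpha_FL + 15 / N) (\<lambda>k n. g k * n ^ 12) P"
proof -
  \<comment> \<open>Machine constants are rational, hence e = p = 1 / N; \<open>r\<delta>\<close>
    lacks the factor 1 / k, which is only known at run time.\<close>
  define r\<delta> rp rb :: rat where "r\<delta> = (1 / of_nat N) ^ 3 / 48" and "rp = 1 / of_nat N" and "rb = 1 / (1 + 1 / of_nat N)"
  define K M0 where "K = 48 * N ^ 3" and "M0 = 4 * N + 5"
  define e where "e = 1 / real N"
  have rats: "real_of_rat r\<delta> = e ^ 3 / 48" "real_of_rat rp = e" "real_of_rat rb = 1 / (1 + e)"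
    unfolding r\<delta>_def rp_def rb_def e_def
    by (simp_all add: of_rat_divide of_rat_power of_rat_add)
  obtain g where g: "\<And>n k lg B L. 1 \<le> n \<Longrightarrow> 1 \<le> lg \<Longrightarrow> 2 ^ lg \<le> 4 * n \<Longrightarrow> B = K * (k + 1) * lg \<Longrightarrow>
     L = 3 * k + 2 + M0 * k \<Longrightarrow>
     tS (n + k + B + L + B ^ L + M0) (PRELUDE1 K M0) + tS (n + k + B + L + B ^ L + M0) PRELUDE2 +
     tS (n + k + B + L + B ^ L + M0) (MAIN r\<delta> rp rb) + 7 \<le> g k * n ^ 12"
    using time_bound[of K M0 r\<delta> rp rb] by blast
  have "\<exists>t s. exec (PROGRAM K M0 r\<delta> rp rb) (encode I k) t s \<and> t \<le> g k * n ^ 12 \<and>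
      fl_solution I (decode n s) \<and> fl_cost I (decode n s) \<le> (alpha_FL + 15 / N) * fl_cost I Opt"
    if I: "fl_instance I" "points I = {..<n}" and Opt: "fl_optimal I Opt" "card Opt = k" for n I k Opt
  proof -
    define C Fc d cost where "C = clients I" and "Fc = facilities I" and "d = distance I" and "cost = open_cost I"
    have pts: "fl_points n d C Fc cost" using I
      by (simp add: fl_points_def fl_instance_def C_def Fc_def d_def cost_def)
    have n: "1 \<le> n" using I by (auto simp: fl_instance_def Suc_le_eq)
    have card: "card (points I) = n" using I by simp
    define \<rho> :: "nat \<Rightarrow> nat" where "\<rho> = (\<lambda>_. 0)(0 := n, 1 := k)"
    define \<sigma> where "\<sigma> = (narr (encode I k), rarr (encode I k))"
    have "corresponds {0, 1} \<rho> \<sigma> (encode I k)"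
      by (simp add: corresponds_def \<sigma>_def \<rho>_def encode_def Let_def card)
    from PROGRAM_exec[OF this \<rho>_def n, of K M0 r\<delta> rp rb]
    obtain lg B L where lg: "1 \<le> lg" "n < 2 ^ lg" "2 ^ lg \<le> 4 * n" "B = K * (k + 1) * lg"
      "L = 3 * k + 2 + M0 * k" and ex: "\<And>m. n + k + B + L + B ^ L + M0 \<le> m \<Longrightarrow>
      (\<exists>s' t. exec (PROGRAM K M0 r\<delta> rp rb) (encode I k) t s' \<and>
         t \<le> tS m (PRELUDE1 K M0) + tS m PRELUDE2 + tS m (MAIN r\<delta> rp rb) + 7 \<and>
         corresponds {0, 1, 2, 3, 4, 5} (\<rho>(2 := B, 3 := L, 4 := B ^ L, 5 := M0))
           (sem (MAIN r\<delta> rp rb) (\<rho>(2 := B, 3 := L, 4 := B ^ L, 5 := M0))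
              (sem PRELUDE2 (\<rho>(2 := B, 3 := L)) (sem (PRELUDE1 K M0) \<rho> \<sigma>))) s')" by blast
    define \<rho>' where "\<rho>' = \<rho>(2 := B, 3 := L, 4 := B ^ L, 5 := M0)"
    define \<sigma>' where "\<sigma>' = sem PRELUDE2 (\<rho>(2 := B, 3 := L)) (sem (PRELUDE1 K M0) \<rho> \<sigma>)"
    define \<sigma>'' where "\<sigma>'' = sem (MAIN r\<delta> rp rb) \<rho>' \<sigma>'"
    obtain s t where run: "exec (PROGRAM K M0 r\<delta> rp rb) (encode I k) t s"
      "t \<le> tS (n + k + B + L + B ^ L + M0) (PRELUDE1 K M0) + tS (n + k + B + L + B ^ L + M0) PRELUDE2 +
         tS (n + k + B + L + B ^ L + M0) (MAIN r\<delta> rp rb) + 7"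
      "corresponds {0, 1, 2, 3, 4, 5} \<rho>' \<sigma>'' s"
      using ex[OF order_refl] unfolding \<rho>'_def \<sigma>''_def \<sigma>'_def by blast
    have tg: "t \<le> g k * n ^ 12" by (rule le_trans[OF run(2) g[OF n lg(1,3-5)]])
    have arr: "fst \<sigma>' A = fst \<sigma> A" "snd \<sigma>' D = snd \<sigma> D" if "A < 14" for A D
      using that unfolding \<sigma>'_def by (auto simp: sem_frame)
    have init: "fst \<sigma> 0 = (\<lambda>v. if v \<in> C then 1 else 0)" "fst \<sigma> 1 = (\<lambda>v. if v \<in> Fc then 1 else 0)"
      "\<And>A. 2 \<le> A \<Longrightarrow> fst \<sigma> A = (\<lambda>_. 0)" "snd \<sigma> 1 = (\<lambda>v. if v \<in> Fc then cost v else 0)"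
      "snd \<sigma> 0 = (\<lambda>i. if i < n * n then d (i div n) (i mod n) else 0)"
      by (auto simp: \<sigma>_def encode_def Let_def card C_def Fc_def cost_def d_def)
    have r0: "\<rho>' 0 = n" by (simp add: \<rho>'_def \<rho>_def)
    have dec: "decode n s = {f. f < n \<and> fst \<sigma>'' 2 f \<noteq> 0}" using run(3) by (simp add: decode_def corresponds_def)
    have finC: "finite C" by (rule fl_points.finite_CF(1)[OF pts])
    have "(\<Sum>j<n. if 1 \<le> fst \<sigma>' 0 j then 1 else (0::real)) = (\<Sum>j<n. if j \<in> C then 1 else 0)"
      using arr(1)[of 0] init(1) by (intro sum.cong refl) auto
    also have "\<dots> = card ({..<n} \<inter> C)" by (subst sum.inter_restrict[symmetric]) auto
    also have "{..<n} \<inter> C = C" using I by (auto simp: fl_instance_def C_def)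
    finally have sumC: "evR (RSum 10 0 (IND (NC 1) (NA 0 (NV 10)))) \<rho>' \<sigma>' = card C" using r0 by simp
    have opt: "fl_solution I Opt" using Opt by (simp add: fl_optimal_def)
    have "fl_solution I (decode n s) \<and> fl_cost I (decode n s) \<le> (alpha_FL + 15 / N) * fl_cost I Opt"
    proof (cases "C = {}")
      case True
      have "\<sigma>'' = \<sigma>'" unfolding \<sigma>''_def MAIN_def sem.simps(6) sumC using True by simp
      then have "decode n s = {}" unfolding dec using arr(1)[of 2] init(3)[of 2] by simp
      moreover have "0 \<le> fl_cost I Opt" by (rule fl_cost_nonneg[OF I(1) opt])
      ultimately show ?thesis using True alpha_FL_approx by (simp add: fl_solution_def fl_cost_def C_def)
    next
      case False
      have "1 \<le> card C" using False finC by (simp add: Suc_le_eq card_gt_0_iff)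
      then have \<sigma>'': "\<sigma>'' = sem (SEARCH r\<delta> rp rb) \<rho>' (sem (SETUP rb) \<rho>' \<sigma>')"
        unfolding \<sigma>''_def MAIN_def sem.simps(6) sumC by simp
      obtain k' fs \<phi> where cl: "1 \<le> k'" "k' \<le> card Opt" "\<And>i. i < k' \<Longrightarrow> fs i \<in> Opt" "\<And>j. j \<in> C \<Longrightarrow> \<phi> j < k'"
        "\<And>i. i < k' \<Longrightarrow> \<exists>j\<in>C. \<phi> j = i"
        "(\<Sum>i<k'. cost (fs i)) + (\<Sum>j\<in>C. d j (fs (\<phi> j))) \<le> fl_cost I Opt"
        proof (rule solution_clusters[OF I(1) opt False[unfolded C_def]], goal_cases)
        case (1 k' fs \<phi>)
        show ?case by (rule 1(1)[of k' fs \<phi>]; (unfold C_def cost_def d_def)?; fact 1)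
      qed
      have k: "1 \<le> k" using cl Opt by simp
      have B: "B = 48 * N ^ 3 * (k + 1) * lg" using lg by (simp add: K_def)
      note par = parameters[OF N k lg(1) n lg(2) B e_def]
      have e: "0 < e" "e \<le> 1" using N by (auto simp: e_def)
      interpret fl_points n d C Fc cost by (rule pts)
      have clusters: "fl_clusters n d C Fc cost k (e ^ 3 / (48 * real k)) (1 / (1 + e)) e M0 k' fs \<phi> e B N"
        using cl opt N e par Opt(2) by unfold_locales (auto simp: fl_solution_def Fc_def M0_def e_def)
      have \<delta>k: "e ^ 3 / (48 * real k) = real_of_rat r\<delta> / real k" by (simp add: rats(1))
      have prog: "fl_prog n d C Fc cost k (e ^ 3 / (48 * real k)) (1 / (1 + e)) e M0 L r\<delta> rb rp"
        using False k e lg(5) rats \<delta>k by unfold_locales auto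
      interpret pr: fl_prog n d C Fc cost k "e ^ 3 / (48 * real k)" "1 / (1 + e)" e M0 B L r\<delta> rb rp by (rule prog)
      have env: "pr.env \<rho>'" "\<rho>' 4 = B ^ L" by (auto simp: pr.env_def \<rho>'_def \<rho>_def)
      have "pr.ready (sem (SETUP rb) \<rho>' \<sigma>')"
      proof (rule pr.SETUP_sem[OF env(1)])
        show "\<forall>u<n. \<forall>w<n. snd \<sigma>' 0 (u * n + w) = d u w"
        proof (intro allI impI)
          fix u w assume uw: "u < n" "w < n"
          have "u * n + w < Suc u * n" using uw by simp
          also have "\<dots> \<le> n * n" using uw by (intro mult_le_mono1) simp
          finally show "snd \<sigma>' 0 (u * n + w) = d u w" using uw arr(2)[of 0 0] init(5) by simp
        qed
      qed (use arr(1) arr(2)[of 0] init in auto)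
      moreover have "\<forall>A\<in>{4, 7, 13}. \<forall>l. fst (sem (SETUP rb) \<rho>' \<sigma>') A l = 0"
        using arr(1) init(3) by (auto simp: sem_frame)
      ultimately have out: "decode n s \<noteq> {} \<and> decode n s \<subseteq> Fc \<and> pr.val (decode n s) \<le> (alpha_FL + 5 / N + 10 * e) *
        ((\<Sum>i<k'. cost (fs i)) + (\<Sum>j\<in>C. d j (fs (\<phi> j))))"
        using SEARCH_solution[OF clusters prog rats(3) env] dec unfolding \<sigma>'' by blast
      have "fl_cost I (decode n s) = pr.val (decode n s)"
        unfolding pr.val_def by (simp add: fl_cost_def dist_to_set_def C_def cost_def d_def)
      also have "\<dots> \<le> (alpha_FL + 5 / N + 10 * e) * ((\<Sum>i<k'. cost (fs i)) + (\<Sum>j\<in>C. d j (fs (\<phi> j))))"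
        using out by simp
      also have "\<dots> \<le> (alpha_FL + 5 / N + 10 * e) * fl_cost I Opt"
        using cl(6) alpha_FL_approx e by (intro mult_left_mono) auto
      \<comment> \<open>5 / N is lost in rounding the number of rounds, and 10 e in anchors and
        radii.\<close>
      also have "alpha_FL + 5 / N + 10 * e = alpha_FL + 15 / N" by (simp add: e_def)
      finally show ?thesis using out by (simp add: fl_solution_def Fc_def)
    qed
    then show ?thesis using run(1) tg by blast
  qed
  then have "fl_approx_algorithm (alpha_FL + 15 / N) (\<lambda>k n. g k * n ^ 12) (PROGRAM K M0 r\<delta> rp rb)"
    unfolding fl_approx_algorithm_def by blast
  then show ?thesis by blast
qed

lemma fl_approx_algorithm_mono:
  assumes "fl_approx_algorithm \<rho> T P" "\<rho> \<le> \<rho>'"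
  shows "fl_approx_algorithm \<rho>' T P"
  unfolding fl_approx_algorithm_def
proof (intro allI impI)
  fix n k Opt and I :: "nat fl_instance"
  assume a: "fl_instance I \<and> points I = {..<n} \<and> fl_optimal I Opt \<and> card Opt = k"
  obtain t s where s: "exec P (encode I k) t s" "t \<le> T k n" "fl_solution I (decode n s)"
    "fl_cost I (decode n s) \<le> \<rho> * fl_cost I Opt"
    using assms(1)[unfolded fl_approx_algorithm_def, rule_format, OF a] by (elim exE conjE)
  have "fl_instance I" "fl_solution I Opt" using a by (simp_all add: fl_optimal_def)
  then have "0 \<le> fl_cost I Opt" by (rule fl_cost_nonneg)
  then have "\<rho> * fl_cost I Opt \<le> \<rho>' * fl_cost I Opt" by (rule mult_right_mono[OF assms(2)])
  with s(4) have "fl_cost I (decode n s) \<le> \<rho>' * fl_cost I Opt" by (rule order_trans)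
  then show "\<exists>t s. exec P (encode I k) t s \<and> t \<le> T k n \<and> fl_solution I (decode n s) \<and>
    fl_cost I (decode n s) \<le> \<rho>' * fl_cost I Opt" by (intro exI conjI) (rule s(1-3))+
qed

theorem theorem4:
  shows "\<exists>(f :: nat \<Rightarrow> real \<Rightarrow> nat) (c :: nat). \<forall>\<epsilon>>0. \<exists>P.
           fl_approx_algorithm (alpha_FL + \<epsilon>) (\<lambda>k n. f k \<epsilon> * n ^ c) P"
proof -
  \<comment> \<open>The premise stands inside the existential so that \<open>choice\<close> applies
    to all reals and merges the time bounds into one function of k and \<epsilon>.\<close>
  have "\<exists>g. 0 < \<epsilon> \<longrightarrow> (\<exists>P. fl_approx_algorithm (alpha_FL + \<epsilon>) (\<lambda>k n. g k * n ^ 12) P)" for \<epsilon> :: real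
  proof (cases "0 < \<epsilon>")
    case True
    obtain N :: nat where N: "15 / \<epsilon> < real N" using reals_Archimedean2 ..
    have "0 < 15 / \<epsilon>" using True by simp
    then have N0: "0 < real N" using N by linarith
    have "15 / N \<le> \<epsilon>" using N True N0 by (simp add: field_simps)
    then have le: "alpha_FL + 15 / N \<le> alpha_FL + \<epsilon>" by simp
    have N1: "1 \<le> N" using N0 by simp
    obtain g P where "fl_approx_algorithm (alpha_FL + 15 / N) (\<lambda>k n. g k * n ^ 12) P"
      using approximation_algorithm[OF N1] by (elim exE)
    from fl_approx_algorithm_mono[OF this le] show ?thesis by (intro exI impI)
  qed simp
  then have "\<forall>\<epsilon>. \<exists>g. 0 < \<epsilon> \<longrightarrow> (\<exists>P. fl_approx_algorithm (alpha_FL + \<epsilon>) (\<lambda>k n. g k * n ^ 12) P)" ..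
  from choice[OF this] obtain g where
    "\<forall>\<epsilon>>0. \<exists>P. fl_approx_algorithm (alpha_FL + \<epsilon>) (\<lambda>k n. g \<epsilon> k * n ^ 12) P" ..
  then show ?thesis by (rule exI[of _ "\<lambda>k \<epsilon>. g \<epsilon> k", OF exI[of _ 12]])
qed

end
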